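(* Let $F$ denote a self-similar set associated with the iterated function system $\Phi=\{\phi_1,\dots,\phi_N\}$ acting on $X$. Assume that $\Phi$ satisfies the open set condition with feasible open set $\operatorname{int}X$ and that $\lambda^1(F)=0$. Let $r_1,\dots,r_N$ denote the respective similarity ratios of the maps $\phi_1,\dots,\phi_N$. Let $\delta$ denote the Minkowski dimension of $F$ and let $\nu$ be the $\delta$-conformal measure associated with $F$. Then the following hold. (i) The average fractal curvature measures of $F$ exist and are given by $$\widetilde C_0^f(F,\cdot)=\frac{2^{-\delta}\sum_{i=1}^{Q-1}|L^i|^\delta}{-\delta\sum_{i\in\Sigma}\ln(r_i)r_i^\delta}\cdot\nu(\cdot)\qquad\text{and}\qquad\widetilde C_1^f(F,\cdot)=\frac{2^{1-\delta}\sum_{i=1}^{Q-1}|L^i|^\delta}{(\delta-1)\delta\sum_{i\in\Sigma}\ln(r_i)r_i^\delta}\cdot\nu(\cdot).$$ (ii) If $\Phi$ is lattice, then for $k\in\{0,1\}$ and for every Borel set $B\subseteq\mathbb R$ for which $F\cap B$ is nonempty and allows a representation as a finite union of sets of the form $\phi_\omega F$, where $\omega\in\Sigma^*$, and for which $F_\varepsilon\cap B=(F\cap B)_\varepsilon$ for all sufficiently small $\varepsilon>0$, we have $$0<\underline C_k^f(F,B)<\overline C_k^f(F,B)<\infty.$$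
   Context: **Iterated function systems.** $X\subset\mathbb R$ is a nonempty compact interval, $N\ge2$, and $\phi_1,\dots,\phi_N\colon X\to X$ are similarities with similarity ratios $r_i=|\phi_i'|\in(0,1)$. The self-similar set $F$ associated with $\Phi$ is the unique nonempty compact set with $F=\bigcup_i\phi_i(F)$. $\Phi$ satisfies the open set condition with feasible open set $O$ if $O\subset\mathbb R$ is nonempty, open and bounded, $\bigcup_i\phi_i(O)\subseteq O$ and $\phi_i(O)\cap\phi_j(O)=\emptyset$ for $i\ne j$. The Minkowski dimension $\delta=1-\lim_{\varepsilon\searrow0}\ln\lambda^1(F_\varepsilon)/\ln\varepsilon$ exists. **Symbolic notation.** $\Sigma=\{1,\dots,N\}$; $\Sigma^*$ is the set of all finite words over $\Sigma$ including the empty word; $\Sigma^\infty$ is the set of infinite words with the topology of pointwise convergence and $\sigma$ is the left shift. For $\omega=\omega_1\cdots\omega_n\in\Sigma^*$, $\phi_\omega=\phi_{\omega_1}\circ\cdots\circ\phi_{\omega_n}$ and $\phi_\emptyset=\mathrm{id}_X$. **Gaps.** The primary gaps $L^1,\dots,L^{Q-1}$ of $F$ are the gap intervals obtained by applying $\Phi$ to the convex hull $\langle F\rangle$ of $F$ (the connected components of $\langle F\rangle\setminus\bigcup_i\phi_i\langle F\rangle$); $2\le Q\le N$ as $\lambda^1(F)=0$. $|\cdot|$ denotes length. **Lattice property.** The geometric potential function is $\xi\colon\Sigma^\infty\to\mathbb R$, $\xi(\omega)=-\ln r_{\omega_1}$. $\Phi$ is lattice if $\xi$ is lattice, i.e.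 there are continuous $\zeta,\psi\colon\Sigma^\infty\to\mathbb R$ with $\xi-\zeta=\psi-\psi\circ\sigma$ and the range of $\zeta$ contained in a discrete subgroup of $\mathbb R$. **Conformal measure.** $\nu$ is the unique probability measure supported on $F$ with $\nu(\phi_iX\cap\phi_jX)=0$ for $i\ne j$ and $\nu(\phi_iB)=\int_B|\phi_i'|^\delta\,d\nu$ for all $i$ and all Borel $B\subseteq X$. **Curvature measures.** $\lambda^0$ is counting measure, $\lambda^1$ Lebesgue measure on $\mathbb R$, $Y_\varepsilon=\{x\in\mathbb R:\inf_{y\in Y}|x-y|\le\varepsilon\}$ and $\partial$ is the boundary. For $Y\subset\mathbb R$ nonempty compact, $s_0(Y)=\inf\{t\in\mathbb R:\varepsilon^t\lambda^0(\partial Y_\varepsilon)\to0\text{ as }\varepsilon\to0\}$ and $s_1(Y)=\inf\{t\in\mathbb R:\varepsilon^t\lambda^1(Y_\varepsilon)\to0\text{ as }\varepsilon\to0\}$. For Borel $B\subseteq\mathbb R$, $\overline C_k^f(Y,B)$ and $\underline C_k^f(Y,B)$ are the $\limsup$ and $\liminf$ as $\varepsilon\to0$ of $\varepsilon^{s_0(Y)}\lambda^0(\partial Y_\varepsilon\cap B)/2$ (for $k=0$) and of $\varepsilon^{s_1(Y)}\lambda^1(Y_\varepsilon\cap B)$ (for $k=1$). The average fractal curvature measures are the weak limits (of finite Borel measures), if they exist, $$\widetilde C_0^f(Y,\cdot)=\operatorname*{w-lim}_{T\searrow0}\frac1{2|\ln T|}\int_T^1\varepsilon^{s_0(Y)-1}\lambda^0(\partial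 Y_\varepsilon\cap\cdot)\,d\varepsilon,\qquad \widetilde C_1^f(Y,\cdot)=\operatorname*{w-lim}_{T\searrow0}\frac1{|\ln T|}\int_T^1\varepsilon^{s_1(Y)-1}\lambda^1(Y_\varepsilon\cap\cdot)\,d\varepsilon.$$ *)

theory Defs
  imports "HOL-Probability.Probability_Measure"
begin

subsection \<open>Iterated function systems on an interval\<close>

text \<open>The alphabet is \<open>{1..N}\<close>. The maps are total functions on the reals of which only the values on
  \<open>X\<close> matter, so the ratio (the constant value of the modulus of the derivative on \<open>X\<close>) is expressed
  through distances of points of \<open>X\<close>.\<close>

definition similarity_on :: "real set \<Rightarrow> real \<Rightarrow> (real \<Rightarrow> real) \<Rightarrow> bool" where
  "similarity_on X c f \<longleftrightarrow> (\<forall>x\<in>X. \<forall>y\<in>X. dist (f x) (f y) = c * dist x y)"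

definition similarity_ifs :: "real set \<Rightarrow> nat \<Rightarrow> (nat \<Rightarrow> real \<Rightarrow> real) \<Rightarrow> (nat \<Rightarrow> real) \<Rightarrow> bool" where
  "similarity_ifs X N \<phi> r \<longleftrightarrow>
     X \<noteq> {} \<and> is_interval X \<and> compact X \<and> N \<ge> 2 \<and>
     (\<forall>i\<in>{1..N}. \<phi> i ` X \<subseteq> X \<and> 0 < r i \<and> r i < 1 \<and> similarity_on X (r i) (\<phi> i))"

definition self_similar_set :: "real set \<Rightarrow> nat \<Rightarrow> (nat \<Rightarrow> real \<Rightarrow> real) \<Rightarrow> real set \<Rightarrow> bool" where
  "self_similar_set X N \<phi> F \<longleftrightarrow>
     F \<subseteq> X \<and> F \<noteq> {} \<and> compact F \<and> F = (\<Union>i\<in>{1..N}. \<phi> i ` F)"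

definition feasible_open_set :: "nat \<Rightarrow> (nat \<Rightarrow> real \<Rightarrow> real) \<Rightarrow> real set \<Rightarrow> bool" where
  "feasible_open_set N \<phi> U \<longleftrightarrow>
     U \<noteq> {} \<and> open U \<and> bounded U \<and> (\<Union>i\<in>{1..N}. \<phi> i ` U) \<subseteq> U \<and>
     (\<forall>i\<in>{1..N}. \<forall>j\<in>{1..N}. i \<noteq> j \<longrightarrow> \<phi> i ` U \<inter> \<phi> j ` U = {})"

definition word_map :: "(nat \<Rightarrow> real \<Rightarrow> real) \<Rightarrow> nat list \<Rightarrow> real \<Rightarrow> real" where
  "word_map \<phi> w = foldr (\<circ>) (map \<phi> w) id"

definition primary_gaps :: "nat \<Rightarrow> (nat \<Rightarrow> real \<Rightarrow> real) \<Rightarrow> real set \<Rightarrow> real set set" where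
  "primary_gaps N \<phi> F = components (convex hull F - (\<Union>i\<in>{1..N}. \<phi> i ` (convex hull F)))"

subsection \<open>The lattice property\<close>

text \<open>An infinite word \<open>\<omega>\<close> has first letter \<open>\<omega> 0\<close>. The type \<^typ>\<open>nat \<Rightarrow> nat\<close> carries the product of
  the discrete topologies, that is, the topology of pointwise convergence.\<close>

definition infinite_words :: "nat \<Rightarrow> (nat \<Rightarrow> nat) set" where
  "infinite_words N = {\<omega>. \<forall>n. \<omega> n \<in> {1..N}}"

definition left_shift :: "(nat \<Rightarrow> nat) \<Rightarrow> (nat \<Rightarrow> nat)" where
  "left_shift \<omega> = (\<lambda>n. \<omega> (Suc n))"

definition geometric_potential :: "(nat \<Rightarrow> real) \<Rightarrow> (nat \<Rightarrow> nat) \<Rightarrow> real" where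
  "geometric_potential r \<omega> = - ln (r (\<omega> 0))"

definition discrete_subgroup :: "real set \<Rightarrow> bool" where
  "discrete_subgroup G \<longleftrightarrow>
     0 \<in> G \<and> (\<forall>x\<in>G. \<forall>y\<in>G. x + y \<in> G) \<and> (\<forall>x\<in>G. - x \<in> G) \<and> discrete G"

definition lattice_potential :: "nat \<Rightarrow> ((nat \<Rightarrow> nat) \<Rightarrow> real) \<Rightarrow> bool" where
  "lattice_potential N \<xi> \<longleftrightarrow>
     (\<exists>\<zeta> \<psi>. continuous_on (infinite_words N) \<zeta> \<and> continuous_on (infinite_words N) \<psi> \<and>
        (\<forall>\<omega>\<in>infinite_words N. \<xi> \<omega> - \<zeta> \<omega> = \<psi> \<omega> - \<psi> (left_shift \<omega>)) \<and>
        (\<exists>G. discrete_subgroup G \<and> \<zeta> ` infinite_words N \<subseteq> G))"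

definition lattice_ifs :: "nat \<Rightarrow> (nat \<Rightarrow> real) \<Rightarrow> bool" where
  "lattice_ifs N r \<longleftrightarrow> lattice_potential N (geometric_potential r)"

subsection \<open>Parallel sets, Minkowski dimension and conformal measure\<close>

text \<open>For nonempty \<open>Y\<close>, \<^term>\<open>infdist x Y\<close> is the infimum of the distances; for empty \<open>Y\<close> it is \<open>0\<close> by
  convention. Only nonempty sets occur below.\<close>

definition parallel_set :: "real set \<Rightarrow> real \<Rightarrow> real set" where
  "parallel_set Y \<epsilon> = {x. infdist x Y \<le> \<epsilon>}"

definition minkowski_dim :: "real set \<Rightarrow> real" where
  "minkowski_dim Y = 1 - Lim (at_right 0) (\<lambda>\<epsilon>. ln (measure lborel (parallel_set Y \<epsilon>)) / ln \<epsilon>)"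

definition conformal_measure ::
    "real set \<Rightarrow> nat \<Rightarrow> (nat \<Rightarrow> real \<Rightarrow> real) \<Rightarrow> (nat \<Rightarrow> real) \<Rightarrow> real set \<Rightarrow> real \<Rightarrow> real measure \<Rightarrow> bool" where
  "conformal_measure X N \<phi> r F \<delta> \<nu> \<longleftrightarrow>
     sets \<nu> = sets borel \<and> prob_space \<nu> \<and> emeasure \<nu> (- F) = 0 \<and>
     (\<forall>i\<in>{1..N}. \<forall>j\<in>{1..N}. i \<noteq> j \<longrightarrow> emeasure \<nu> (\<phi> i ` X \<inter> \<phi> j ` X) = 0) \<and>
     (\<forall>i\<in>{1..N}. \<forall>B\<in>sets borel. B \<subseteq> X \<longrightarrow>
        emeasure \<nu> (\<phi> i ` B) = (\<integral>\<^sup>+x\<in>B. ennreal (r i powr \<delta>) \<partial>\<nu>))"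

subsection \<open>Fractal curvature measures\<close>

abbreviation counting :: "real measure" where
  "counting \<equiv> count_space UNIV"

definition scaling_exponent0 :: "real set \<Rightarrow> real" where
  "scaling_exponent0 Y = Inf {t. ((\<lambda>\<epsilon>. ennreal (\<epsilon> powr t) *
     emeasure counting (frontier (parallel_set Y \<epsilon>))) \<longlongrightarrow> 0) (at_right 0)}"

definition scaling_exponent1 :: "real set \<Rightarrow> real" where
  "scaling_exponent1 Y = Inf {t. ((\<lambda>\<epsilon>. ennreal (\<epsilon> powr t) *
     emeasure lborel (parallel_set Y \<epsilon>)) \<longlongrightarrow> 0) (at_right 0)}"

definition upper_curv0 :: "real set \<Rightarrow> real set \<Rightarrow> ennreal" where
  "upper_curv0 Y B = Limsup (at_right 0) (\<lambda>\<epsilon>. ennreal (\<epsilon> powr scaling_exponent0 Y) *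
     emeasure counting (frontier (parallel_set Y \<epsilon>) \<inter> B) / 2)"

definition lower_curv0 :: "real set \<Rightarrow> real set \<Rightarrow> ennreal" where
  "lower_curv0 Y B = Liminf (at_right 0) (\<lambda>\<epsilon>. ennreal (\<epsilon> powr scaling_exponent0 Y) *
     emeasure counting (frontier (parallel_set Y \<epsilon>) \<inter> B) / 2)"

definition upper_curv1 :: "real set \<Rightarrow> real set \<Rightarrow> ennreal" where
  "upper_curv1 Y B = Limsup (at_right 0) (\<lambda>\<epsilon>. ennreal (\<epsilon> powr scaling_exponent1 Y) *
     emeasure lborel (parallel_set Y \<epsilon> \<inter> B))"

definition lower_curv1 :: "real set \<Rightarrow> real set \<Rightarrow> ennreal" where
  "lower_curv1 Y B = Liminf (at_right 0) (\<lambda>\<epsilon>. ennreal (\<epsilon> powr scaling_exponent1 Y) *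
     emeasure lborel (parallel_set Y \<epsilon> \<inter> B))"

text \<open>The measures whose weak limits as \<open>T\<close> decreases to \<open>0\<close> are the average fractal curvature
  measures.\<close>

definition avg_curv0 :: "real set \<Rightarrow> real \<Rightarrow> real measure" where
  "avg_curv0 Y T = measure_of UNIV (sets borel) (\<lambda>B. ennreal (1 / (2 * \<bar>ln T\<bar>)) *
     (\<integral>\<^sup>+\<epsilon>\<in>{T..1}. ennreal (\<epsilon> powr (scaling_exponent0 Y - 1)) *
        emeasure counting (frontier (parallel_set Y \<epsilon>) \<inter> B) \<partial>lborel))"

definition avg_curv1 :: "real set \<Rightarrow> real \<Rightarrow> real measure" where
  "avg_curv1 Y T = measure_of UNIV (sets borel) (\<lambda>B. ennreal (1 / \<bar>ln T\<bar>) *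
     (\<integral>\<^sup>+\<epsilon>\<in>{T..1}. ennreal (\<epsilon> powr (scaling_exponent1 Y - 1)) *
        emeasure lborel (parallel_set Y \<epsilon> \<inter> B) \<partial>lborel))"

text \<open>The library notion of weak convergence is pointwise convergence of sequences of distribution
  functions, which for measures that are not probability measures does not control the total mass.
  Hence weak convergence of finite Borel measures is defined by testing against bounded continuous
  functions.\<close>

definition weak_limit :: "('a \<Rightarrow> real measure) \<Rightarrow> real measure \<Rightarrow> 'a filter \<Rightarrow> bool" where
  "weak_limit M \<mu> A \<longleftrightarrow>
     finite_measure \<mu> \<and> sets \<mu> = sets borel \<and>
     (\<forall>\<^sub>F T in A. finite_measure (M T) \<and> sets (M T) = sets borel) \<and>
     (\<forall>f::real \<Rightarrow> real. continuous_on UNIV f \<and> bounded (range f) \<longrightarrow>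
        ((\<lambda>T. \<integral>x. f x \<partial>M T) \<longlongrightarrow> (\<integral>x. f x \<partial>\<mu>)) A)"

end

theory Submission
  imports Defs
begin

text \<open>Conformality of \<open>\<nu>\<close> forces \<open>\<Sum> r\<^sub>i powr \<delta> = 1\<close>. Every bounded complementary interval (gap) of
  \<open>F\<close> is the image of a primary gap under a word map. A gap of length \<open>\<ell>\<close> contributes two boundary points
  to the \<open>\<epsilon>\<close>-parallel set as long as \<open>2 \<epsilon> < \<ell>\<close>, and none afterwards, so the number of boundary points
  obeys a renewal equation. The averaged renewal equation is solved by comparison with
  functions linear in \<open>- ln T\<close>; this yields the limits of the average measures on cylinder sets and hence weak
  convergence. The volume is the integral of the number of boundary points, which reduces the case \<open>k = 1\<close>
  to the case \<open>k = 0\<close>. In the lattice case the gap lengths miss a geometric sequence of intervals; on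
  them the number of boundary points is constant and the volume affine, whereas convergence of the rescaled
  quantities would make them proportional to \<open>\<epsilon> powr (- \<delta>)\<close> and to the strictly concave
  \<open>\<epsilon> powr (1 - \<delta>)\<close>.\<close>

section \<open>Gaps of a compact set of reals\<close>

text \<open>The constants come from one integral. To the averaged count a gap of length l
  contributes \<epsilon>^(\<delta> - 1) integrated from T to l / 2; summed over the primary gaps
  with T tending to 0 this is the driving term \<open>prim_moment\<close>. The delays -ln r_i have
  mean \<open>mean_log\<close> under the weights r_i^\<delta>, and the quotient is the limit; the 2
  in the normalisation cancels against the two boundary points per gap. After averaging only the
  linear growth rate of the integrated count matters, and this rate is the same in the lattice and
  the non-lattice case. Two obstacles shape the rest. The normalising exponents are defined as
  infima and have to be evaluated exactly, so two-sided power bounds on the count precede every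
  limit. And images of the hull may touch: the touching points belong to F and are invisible to the
  averages, since no boundary point lies on F and F is Lebesgue null. The limit measure, however,
  lives on F, and for it the overlap condition of the conformal measure is used.\<close>

definition gaps :: "real set \<Rightarrow> real set set" where
  "gaps F = {{u<..<v} | u v. u < v \<and> u \<in> F \<and> v \<in> F \<and> {u<..<v} \<inter> F = {}}"

lemma gapE:
  assumes "C \<in> gaps F"
  obtains u v where "C = {u<..<v}" "u < v" "u \<in> F" "v \<in> F" "{u<..<v} \<inter> F = {}"
    "measure lborel C = v - u" "Inf C = u" "Sup C = v"
  using assms unfolding gaps_def by auto

lemma gapI: "u < v \<Longrightarrow> u \<in> F \<Longrightarrow> v \<in> F \<Longrightarrow> {u<..<v} \<inter> F = {} \<Longrightarrow> {u<..<v} \<in> gaps F"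
  unfolding gaps_def by blast

lemma gap_length_pos: "C \<in> gaps F \<Longrightarrow> 0 < measure lborel C"
  by (erule gapE) auto

lemma gaps_borel: "C \<in> gaps F \<Longrightarrow> C \<in> sets borel"
  by (erule gapE) simp

lemma gap_disjoint_set: "C \<in> gaps F \<Longrightarrow> C \<inter> F = {}"
  by (erule gapE) auto

text \<open>Endpoints of gaps lie in F, so neither interval contains an endpoint of the other;
  overlapping intervals with this property have the same endpoints.\<close>

lemma gaps_disjoint:
  assumes "C \<in> gaps F" "D \<in> gaps F" "C \<noteq> D"
  shows "C \<inter> D = {}"
proof (rule ccontr)
  assume "C \<inter> D \<noteq> {}"
  then obtain x where x: "x \<in> C" "x \<in> D" by blast
  from assms(1) obtain u v where C: "C = {u<..<v}" "u \<in> F" "v \<in> F" "{u<..<v} \<inter> F = {}" by (rule gapE)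
  from assms(2) obtain u' v' where D: "D = {u'<..<v'}" "u' \<in> F" "v' \<in> F" "{u'<..<v'} \<inter> F = {}"
    by (rule gapE)
  have "u \<notin> D" "v \<notin> D" "u' \<notin> C" "v' \<notin> C"
    using C D by blast+
  then have "u = u'" "v = v'" using x C(1) D(1) by auto
  then show False using C(1) D(1) assms(3) by auto
qed

locale compact_real =
  fixes F :: "real set"
  assumes compact_F: "compact F" and F_nonempty: "F \<noteq> {}"
begin

definition lo :: real where "lo = Inf F"
definition hi :: real where "hi = Sup F"

lemma closed_F: "closed F" and bdd_F: "bdd_below F" "bdd_above F"
  using compact_F by (auto simp: compact_imp_closed compact_imp_bounded bounded_imp_bdd_below bounded_imp_bdd_above)

lemma lo_in: "lo \<in> F" and hi_in: "hi \<in> F"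
  unfolding lo_def hi_def
  using closed_F bdd_F F_nonempty by (auto intro: closed_contains_Inf closed_contains_Sup)

lemma F_subset: "F \<subseteq> {lo..hi}"
  unfolding lo_def hi_def using bdd_F by (auto intro: cInf_lower cSup_upper)

lemma lo_le_hi: "lo \<le> hi"
  using lo_in F_subset by auto

lemma gap_subset: "C \<in> gaps F \<Longrightarrow> C \<subseteq> {lo<..<hi}"
  using F_subset by (elim gapE) fastforce

text \<open>The endpoints are the last point of F to the left of x and the first one to the right;
  both are attained because F is closed.\<close>

lemma in_gap:
  assumes "x \<notin> F" "lo \<le> x" "x \<le> hi"
  obtains C where "C \<in> gaps F" "x \<in> C"
proof -
  let ?u = "Sup (F \<inter> {..x})" and ?v = "Inf (F \<inter> {x..})"
  have bdd: "bdd_above (F \<inter> {..x})" "bdd_below (F \<inter> {x..})" by auto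
  have u: "?u \<in> F \<inter> {..x}"
    using closed_F assms lo_in bdd by (intro closed_contains_Sup) auto
  have v: "?v \<in> F \<inter> {x..}"
    using closed_F assms hi_in bdd by (intro closed_contains_Inf) auto
  have ux: "?u < x" using u assms(1) by (metis IntD1 IntD2 atMost_iff less_le)
  have xv: "x < ?v" using v assms(1) by (metis IntD1 IntD2 atLeast_iff less_le)
  have "{?u<..<?v} \<inter> F = {}"
  proof (rule ccontr)
    assume "{?u<..<?v} \<inter> F \<noteq> {}"
    then obtain z where z: "z \<in> F" "?u < z" "z < ?v" by auto
    show False
    proof (cases "z \<le> x")
      case True
      then have "z \<le> ?u" using z bdd by (intro cSup_upper) auto
      then show False using z by simp
    next
      case False
      then have "?v \<le> z" using z bdd by (intro cInf_lower) auto
      then show False using z by simp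
    qed
  qed
  then have "{?u<..<?v} \<in> gaps F" using u v ux xv by (intro gapI) auto
  then show thesis using that ux xv by (meson greaterThanLessThan_iff)
qed

text \<open>Strict, to fit \<open>frontier_gap\<close>: with \<tau> = 2 * \<epsilon> these are
  exactly the gaps that carry boundary points. A gap of length exactly 2 * \<epsilon> is already
  filled.\<close>

definition long_gaps :: "real \<Rightarrow> real set set" where
  "long_gaps \<tau> = {C \<in> gaps F. \<tau> < measure lborel C}"

text \<open>Gaps are disjoint subsets of the hull, so k gaps longer than \<tau> force k * \<tau>
  \<le> \<open>hi - lo\<close>.\<close>

lemma finite_long_gaps:
  assumes "0 < \<tau>" shows "finite (long_gaps \<tau>)"
proof (rule finite_if_finite_subsets_card_bdd[THEN conjunct1])
  fix G assume G: "G \<subseteq> long_gaps \<tau>" "finite G"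
  have "card G * \<tau> = (\<Sum>C\<in>G. \<tau>)" by simp
  also have "\<dots> \<le> (\<Sum>C\<in>G. measure lborel C)"
    using G by (intro sum_mono) (auto simp: long_gaps_def)
  also have "\<dots> = measure lborel (\<Union>C\<in>G. C)"
  proof (rule measure_finite_Union[symmetric])
    show "disjoint_family_on (\<lambda>C. C) G"
      using G(1) gaps_disjoint unfolding disjoint_family_on_def long_gaps_def by blast
    show "(\<lambda>C. C) ` G \<subseteq> sets lborel"
      using G(1) gaps_borel by (auto simp: long_gaps_def)
    show "emeasure lborel C \<noteq> \<infinity>" if "C \<in> G" for C
    proof -
      have "C \<in> gaps F" using G(1) that by (auto simp: long_gaps_def)
      then show ?thesis by (rule gapE) simp
    qed
  qed (use G in auto)
  also have "\<dots> \<le> measure lborel {lo..hi}"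
  proof (rule measure_mono_fmeasurable)
    show "(\<Union>C\<in>G. C) \<subseteq> {lo..hi}"
    proof (rule UN_least)
      fix C assume "C \<in> G"
      then have "C \<subseteq> {lo<..<hi}" using G(1) by (intro gap_subset) (auto simp: long_gaps_def)
      then show "C \<subseteq> {lo..hi}" using greaterThanLessThan_subseteq_atLeastAtMost_iff[of lo hi lo hi] by simp
    qed
    show "(\<Union>C\<in>G. C) \<in> sets lborel"
      using G by (intro sets.finite_UN) (auto simp: long_gaps_def gaps_borel)
  qed (use lo_le_hi in \<open>simp add: fmeasurable_def\<close>)
  finally have "card G * \<tau> \<le> hi - lo" using lo_le_hi by simp
  then have "card G \<le> (hi - lo) / \<tau>" using assms by (simp add: field_simps)
  then show "card G \<le> nat \<lceil>(hi - lo) / \<tau>\<rceil>" by linarith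
qed

lemma countable_gaps: "countable (gaps F)"
proof -
  have "gaps F \<subseteq> (\<Union>n::nat. long_gaps (1 / Suc n))"
  proof
    fix C assume C: "C \<in> gaps F"
    obtain n where "inverse (real (Suc n)) < measure lborel C"
      using reals_Archimedean[OF gap_length_pos[OF C]] by blast
    then show "C \<in> (\<Union>n::nat. long_gaps (1 / Suc n))"
      using C unfolding long_gaps_def inverse_eq_divide by blast
  qed
  moreover have "countable (\<Union>n::nat. long_gaps (1 / Suc n))"
    by (intro countable_UN countableI_type countable_finite finite_long_gaps) simp
  ultimately show ?thesis by (rule countable_subset)
qed

section \<open>Distance to F and the boundary of its parallel sets\<close>

lemma infdist_gap:
  assumes "{u<..<v} \<inter> F = {}" "u \<in> F" "v \<in> F" "u \<le> x" "x \<le> v"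
  shows "infdist x F = min (x - u) (v - x)"
proof -
  obtain z where z: "z \<in> F" "infdist x F = dist x z"
    using infdist_attains_inf[OF closed_F F_nonempty] by blast
  have "infdist x F \<le> dist x u" "infdist x F \<le> dist x v" using assms by (auto intro: infdist_le)
  moreover have "z \<le> u \<or> v \<le> z" using z(1) assms(1) by (meson disjoint_iff greaterThanLessThan_iff not_le)
  ultimately show ?thesis using assms z by (auto simp: dist_real_def min_def)
qed

lemma infdist_below: "x \<le> lo \<Longrightarrow> infdist x F = lo - x"
proof -
  assume x: "x \<le> lo"
  obtain z where z: "z \<in> F" "infdist x F = dist x z"
    using infdist_attains_inf[OF closed_F F_nonempty] by blast
  have "infdist x F \<le> dist x lo" using lo_in by (auto intro: infdist_le)
  moreover have "lo \<le> z" using z F_subset by auto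
  ultimately show ?thesis using x z by (auto simp: dist_real_def)
qed

lemma infdist_above: "hi \<le> x \<Longrightarrow> infdist x F = x - hi"
proof -
  assume x: "hi \<le> x"
  obtain z where z: "z \<in> F" "infdist x F = dist x z"
    using infdist_attains_inf[OF closed_F F_nonempty] by blast
  have "infdist x F \<le> dist x hi" using hi_in by (auto intro: infdist_le)
  moreover have "z \<le> hi" using z F_subset by auto
  ultimately show ?thesis using x z by (auto simp: dist_real_def)
qed

lemma closed_parallel_set: "closed (parallel_set F \<epsilon>)"
  unfolding parallel_set_def by (intro closed_Collect_le continuous_intros)

lemma frontier_iff:
  "x \<in> frontier (parallel_set F \<epsilon>) \<longleftrightarrow>
     infdist x F \<le> \<epsilon> \<and> (\<forall>e>0. \<exists>y. \<bar>y - x\<bar> < e \<and> \<epsilon> < infdist y F)"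
proof -
  have "x \<in> frontier (parallel_set F \<epsilon>) \<longleftrightarrow> infdist x F \<le> \<epsilon> \<and> x \<notin> interior (parallel_set F \<epsilon>)"
    unfolding frontier_def closure_closed[OF closed_parallel_set] by (simp add: parallel_set_def)
  also have "x \<notin> interior (parallel_set F \<epsilon>) \<longleftrightarrow> (\<forall>e>0. \<exists>y. \<bar>y - x\<bar> < e \<and> \<epsilon> < infdist y F)"
    by (simp add: mem_interior subset_eq parallel_set_def dist_real_def not_le abs_minus_commute Bex_def)
  finally show ?thesis .
qed

lemma frontierD:
  assumes "x \<in> frontier (parallel_set F \<epsilon>)"
  shows "infdist x F \<le> \<epsilon>" and "0 < e \<Longrightarrow> \<exists>y. \<bar>y - x\<bar> < e \<and> \<epsilon> < infdist y F"
  using assms unfolding frontier_iff by blast+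

lemma frontierI:
  assumes "infdist x F \<le> \<epsilon>" and "\<And>e. 0 < e \<Longrightarrow> \<exists>y. \<bar>y - x\<bar> < e \<and> \<epsilon> < infdist y F"
  shows "x \<in> frontier (parallel_set F \<epsilon>)"
  using assms unfolding frontier_iff by blast

text \<open>The distance to F is 1-Lipschitz, so a point at distance below \<epsilon> is interior to
  the parallel set.\<close>

lemma frontier_infdist:
  assumes "x \<in> frontier (parallel_set F \<epsilon>)" shows "infdist x F = \<epsilon>"
proof (rule ccontr)
  assume "infdist x F \<noteq> \<epsilon>"
  then have "0 < \<epsilon> - infdist x F" using frontierD(1)[OF assms] by simp
  then obtain y where "\<bar>y - x\<bar> < \<epsilon> - infdist x F" "\<epsilon> < infdist y F"
    using frontierD(2)[OF assms] by blast
  then show False using infdist_triangle[of y F x] by (simp add: dist_real_def)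
qed

lemma frontier_disjoint: "0 < \<epsilon> \<Longrightarrow> frontier (parallel_set F \<epsilon>) \<inter> F = {}"
  using frontier_infdist by fastforce

lemma frontier_gap:
  assumes g: "{u<..<v} \<inter> F = {}" "u \<in> F" "v \<in> F" "u < v" and e: "0 < \<epsilon>"
  shows "frontier (parallel_set F \<epsilon>) \<inter> {u<..<v} = (if 2 * \<epsilon> < v - u then {u + \<epsilon>, v - \<epsilon>} else {})"
proof -
  have d: "infdist x F = min (x - u) (v - x)" if "u \<le> x" "x \<le> v" for x
    using infdist_gap[OF g(1-3)] that by simp
  have 1: "2 * \<epsilon> < v - u \<and> x \<in> {u + \<epsilon>, v - \<epsilon>}"
    if x: "x \<in> frontier (parallel_set F \<epsilon>)" "u < x" "x < v" for x
  proof -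
    have dx: "min (x - u) (v - x) = \<epsilon>" using frontier_infdist[OF x(1)] d x by simp
    have "2 * \<epsilon> < v - u"
    proof (rule ccontr)
      assume n: "\<not> 2 * \<epsilon> < v - u"
      \<comment> \<open>Both endpoints are at least \<epsilon> away from x, so y still lies between
        them; there the distance to F is at most \<open>(v - u) / 2\<close>, which does not exceed
        \<epsilon>.\<close>
      obtain y where y: "\<bar>y - x\<bar> < \<epsilon>" "\<epsilon> < infdist y F"
        using frontierD(2)[OF x(1) e] by blast
      have "u \<le> y" "y \<le> v" using y(1) n dx by (auto simp: min_def split: if_splits)
      then show False using y n d by auto
    qed
    then show ?thesis using dx by (auto simp: min_def split: if_splits)
  qed
  have 2: "u + \<epsilon> \<in> frontier (parallel_set F \<epsilon>)" "v - \<epsilon> \<in> frontier (parallel_set F \<epsilon>)" if l: "2 * \<epsilon> < v - u"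
  proof -
    \<comment> \<open>The witness moves into the gap by at most \<eta> / 2 and never beyond the
      midpoint, which is reached for the increment \<open>(v - u - 2*\<epsilon>)/2\<close>; up to
      there the distance to F grows.\<close>
    have "\<exists>y. \<bar>y - (u + \<epsilon>)\<bar> < \<eta> \<and> \<epsilon> < infdist y F" if "0 < \<eta>" for \<eta>
      using l e that by (intro exI[of _ "u + \<epsilon> + min (\<eta>/2) ((v - u - 2*\<epsilon>)/2)"]) (auto simp: d min_def field_simps)
    then show "u + \<epsilon> \<in> frontier (parallel_set F \<epsilon>)" using l e by (intro frontierI) (auto simp: d)
    have "\<exists>y. \<bar>y - (v - \<epsilon>)\<bar> < \<eta> \<and> \<epsilon> < infdist y F" if "0 < \<eta>" for \<eta>
      using l e that by (intro exI[of _ "v - \<epsilon> - min (\<eta>/2) ((v - u - 2*\<epsilon>)/2)"]) (auto simp: d min_def field_simps)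
    then show "v - \<epsilon> \<in> frontier (parallel_set F \<epsilon>)" using l e by (intro frontierI) (auto simp: d)
  qed
  show ?thesis
  proof (cases "2 * \<epsilon> < v - u")
    case True
    then have "{u + \<epsilon>, v - \<epsilon>} \<subseteq> frontier (parallel_set F \<epsilon>) \<inter> {u<..<v}" using 2 e by auto
    moreover have "frontier (parallel_set F \<epsilon>) \<inter> {u<..<v} \<subseteq> {u + \<epsilon>, v - \<epsilon>}"
    proof
      fix x assume "x \<in> frontier (parallel_set F \<epsilon>) \<inter> {u<..<v}"
      then show "x \<in> {u + \<epsilon>, v - \<epsilon>}" using 1[of x] by simp
    qed
    ultimately have "frontier (parallel_set F \<epsilon>) \<inter> {u<..<v} = {u + \<epsilon>, v - \<epsilon>}" by (rule subset_antisym[rotated])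
    then show ?thesis using True by (simp only: if_True)
  next
    case False
    then have "x \<notin> frontier (parallel_set F \<epsilon>) \<inter> {u<..<v}" for x using 1[of x] by auto
    then have "frontier (parallel_set F \<epsilon>) \<inter> {u<..<v} = {}" by blast
    then show ?thesis using False by (simp only: if_False)
  qed
qed

lemma frontier_below:
  assumes e: "0 < \<epsilon>" shows "frontier (parallel_set F \<epsilon>) \<inter> {..<lo} = {lo - \<epsilon>}"
proof -
  have "x = lo - \<epsilon>" if "x \<in> frontier (parallel_set F \<epsilon>)" "x < lo" for x
    using frontier_infdist[OF that(1)] infdist_below[of x] that by simp
  moreover have "\<exists>y. \<bar>y - (lo - \<epsilon>)\<bar> < \<eta> \<and> \<epsilon> < infdist y F" if "0 < \<eta>" for \<eta>
    using e that by (intro exI[of _ "lo - \<epsilon> - \<eta>/2"]) (auto simp: infdist_below)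
  then have "lo - \<epsilon> \<in> frontier (parallel_set F \<epsilon>)" using e by (intro frontierI) (auto simp: infdist_below)
  moreover have "lo - \<epsilon> < lo" using e by simp
  ultimately show ?thesis by blast
qed

lemma frontier_above:
  assumes e: "0 < \<epsilon>" shows "frontier (parallel_set F \<epsilon>) \<inter> {hi<..} = {hi + \<epsilon>}"
proof -
  have "x = hi + \<epsilon>" if "x \<in> frontier (parallel_set F \<epsilon>)" "hi < x" for x
    using frontier_infdist[OF that(1)] infdist_above[of x] that by simp
  moreover have "\<exists>y. \<bar>y - (hi + \<epsilon>)\<bar> < \<eta> \<and> \<epsilon> < infdist y F" if "0 < \<eta>" for \<eta>
    using e that by (intro exI[of _ "hi + \<epsilon> + \<eta>/2"]) (auto simp: infdist_above)
  then have "hi + \<epsilon> \<in> frontier (parallel_set F \<epsilon>)" using e by (intro frontierI) (auto simp: infdist_above)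
  moreover have "hi < hi + \<epsilon>" using e by simp
  ultimately show ?thesis by blast
qed

text \<open>All components of the complement of F. The two unbounded ones carry the boundary points
  \<open>lo - \<epsilon>\<close> and \<open>hi + \<epsilon>\<close> for every positive \<epsilon>
  and are kept together with the gaps, so that everything off F is a countable disjoint
  union.\<close>

definition comps :: "real set set" where
  "comps = insert {..<lo} (insert {hi<..} (gaps F))"

lemma countable_comps: "countable comps"
  unfolding comps_def using countable_gaps by simp

lemma Union_comps: "\<Union> comps = - F"
proof (intro equalityI subsetI)
  fix x assume "x \<in> \<Union> comps"
  then consider "x < lo" | "hi < x" | C where "C \<in> gaps F" "x \<in> C" unfolding comps_def by blast
  then show "x \<in> - F"
  proof cases
    case 3
    then show ?thesis using gap_disjoint_set by blast
  qed (use F_subset in auto)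
next
  fix x assume x: "x \<in> - F"
  show "x \<in> \<Union> comps"
  proof (cases "lo \<le> x \<and> x \<le> hi")
    case True
    then obtain C where "C \<in> gaps F" "x \<in> C" using x in_gap[of x] by blast
    then show ?thesis by (auto simp: comps_def)
  qed (auto simp: comps_def)
qed

lemma disjoint_comps:
  assumes "C \<in> comps" "D \<in> comps" "C \<noteq> D"
  shows "C \<inter> D = {}"
proof -
  have gg: "C \<inter> {..<lo} = {}" "C \<inter> {hi<..} = {}" if "C \<in> gaps F" for C
    using gap_subset[OF that] by auto
  have lh: "{..<lo} \<inter> {hi<..} = {}" using lo_le_hi by auto
  consider "C \<in> gaps F" "D \<in> gaps F" | "C \<in> gaps F" "D \<in> {{..<lo}, {hi<..}}"
    | "D \<in> gaps F" "C \<in> {{..<lo}, {hi<..}}" | "C \<in> {{..<lo}, {hi<..}}" "D \<in> {{..<lo}, {hi<..}}"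
    using assms(1,2) unfolding comps_def by blast
  then show ?thesis
  proof cases
    case 1
    then show ?thesis using gaps_disjoint[of C F D] assms(3) by simp
  next
    case 2
    then show ?thesis using gg[of C] by (elim insertE emptyE) simp_all
  next
    case 3
    then show ?thesis using gg[of D] by (elim insertE emptyE) (simp_all add: Int_commute)
  next
    case 4
    then show ?thesis using lh assms(3) by (elim insertE emptyE) (simp_all add: Int_commute)
  qed
qed

lemma comps_borel: "C \<in> comps \<Longrightarrow> C \<in> sets borel"
  unfolding comps_def using gaps_borel by auto

end

section \<open>Boundary points and volume of parallel sets\<close>

context compact_real
begin

abbreviation boundary_count :: "real set \<Rightarrow> real \<Rightarrow> ennreal" where
  "boundary_count B \<epsilon> \<equiv> emeasure counting (frontier (parallel_set F \<epsilon>) \<inter> B)"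

lemma emeasure_counting_pair:
  "p \<noteq> q \<Longrightarrow> emeasure counting ({p, q} \<inter> B) = indicator B p + indicator B q"
  by (cases "p \<in> B"; cases "q \<in> B") (simp_all add: Int_insert_left)

lemma emeasure_counting_single: "emeasure counting ({p} \<inter> B) = indicator B p"
  by (cases "p \<in> B") (simp_all add: Int_insert_left)

lemma boundary_count_gap:
  assumes "{u<..<v} \<inter> F = {}" "u \<in> F" "v \<in> F" "u < v" and e: "0 < \<epsilon>"
  shows "boundary_count (B \<inter> {u<..<v}) \<epsilon> =
    indicator {..<(v - u) / 2} \<epsilon> * (indicator B (u + \<epsilon>) + indicator B (v - \<epsilon>))"
proof -
  have "frontier (parallel_set F \<epsilon>) \<inter> (B \<inter> {u<..<v}) = (if 2 * \<epsilon> < v - u then {u + \<epsilon>, v - \<epsilon>} else {}) \<inter> B"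
    using frontier_gap[OF assms] by blast
  moreover have "u + \<epsilon> \<noteq> v - \<epsilon>" if "2 * \<epsilon> < v - u" using that by auto
  ultimately show ?thesis
    using emeasure_counting_pair[of "u + \<epsilon>" "v - \<epsilon>" B] by (auto split: split_indicator)
qed

lemma boundary_count_below: "0 < \<epsilon> \<Longrightarrow> boundary_count (B \<inter> {..<lo}) \<epsilon> = indicator B (lo - \<epsilon>)"
  using emeasure_counting_single[of "lo - \<epsilon>" B] frontier_below[of \<epsilon>] by (simp add: Int_ac)

lemma boundary_count_above: "0 < \<epsilon> \<Longrightarrow> boundary_count (B \<inter> {hi<..}) \<epsilon> = indicator B (hi + \<epsilon>)"
  using emeasure_counting_single[of "hi + \<epsilon>" B] frontier_above[of \<epsilon>] by (simp add: Int_ac)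

lemma parallel_set_borel [measurable]: "parallel_set F \<epsilon> \<in> sets borel"
  using closed_parallel_set by (rule borel_closed)

lemma emeasure_translate:
  assumes [measurable]: "A \<in> sets borel" and c: "c = 1 \<or> c = -1"
  shows "(\<integral>\<^sup>+s. indicator A (u + c * s) \<partial>lborel) = emeasure lborel (A :: real set)"
  using nn_integral_real_affine[of "indicator A" c u] c by auto

text \<open>A coarea formula on one component: as \<epsilon> grows, the boundary points sweep the
  component at unit speed, so integrating the number of them in B gives the length of the swept part
  of B. The Borel function g stands in for the count, which is described only for positive
  \<epsilon>.\<close>

lemma comp_coarea:
  assumes C: "C \<in> comps" and B [measurable]: "B \<in> sets borel"
  shows "\<exists>g\<in>borel_measurable borel. (\<forall>\<epsilon>>0. boundary_count (B \<inter> C) \<epsilon> = g \<epsilon>) \<and>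
     (\<forall>\<epsilon>>0. (\<integral>\<^sup>+s\<in>{0<..\<epsilon>}. g s \<partial>lborel) = emeasure lborel (parallel_set F \<epsilon> \<inter> B \<inter> C))"
proof -
  consider "C = {..<lo}" | "C = {hi<..}" | "C \<in> gaps F" using C unfolding comps_def by blast
  then show ?thesis
  proof cases
    case 1
    have "(\<integral>\<^sup>+s\<in>{0<..\<epsilon>}. indicator B (lo - s) \<partial>lborel) = emeasure lborel (parallel_set F \<epsilon> \<inter> B \<inter> C)"
      if "0 < \<epsilon>" for \<epsilon>
    proof -
      have "(\<integral>\<^sup>+s\<in>{0<..\<epsilon>}. indicator B (lo - s) \<partial>lborel) =
          (\<integral>\<^sup>+s. indicator (B \<inter> {lo - \<epsilon>..<lo}) (lo + (-1) * s) \<partial>lborel)"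
        by (intro nn_integral_cong) (auto split: split_indicator)
      also have "\<dots> = emeasure lborel (B \<inter> {lo - \<epsilon>..<lo})" by (rule emeasure_translate) auto
      also have "B \<inter> {lo - \<epsilon>..<lo} = parallel_set F \<epsilon> \<inter> B \<inter> C"
        using 1 by (auto simp: parallel_set_def infdist_below)
      finally show ?thesis .
    qed
    then show ?thesis using 1 boundary_count_below
      by (intro bexI[of _ "\<lambda>s. indicator B (lo - s)"]) auto
  next
    case 2
    have "(\<integral>\<^sup>+s\<in>{0<..\<epsilon>}. indicator B (hi + s) \<partial>lborel) = emeasure lborel (parallel_set F \<epsilon> \<inter> B \<inter> C)"
      if "0 < \<epsilon>" for \<epsilon>
    proof -
      have "(\<integral>\<^sup>+s\<in>{0<..\<epsilon>}. indicator B (hi + s) \<partial>lborel) =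
          (\<integral>\<^sup>+s. indicator (B \<inter> {hi<..hi + \<epsilon>}) (hi + 1 * s) \<partial>lborel)"
        by (intro nn_integral_cong) (auto split: split_indicator)
      also have "\<dots> = emeasure lborel (B \<inter> {hi<..hi + \<epsilon>})" by (rule emeasure_translate) auto
      also have "B \<inter> {hi<..hi + \<epsilon>} = parallel_set F \<epsilon> \<inter> B \<inter> C"
        using 2 by (auto simp: parallel_set_def infdist_above)
      finally show ?thesis .
    qed
    then show ?thesis using 2 boundary_count_above
      by (intro bexI[of _ "\<lambda>s. indicator B (hi + s)"]) auto
  next
    case 3
    then obtain u v where uv: "C = {u<..<v}" "u < v" "u \<in> F" "v \<in> F" "{u<..<v} \<inter> F = {}" by (rule gapE)
    define m where "m = (v - u) / 2"
    define g :: "real \<Rightarrow> ennreal" where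
      "g = (\<lambda>s. indicator {..<m} s * (indicator B (u + s) + indicator B (v - s)))"
    have [measurable]: "g \<in> borel_measurable borel" unfolding g_def by measurable
    have "(\<integral>\<^sup>+s\<in>{0<..\<epsilon>}. g s \<partial>lborel) = emeasure lborel (parallel_set F \<epsilon> \<inter> B \<inter> C)" if e: "0 < \<epsilon>" for \<epsilon>
    proof -
      let ?U = "B \<inter> {u<..u + \<epsilon>} \<inter> {..<u + m}" and ?V = "B \<inter> {v - \<epsilon>..<v} \<inter> {v - m<..}"
      have "(\<integral>\<^sup>+s\<in>{0<..\<epsilon>}. g s \<partial>lborel) =
          (\<integral>\<^sup>+s. indicator ?U (u + 1 * s) + indicator ?V (v + (-1) * s) \<partial>lborel)"
        by (intro nn_integral_cong) (auto simp: g_def split: split_indicator)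
      also have "\<dots> = (\<integral>\<^sup>+s. indicator ?U (u + 1 * s) \<partial>lborel) + (\<integral>\<^sup>+s. indicator ?V (v + (-1) * s) \<partial>lborel)"
        by (intro nn_integral_add) measurable
      also have "\<dots> = emeasure lborel ?U + emeasure lborel ?V"
        by (intro arg_cong2[where f = "(+)"] emeasure_translate) auto
      also have "\<dots> = emeasure lborel (?U \<union> ?V)"
        by (intro plus_emeasure) (auto simp: m_def field_simps)
      \<comment> \<open>The sweeps from the two sides both stop short of the midpoint
        \<open>u + m\<close>, because the count vanishes from s = m on; a single point does not
        affect the length.\<close>
      also have "?U \<union> ?V = (parallel_set F \<epsilon> \<inter> B \<inter> C) - {u + m}"
      proof (rule set_eqI)
        fix x
        have m: "v - m = u + m" "u + m < v" "u < u + m" using uv(2) by (simp_all add: m_def field_simps)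
        show "x \<in> ?U \<union> ?V \<longleftrightarrow> x \<in> (parallel_set F \<epsilon> \<inter> B \<inter> C) - {u + m}"
        proof (cases "u < x \<and> x < v")
          case True
          then have "x \<in> parallel_set F \<epsilon> \<longleftrightarrow> x - u \<le> \<epsilon> \<or> v - x \<le> \<epsilon>"
            using infdist_gap[OF uv(5,3,4), of x] by (simp add: parallel_set_def min_le_iff_disj)
          moreover have "(x \<le> u + \<epsilon> \<and> x < u + m) \<or> (v - \<epsilon> \<le> x \<and> v - m < x) \<longleftrightarrow>
              (x - u \<le> \<epsilon> \<or> v - x \<le> \<epsilon>) \<and> x \<noteq> u + m"
            using m by linarith
          ultimately show ?thesis using True uv(1) by auto
        next
          case False
          then show ?thesis using uv(1) m by auto
        qed
      qed
      also have "emeasure lborel \<dots> = emeasure lborel (parallel_set F \<epsilon> \<inter> B \<inter> C)"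
        using uv(1) by (intro emeasure_Diff_null_set) (auto simp: null_sets_def)
      finally show ?thesis .
    qed
    then show ?thesis
      using boundary_count_gap[OF uv(5,3,4,2)] uv(1) by (intro bexI[of _ g]) (auto simp: g_def m_def)
  qed
qed

lemma disjoint_family_comps:
  "disjoint_family_on (\<lambda>C. A \<inter> (B \<inter> C)) comps" "disjoint_family_on (\<lambda>C. A \<inter> C) comps"
proof -
  have "(A \<inter> (B \<inter> C)) \<inter> (A \<inter> (B \<inter> D)) = {}" "(A \<inter> C) \<inter> (A \<inter> D) = {}"
    if "C \<in> comps" "D \<in> comps" "C \<noteq> D" for C D
    using disjoint_comps[OF that] by blast+
  then show "disjoint_family_on (\<lambda>C. A \<inter> (B \<inter> C)) comps" "disjoint_family_on (\<lambda>C. A \<inter> C) comps"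
    unfolding disjoint_family_on_def by simp_all
qed

lemma boundary_count_split:
  assumes "0 < \<epsilon>"
  shows "boundary_count B \<epsilon> = (\<integral>\<^sup>+C. boundary_count (B \<inter> C) \<epsilon> \<partial>count_space comps)"
proof -
  have "frontier (parallel_set F \<epsilon>) \<inter> B = (\<Union>C\<in>comps. frontier (parallel_set F \<epsilon>) \<inter> (B \<inter> C))"
    using frontier_disjoint[OF assms] Union_comps by blast
  also have "emeasure counting \<dots> = (\<integral>\<^sup>+C. boundary_count (B \<inter> C) \<epsilon> \<partial>count_space comps)"
    by (intro emeasure_UN_countable countable_comps disjoint_family_comps) simp
  finally show ?thesis .
qed

text \<open>Summation of \<open>comp_coarea\<close> over the countably many components. Boundary
  points never lie on F, and a null F does not contribute to the volume, so nothing is lost by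
  looking at components only.\<close>

lemma boundary_count_measurable:
  assumes B: "B \<in> sets borel"
  obtains n where "n \<in> borel_measurable borel" "\<And>\<epsilon>. 0 < \<epsilon> \<Longrightarrow> boundary_count B \<epsilon> = n \<epsilon>"
    "\<And>\<epsilon>. 0 < \<epsilon> \<Longrightarrow> emeasure lborel F = 0 \<Longrightarrow>
       emeasure lborel (parallel_set F \<epsilon> \<inter> B) = (\<integral>\<^sup>+s\<in>{0<..\<epsilon>}. n s \<partial>lborel)"
proof -
  obtain g where g: "\<And>C. C \<in> comps \<Longrightarrow> g C \<in> borel_measurable borel"
    "\<And>C \<epsilon>. C \<in> comps \<Longrightarrow> 0 < \<epsilon> \<Longrightarrow> boundary_count (B \<inter> C) \<epsilon> = g C \<epsilon>"
    "\<And>C \<epsilon>. C \<in> comps \<Longrightarrow> 0 < \<epsilon> \<Longrightarrow>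
       (\<integral>\<^sup>+s\<in>{0<..\<epsilon>}. g C s \<partial>lborel) = emeasure lborel (parallel_set F \<epsilon> \<inter> B \<inter> C)"
  proof -
    have "\<forall>C\<in>comps. \<exists>g. g \<in> borel_measurable borel \<and> (\<forall>\<epsilon>>0. boundary_count (B \<inter> C) \<epsilon> = g \<epsilon>) \<and>
       (\<forall>\<epsilon>>0. (\<integral>\<^sup>+s\<in>{0<..\<epsilon>}. g s \<partial>lborel) = emeasure lborel (parallel_set F \<epsilon> \<inter> B \<inter> C))"
      using comp_coarea[OF _ B] unfolding Bex_def by (intro ballI)
    from bchoice[OF this] show thesis using that by auto
  qed
  interpret cs: sigma_finite_measure "count_space comps"
    by (rule sigma_finite_measure_count_space_countable[OF countable_comps])
  define n where "n = (\<lambda>\<epsilon>. \<integral>\<^sup>+C. g C \<epsilon> \<partial>count_space comps)"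
  have n: "n \<in> borel_measurable borel"
    unfolding n_def
  proof (rule cs.borel_measurable_nn_integral)
    have "(\<lambda>(C, \<epsilon>). g C \<epsilon>) \<in> borel_measurable (count_space comps \<Otimes>\<^sub>M borel)"
      by (rule measurable_pair_measure_countable1[OF countable_comps]) (simp add: g(1))
    then show "(\<lambda>(\<epsilon>, C). g C \<epsilon>) \<in> borel_measurable (borel \<Otimes>\<^sub>M count_space comps)"
      by (subst measurable_pair_swap_iff) (simp add: case_prod_beta')
  qed
  have c: "boundary_count B \<epsilon> = n \<epsilon>" if "0 < \<epsilon>" for \<epsilon>
    unfolding n_def by (subst boundary_count_split[OF that], intro nn_integral_cong g(2) that) simp
  have "emeasure lborel (parallel_set F \<epsilon> \<inter> B) = (\<integral>\<^sup>+s\<in>{0<..\<epsilon>}. n s \<partial>lborel)"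
    if e: "0 < \<epsilon>" and null: "emeasure lborel F = 0" for \<epsilon>
  proof -
    have [measurable]: "F \<in> sets borel" using closed_F by (rule borel_closed)
    have "emeasure lborel (parallel_set F \<epsilon> \<inter> B) = emeasure lborel (parallel_set F \<epsilon> \<inter> B - F)"
      using null B by (intro emeasure_Diff_null_set[symmetric]) (auto simp: null_sets_def)
    also have "parallel_set F \<epsilon> \<inter> B - F = (\<Union>C\<in>comps. parallel_set F \<epsilon> \<inter> B \<inter> C)"
      using Union_comps by blast
    also have "emeasure lborel \<dots> = (\<integral>\<^sup>+C. emeasure lborel (parallel_set F \<epsilon> \<inter> B \<inter> C) \<partial>count_space comps)"
      using comps_borel B by (intro emeasure_UN_countable countable_comps disjoint_family_comps) simp_all
    also have "\<dots> = (\<integral>\<^sup>+C. (\<integral>\<^sup>+s. g C s * indicator {0<..\<epsilon>} s \<partial>lborel) \<partial>count_space comps)"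
      by (intro nn_integral_cong g(3)[symmetric] e) simp
    also have "\<dots> = (\<integral>\<^sup>+s. (\<integral>\<^sup>+C. g C s * indicator {0<..\<epsilon>} s \<partial>count_space comps) \<partial>lborel)"
      using g(1) by (intro nn_integral_count_space_nn_integral[symmetric] countable_comps) simp
    also have "\<dots> = (\<integral>\<^sup>+s\<in>{0<..\<epsilon>}. n s \<partial>lborel)"
      unfolding n_def by (intro nn_integral_cong) (simp add: nn_integral_multc)
    finally show ?thesis .
  qed
  from that[OF n c this] show thesis .
qed

end

section \<open>Average curvature measures\<close>

lemma nn_integral_powr_Icc:
  fixes a x y :: real
  assumes "a \<noteq> -1" "0 < x" "x \<le> y"
  shows "(\<integral>\<^sup>+s\<in>{x..y}. ennreal (s powr a) \<partial>lborel) = ennreal ((y powr (a + 1) - x powr (a + 1)) / (a + 1))"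
proof -
  have "(\<integral>\<^sup>+s\<in>{x..y}. ennreal (s powr a) \<partial>lborel) = ennreal (y powr (a + 1) / (a + 1) - x powr (a + 1) / (a + 1))"
    using assms
    by (intro nn_integral_FTC_Icc) (auto intro!: derivative_eq_intros simp: powr_diff)
  then show ?thesis by (simp add: diff_divide_distrib)
qed

text \<open>\<open>measure_of\<close> returns the prescribed values only if the set function is a
  measure, and the zero measure otherwise. For a weighted mixture of countably additive kernels
  countable additivity is monotone convergence; what has to be supplied is the measurability of the
  integrand in \<epsilon>.\<close>

lemma emeasure_measure_of_mixture:
  fixes w :: "real \<Rightarrow> ennreal" and K :: "real \<Rightarrow> real set \<Rightarrow> ennreal"
  assumes empty: "\<And>\<epsilon>. K \<epsilon> {} = 0"
    and add: "\<And>\<epsilon> A. range A \<subseteq> sets borel \<Longrightarrow> disjoint_family A \<Longrightarrow> (\<Sum>i. K \<epsilon> (A i)) = K \<epsilon> (\<Union>i. A i)"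
    and meas: "\<And>A. A \<in> sets borel \<Longrightarrow> (\<lambda>\<epsilon>. w \<epsilon> * K \<epsilon> A * indicator S \<epsilon>) \<in> borel_measurable borel"
    and B: "B \<in> sets borel"
  shows "emeasure (measure_of UNIV (sets borel) (\<lambda>B. c * (\<integral>\<^sup>+\<epsilon>\<in>S. w \<epsilon> * K \<epsilon> B \<partial>lborel))) B =
    c * (\<integral>\<^sup>+\<epsilon>\<in>S. w \<epsilon> * K \<epsilon> B \<partial>lborel)"
proof (rule emeasure_measure_of_sigma[OF _ _ _ B])
  show "sigma_algebra UNIV (sets borel :: real set set)"
    using sets.sigma_algebra_axioms[of "borel :: real measure"] by simp
  show "positive (sets borel) (\<lambda>B. c * (\<integral>\<^sup>+\<epsilon>\<in>S. w \<epsilon> * K \<epsilon> B \<partial>lborel))"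
    by (simp add: positive_def empty)
  show "countably_additive (sets borel) (\<lambda>B. c * (\<integral>\<^sup>+\<epsilon>\<in>S. w \<epsilon> * K \<epsilon> B \<partial>lborel))"
  proof (rule countably_additiveI)
    fix A :: "nat \<Rightarrow> real set"
    assume A: "range A \<subseteq> sets borel" "disjoint_family A"
    have "(\<Sum>i. c * (\<integral>\<^sup>+\<epsilon>\<in>S. w \<epsilon> * K \<epsilon> (A i) \<partial>lborel)) = c * (\<Sum>i. \<integral>\<^sup>+\<epsilon>\<in>S. w \<epsilon> * K \<epsilon> (A i) \<partial>lborel)"
      by (rule ennreal_suminf_cmult)
    also have "(\<Sum>i. \<integral>\<^sup>+\<epsilon>\<in>S. w \<epsilon> * K \<epsilon> (A i) \<partial>lborel) = (\<integral>\<^sup>+\<epsilon>. (\<Sum>i. w \<epsilon> * K \<epsilon> (A i) * indicator S \<epsilon>) \<partial>lborel)"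
      using A(1) by (intro nn_integral_suminf[symmetric]) (auto intro!: meas)
    also have "\<dots> = (\<integral>\<^sup>+\<epsilon>\<in>S. w \<epsilon> * K \<epsilon> (\<Union>i. A i) \<partial>lborel)"
      by (intro nn_integral_cong) (simp add: add[OF A])
    finally show "(\<Sum>i. c * (\<integral>\<^sup>+\<epsilon>\<in>S. w \<epsilon> * K \<epsilon> (A i) \<partial>lborel)) =
      c * (\<integral>\<^sup>+\<epsilon>\<in>S. w \<epsilon> * K \<epsilon> (\<Union>i. A i) \<partial>lborel)" .
  qed
qed

context compact_real
begin

text \<open>The positions of all boundary points in one finite sum. Later questions, such as which
  of them fall into a cylinder or into a given B, reduce to membership of these points.\<close>

lemma boundary_count_formula:
  assumes e: "0 < \<epsilon>"
  shows "boundary_count B \<epsilon> = indicator B (lo - \<epsilon>) + indicator B (hi + \<epsilon>) +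
    (\<Sum>C\<in>long_gaps (2 * \<epsilon>). indicator B (Inf C + \<epsilon>) + indicator B (Sup C - \<epsilon>))"
proof -
  have fin: "finite (long_gaps (2 * \<epsilon>))" using e by (intro finite_long_gaps) simp
  have gap: "boundary_count (B \<inter> C) \<epsilon> =
      (if C \<in> long_gaps (2 * \<epsilon>) then indicator B (Inf C + \<epsilon>) + indicator B (Sup C - \<epsilon>) else 0)"
    if "C \<in> gaps F" for C
  proof -
    from that obtain u v where uv: "C = {u<..<v}" "u < v" "u \<in> F" "v \<in> F" "{u<..<v} \<inter> F = {}"
      "measure lborel C = v - u" "Inf C = u" "Sup C = v" by (rule gapE)
    show ?thesis
      using boundary_count_gap[OF uv(5,3,4,2) e, of B] uv(6-8) that unfolding uv(1)
      by (auto simp: long_gaps_def split: split_indicator)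
  qed
  have ne: "{..<lo} \<noteq> {hi<..}" "{..<lo} \<notin> long_gaps (2 * \<epsilon>)" "{hi<..} \<notin> long_gaps (2 * \<epsilon>)"
  proof -
    have "lo - 1 \<in> {..<lo}" "lo - 1 \<notin> {hi<..}" using lo_le_hi by auto
    then show "{..<lo} \<noteq> {hi<..}" by blast
    have "\<not> {..<lo} \<subseteq> {lo<..<hi}" "\<not> {hi<..} \<subseteq> {lo<..<hi}"
      by (auto simp: subset_eq intro: exI[of _ "lo - 1"] exI[of _ "hi + 1"])
    then show "{..<lo} \<notin> long_gaps (2 * \<epsilon>)" "{hi<..} \<notin> long_gaps (2 * \<epsilon>)"
      using gap_subset unfolding long_gaps_def by blast+
  qed
  have "boundary_count B \<epsilon> = (\<Sum>C\<in>insert {..<lo} (insert {hi<..} (long_gaps (2 * \<epsilon>))). boundary_count (B \<inter> C) \<epsilon>)"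
  proof (subst boundary_count_split[OF e], rule nn_integral_count_space')
    fix C assume "C \<in> comps" "C \<notin> insert {..<lo} (insert {hi<..} (long_gaps (2 * \<epsilon>)))"
    then have "C \<in> gaps F" "C \<notin> long_gaps (2 * \<epsilon>)" unfolding comps_def by auto
    then show "boundary_count (B \<inter> C) \<epsilon> = 0" using gap[of C] by simp
  qed (use fin in \<open>auto simp: comps_def long_gaps_def\<close>)
  also have "\<dots> = boundary_count (B \<inter> {..<lo}) \<epsilon> + (boundary_count (B \<inter> {hi<..}) \<epsilon> +
      (\<Sum>C\<in>long_gaps (2 * \<epsilon>). boundary_count (B \<inter> C) \<epsilon>))"
    using fin ne by (simp del: emeasure_count_space)
  also have "(\<Sum>C\<in>long_gaps (2 * \<epsilon>). boundary_count (B \<inter> C) \<epsilon>) =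
      (\<Sum>C\<in>long_gaps (2 * \<epsilon>). indicator B (Inf C + \<epsilon>) + indicator B (Sup C - \<epsilon>))"
  proof (rule sum.cong[OF refl])
    fix C assume C: "C \<in> long_gaps (2 * \<epsilon>)"
    then have "C \<in> gaps F" by (simp add: long_gaps_def)
    from gap[OF this] C show "boundary_count (B \<inter> C) \<epsilon> = indicator B (Inf C + \<epsilon>) + indicator B (Sup C - \<epsilon>)"
      by (simp only: if_True)
  qed
  finally show ?thesis
    unfolding boundary_count_below[OF e] boundary_count_above[OF e] by (simp only: add.assoc)
qed

lemma emeasure_avg_curv0:
  assumes T: "0 < T" and B: "B \<in> sets borel"
  shows "emeasure (avg_curv0 F T) B = ennreal (1 / (2 * \<bar>ln T\<bar>)) *
     (\<integral>\<^sup>+\<epsilon>\<in>{T..1}. ennreal (\<epsilon> powr (scaling_exponent0 F - 1)) * boundary_count B \<epsilon> \<partial>lborel)"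
  unfolding avg_curv0_def
proof (rule emeasure_measure_of_mixture[OF _ _ _ B])
  fix A :: "real set" assume A: "A \<in> sets borel"
  obtain n where n: "n \<in> borel_measurable borel" "\<And>\<epsilon>. 0 < \<epsilon> \<Longrightarrow> boundary_count A \<epsilon> = n \<epsilon>"
    using boundary_count_measurable[OF A] by metis
  have "(\<lambda>\<epsilon>. ennreal (\<epsilon> powr (scaling_exponent0 F - 1)) * boundary_count A \<epsilon> * indicator {T..1} \<epsilon>) =
     (\<lambda>\<epsilon>. ennreal (\<epsilon> powr (scaling_exponent0 F - 1)) * n \<epsilon> * indicator {T..1} \<epsilon>)"
  proof
    fix \<epsilon>
    show "ennreal (\<epsilon> powr (scaling_exponent0 F - 1)) * boundary_count A \<epsilon> * indicator {T..1} \<epsilon> =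
       ennreal (\<epsilon> powr (scaling_exponent0 F - 1)) * n \<epsilon> * indicator {T..1} \<epsilon>"
      using n(2)[of \<epsilon>] T by (cases "T \<le> \<epsilon>") (simp_all del: emeasure_count_space)
  qed
  then show "(\<lambda>\<epsilon>. ennreal (\<epsilon> powr (scaling_exponent0 F - 1)) * boundary_count A \<epsilon> * indicator {T..1} \<epsilon>)
      \<in> borel_measurable borel"
    using n(1) by simp
next
  fix \<epsilon> and A :: "nat \<Rightarrow> real set" assume A: "disjoint_family A"
  have "disjoint_family (\<lambda>i. frontier (parallel_set F \<epsilon>) \<inter> A i)"
    using A unfolding disjoint_family_on_def by blast
  then have "(\<Sum>i. boundary_count (A i) \<epsilon>) = emeasure counting (\<Union>i. frontier (parallel_set F \<epsilon>) \<inter> A i)"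
    by (intro suminf_emeasure) simp
  then show "(\<Sum>i. boundary_count (A i) \<epsilon>) = boundary_count (\<Union>i. A i) \<epsilon>"
    by (simp only: Int_UN_distrib)
qed simp

text \<open>The set of pairs (\<epsilon>, x) with x in the \<epsilon>-parallel set is closed, and
  the measure of its sections is measurable.\<close>

lemma parallel_measure_measurable:
  assumes [measurable]: "A \<in> sets borel"
  shows "(\<lambda>\<epsilon>. emeasure lborel (parallel_set F \<epsilon> \<inter> A)) \<in> borel_measurable borel"
proof -
  have "closed {p :: real \<times> real. infdist (snd p) F \<le> fst p}"
    by (intro closed_Collect_le continuous_intros)
  then have "{p. infdist (snd p) F \<le> fst p} \<in> sets (borel \<Otimes>\<^sub>M borel :: (real \<times> real) measure)"
    unfolding borel_prod by (rule borel_closed)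
  moreover have "UNIV \<times> A \<in> sets (borel \<Otimes>\<^sub>M borel :: (real \<times> real) measure)" by simp
  ultimately have "{p. infdist (snd p) F \<le> fst p} \<inter> UNIV \<times> A \<in> sets (borel \<Otimes>\<^sub>M borel :: (real \<times> real) measure)"
    by (rule sets.Int)
  moreover have "{p. infdist (snd p) F \<le> fst p} \<inter> UNIV \<times> A = {p. infdist (snd p) F \<le> fst p \<and> snd p \<in> A}"
    by auto
  ultimately have "{p. infdist (snd p) F \<le> fst p \<and> snd p \<in> A} \<in> sets (borel \<Otimes>\<^sub>M lborel)"
    by (simp cong: sets_pair_measure_cong)
  from lborel.measurable_emeasure_Pair[OF this]
  have "(\<lambda>\<epsilon>. emeasure lborel (Pair \<epsilon> -` {p. infdist (snd p) F \<le> fst p \<and> snd p \<in> A})) \<in> borel_measurable borel"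
    .
  moreover have "Pair \<epsilon> -` {p. infdist (snd p) F \<le> fst p \<and> snd p \<in> A} = parallel_set F \<epsilon> \<inter> A" for \<epsilon>
    by (auto simp: parallel_set_def)
  ultimately show ?thesis by simp
qed

lemma emeasure_avg_curv1:
  assumes B: "B \<in> sets borel"
  shows "emeasure (avg_curv1 F T) B = ennreal (1 / \<bar>ln T\<bar>) *
     (\<integral>\<^sup>+\<epsilon>\<in>{T..1}. ennreal (\<epsilon> powr (scaling_exponent1 F - 1)) * emeasure lborel (parallel_set F \<epsilon> \<inter> B) \<partial>lborel)"
  unfolding avg_curv1_def
proof (rule emeasure_measure_of_mixture[OF _ _ _ B])
  fix A :: "real set" assume [measurable]: "A \<in> sets borel"
  note parallel_measure_measurable[measurable]
  show "(\<lambda>\<epsilon>. ennreal (\<epsilon> powr (scaling_exponent1 F - 1)) * emeasure lborel (parallel_set F \<epsilon> \<inter> A) *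
      indicator {T..1} \<epsilon>) \<in> borel_measurable borel"
    by measurable
next
  fix \<epsilon> and A :: "nat \<Rightarrow> real set" assume A: "range A \<subseteq> sets borel" "disjoint_family A"
  have "disjoint_family (\<lambda>i. parallel_set F \<epsilon> \<inter> A i)"
    using A(2) unfolding disjoint_family_on_def by blast
  moreover have "range (\<lambda>i. parallel_set F \<epsilon> \<inter> A i) \<subseteq> sets lborel"
    using A(1) by auto
  ultimately have "(\<Sum>i. emeasure lborel (parallel_set F \<epsilon> \<inter> A i)) = emeasure lborel (\<Union>i. parallel_set F \<epsilon> \<inter> A i)"
    by (intro suminf_emeasure)
  then show "(\<Sum>i. emeasure lborel (parallel_set F \<epsilon> \<inter> A i)) = emeasure lborel (parallel_set F \<epsilon> \<inter> (\<Union>i. A i))"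
    by (simp only: Int_UN_distrib)
qed simp

lemma sets_avg_curv [simp]: "sets (avg_curv0 F T) = sets borel" "sets (avg_curv1 F T) = sets borel"
  unfolding avg_curv0_def avg_curv1_def using sets.sigma_sets_eq[of "borel :: real measure"] by simp_all

lemma space_avg_curv [simp]: "space (avg_curv0 F T) = UNIV" "space (avg_curv1 F T) = UNIV"
  unfolding avg_curv0_def avg_curv1_def by simp_all

text \<open>Integration by parts: the volume V(\<epsilon>) has the count n(\<epsilon>) as
  derivative, and \<epsilon>^(\<delta> - 1) V(\<epsilon>) is differentiated and integrated from T to
  1. Terms with a negative sign are moved across the equation so that it makes sense in the extended
  nonnegative reals; the proof inserts V as the integral of n and applies Fubini.\<close>

lemma surface_volume_identity:
  assumes null: "emeasure lborel F = 0" and B: "B \<in> sets borel" and d: "\<delta> < 1" and T: "0 < T" "T \<le> 1"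
  shows "ennreal (1 - \<delta>) * (\<integral>\<^sup>+\<epsilon>\<in>{T..1}. ennreal (\<epsilon> powr (\<delta> - 2)) * emeasure lborel (parallel_set F \<epsilon> \<inter> B) \<partial>lborel)
      + emeasure lborel (parallel_set F 1 \<inter> B) =
    (\<integral>\<^sup>+\<epsilon>\<in>{T..1}. ennreal (\<epsilon> powr (\<delta> - 1)) * boundary_count B \<epsilon> \<partial>lborel)
      + ennreal (T powr (\<delta> - 1)) * emeasure lborel (parallel_set F T \<inter> B)"
proof -
  obtain n where [measurable]: "n \<in> borel_measurable borel" and n: "\<And>\<epsilon>. 0 < \<epsilon> \<Longrightarrow> boundary_count B \<epsilon> = n \<epsilon>"
    "\<And>\<epsilon>. 0 < \<epsilon> \<Longrightarrow> emeasure lborel (parallel_set F \<epsilon> \<inter> B) = (\<integral>\<^sup>+s\<in>{0<..\<epsilon>}. n s \<partial>lborel)"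
    using boundary_count_measurable[OF B] null by metis
  \<comment> \<open>The weight of radius s after exchanging the integrals: (1 - \<delta>) times the
    integral of \<epsilon>^(\<delta> - 2) over \<epsilon> from \<open>max s T\<close> to 1.\<close>
  define k where "k = (\<lambda>s. ennreal (max s T powr (\<delta> - 1) - 1))"
  have [measurable]: "k \<in> borel_measurable borel" unfolding k_def by measurable
  have inner: "ennreal (1 - \<delta>) * (\<integral>\<^sup>+\<epsilon>. ennreal (\<epsilon> powr (\<delta> - 2)) * indicator {T..1} \<epsilon> * indicator {0<..\<epsilon>} s \<partial>lborel)
      = k s * indicator {0<..1} s" for s
  proof (cases "0 < s \<and> s \<le> 1")
    case True
    have "(\<integral>\<^sup>+\<epsilon>. ennreal (\<epsilon> powr (\<delta> - 2)) * indicator {T..1} \<epsilon> * indicator {0<..\<epsilon>} s \<partial>lborel) =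
        (\<integral>\<^sup>+\<epsilon>\<in>{max s T..1}. ennreal (\<epsilon> powr (\<delta> - 2)) \<partial>lborel)"
      using True by (intro nn_integral_cong) (auto split: split_indicator)
    also have "\<dots> = ennreal ((1 - max s T powr (\<delta> - 1)) / (\<delta> - 1))"
      using True T d by (subst nn_integral_powr_Icc) auto
    finally have "ennreal (1 - \<delta>) * (\<integral>\<^sup>+\<epsilon>. ennreal (\<epsilon> powr (\<delta> - 2)) * indicator {T..1} \<epsilon> * indicator {0<..\<epsilon>} s \<partial>lborel)
        = ennreal (1 - \<delta>) * ennreal ((1 - max s T powr (\<delta> - 1)) / (\<delta> - 1))"
      by (rule arg_cong)
    also have "\<dots> = ennreal ((1 - \<delta>) * ((1 - max s T powr (\<delta> - 1)) / (\<delta> - 1)))"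
      using d by (intro ennreal_mult'[symmetric]) simp
    also have "(1 - \<delta>) * ((1 - max s T powr (\<delta> - 1)) / (\<delta> - 1)) = max s T powr (\<delta> - 1) - 1"
      using d by (simp add: field_simps)
    finally show ?thesis using True by (simp add: k_def)
  next
    case False
    have "(\<lambda>\<epsilon>. ennreal (\<epsilon> powr (\<delta> - 2)) * indicator {T..1} \<epsilon> * indicator {0<..\<epsilon>} s) = (\<lambda>\<epsilon>. 0)"
      using False by (auto split: split_indicator)
    then show ?thesis using False by simp
  qed
  have "(\<integral>\<^sup>+\<epsilon>\<in>{T..1}. ennreal (\<epsilon> powr (\<delta> - 2)) * emeasure lborel (parallel_set F \<epsilon> \<inter> B) \<partial>lborel) =
      (\<integral>\<^sup>+\<epsilon>. (\<integral>\<^sup>+s. n s * (ennreal (\<epsilon> powr (\<delta> - 2)) * indicator {T..1} \<epsilon> * indicator {0<..\<epsilon>} s) \<partial>lborel) \<partial>lborel)"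
  proof (intro nn_integral_cong)
    fix \<epsilon>
    show "ennreal (\<epsilon> powr (\<delta> - 2)) * emeasure lborel (parallel_set F \<epsilon> \<inter> B) * indicator {T..1} \<epsilon> =
       (\<integral>\<^sup>+s. n s * (ennreal (\<epsilon> powr (\<delta> - 2)) * indicator {T..1} \<epsilon> * indicator {0<..\<epsilon>} s) \<partial>lborel)"
    proof (cases "\<epsilon> \<in> {T..1}")
      case True
      then have "0 < \<epsilon>" using T by simp
      have "(\<integral>\<^sup>+s. n s * (ennreal (\<epsilon> powr (\<delta> - 2)) * indicator {T..1} \<epsilon> * indicator {0<..\<epsilon>} s) \<partial>lborel) =
          (\<integral>\<^sup>+s. ennreal (\<epsilon> powr (\<delta> - 2)) * (n s * indicator {0<..\<epsilon>} s) \<partial>lborel)"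
        using True by (intro nn_integral_cong) (simp add: ac_simps)
      also have "\<dots> = ennreal (\<epsilon> powr (\<delta> - 2)) * emeasure lborel (parallel_set F \<epsilon> \<inter> B)"
        unfolding n(2)[OF \<open>0 < \<epsilon>\<close>] by (intro nn_integral_cmult) measurable
      finally show ?thesis using True by simp
    qed simp
  qed
  also have "\<dots> = (\<integral>\<^sup>+s. (\<integral>\<^sup>+\<epsilon>. n s * (ennreal (\<epsilon> powr (\<delta> - 2)) * indicator {T..1} \<epsilon> * indicator {0<..\<epsilon>} s) \<partial>lborel) \<partial>lborel)"
    by (rule lborel_pair.Fubini') (simp add: indicator_def[of "{0<.._}"] indicator_def[of "{T..1}"])
  also have "\<dots> = (\<integral>\<^sup>+s. n s * (\<integral>\<^sup>+\<epsilon>. ennreal (\<epsilon> powr (\<delta> - 2)) * indicator {T..1} \<epsilon> * indicator {0<..\<epsilon>} s \<partial>lborel) \<partial>lborel)"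
    by (intro nn_integral_cong nn_integral_cmult) (simp add: indicator_def[of "{0<.._}"])
  finally have "ennreal (1 - \<delta>) * (\<integral>\<^sup>+\<epsilon>\<in>{T..1}. ennreal (\<epsilon> powr (\<delta> - 2)) * emeasure lborel (parallel_set F \<epsilon> \<inter> B) \<partial>lborel)
     = ennreal (1 - \<delta>) * (\<integral>\<^sup>+s. n s * (\<integral>\<^sup>+\<epsilon>. ennreal (\<epsilon> powr (\<delta> - 2)) * indicator {T..1} \<epsilon> * indicator {0<..\<epsilon>} s \<partial>lborel) \<partial>lborel)"
    by simp
  also have "\<dots> = (\<integral>\<^sup>+s. ennreal (1 - \<delta>) * (n s * (\<integral>\<^sup>+\<epsilon>. ennreal (\<epsilon> powr (\<delta> - 2)) * indicator {T..1} \<epsilon> * indicator {0<..\<epsilon>} s \<partial>lborel)) \<partial>lborel)"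
    by (intro nn_integral_cmult[symmetric]) (simp add: indicator_def[of "{0<.._}"])
  also have "\<dots> = (\<integral>\<^sup>+s\<in>{0<..1}. n s * k s \<partial>lborel)"
  proof (intro nn_integral_cong)
    fix s
    show "ennreal (1 - \<delta>) * (n s * (\<integral>\<^sup>+\<epsilon>. ennreal (\<epsilon> powr (\<delta> - 2)) * indicator {T..1} \<epsilon> * indicator {0<..\<epsilon>} s \<partial>lborel))
        = n s * k s * indicator {0<..1} s"
      by (subst mult.left_commute, subst inner) (simp only: mult.assoc)
  qed
  finally have "ennreal (1 - \<delta>) * (\<integral>\<^sup>+\<epsilon>\<in>{T..1}. ennreal (\<epsilon> powr (\<delta> - 2)) * emeasure lborel (parallel_set F \<epsilon> \<inter> B) \<partial>lborel)
      + emeasure lborel (parallel_set F 1 \<inter> B) = (\<integral>\<^sup>+s\<in>{0<..1}. n s * k s \<partial>lborel) + (\<integral>\<^sup>+s\<in>{0<..1}. n s \<partial>lborel)"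
    using n(2)[of 1] by simp
  also have "\<dots> = (\<integral>\<^sup>+s. n s * k s * indicator {0<..1} s + n s * indicator {0<..1} s \<partial>lborel)"
    by (intro nn_integral_add[symmetric]) measurable
  also have "\<dots> = (\<integral>\<^sup>+s. ennreal (s powr (\<delta> - 1)) * n s * indicator {T..1} s
      + ennreal (T powr (\<delta> - 1)) * (n s * indicator {0<..T} s) \<partial>lborel)"
  proof (intro nn_integral_cong_AE)
    \<comment> \<open>At s = T both indicators on the right are 1 and the identity may fail, hence
      the detour over almost all s.\<close>
    have eq: "n s * k s * indicator {0<..1} s + n s * indicator {0<..1} s =
        ennreal (s powr (\<delta> - 1)) * n s * indicator {T..1} s + ennreal (T powr (\<delta> - 1)) * (n s * indicator {0<..T} s)"
      if "s \<noteq> T" for s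
    proof (cases "0 < s \<and> s \<le> 1")
      case True
      have "1 powr (\<delta> - 1) \<le> max s T powr (\<delta> - 1)"
        using True T d by (intro powr_mono2') auto
      then have "k s + 1 = ennreal (max s T powr (\<delta> - 1))"
        unfolding k_def by (simp add: ennreal_plus[symmetric] del: ennreal_plus flip: ennreal_1)
      then have "n s * k s + n s = n s * ennreal (max s T powr (\<delta> - 1))"
        using distrib_left[of "n s" "k s" 1] by simp
      then show ?thesis using True that by (cases "s < T") (auto simp: ac_simps max_def)
    next
      case False
      then show ?thesis using T by (auto split: split_indicator)
    qed
    show "AE s in lborel. n s * k s * indicator {0<..1} s + n s * indicator {0<..1} s =
        ennreal (s powr (\<delta> - 1)) * n s * indicator {T..1} s + ennreal (T powr (\<delta> - 1)) * (n s * indicator {0<..T} s)"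
      by (rule AE_mp[OF AE_lborel_singleton[of T] AE_I2], rule impI, rule eq)
  qed
  also have "\<dots> = (\<integral>\<^sup>+s\<in>{T..1}. ennreal (s powr (\<delta> - 1)) * n s \<partial>lborel)
      + ennreal (T powr (\<delta> - 1)) * (\<integral>\<^sup>+s\<in>{0<..T}. n s \<partial>lborel)"
    by (simp add: nn_integral_add nn_integral_cmult)
  also have "(\<integral>\<^sup>+s\<in>{T..1}. ennreal (s powr (\<delta> - 1)) * n s \<partial>lborel) =
      (\<integral>\<^sup>+s\<in>{T..1}. ennreal (s powr (\<delta> - 1)) * boundary_count B s \<partial>lborel)"
  proof (intro nn_integral_cong)
    fix s
    show "ennreal (s powr (\<delta> - 1)) * n s * indicator {T..1} s =
      ennreal (s powr (\<delta> - 1)) * boundary_count B s * indicator {T..1} s"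
      using n(1)[of s] T by (cases "T \<le> s") (simp_all del: emeasure_count_space)
  qed
  also have "(\<integral>\<^sup>+s\<in>{0<..T}. n s \<partial>lborel) = emeasure lborel (parallel_set F T \<inter> B)"
    using n(2) T by simp
  finally show ?thesis .
qed

end

section \<open>Renewal inequalities, scaling exponents and weak limits\<close>

text \<open>The affine function t \<mapsto> E / m * t + d solves the renewal equation with constant
  driving term E, because the weights sum to 1 and the weighted mean of the delays is m. An upper
  bound on a window of length A therefore propagates; each induction step gains \<alpha>, the
  smallest delay. E may have any sign: lower bounds come from applying this to the negated function,
  and E = 0 yields plain boundedness.\<close>

lemma renewal_upper:
  fixes p a :: "'i \<Rightarrow> real" and j :: "real \<Rightarrow> real"
  assumes "finite I" and p: "\<And>i. i \<in> I \<Longrightarrow> 0 \<le> p i" "sum p I = 1"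
    and a: "0 < \<alpha>" "\<And>i. i \<in> I \<Longrightarrow> \<alpha> \<le> a i \<and> a i \<le> A"
    and m: "m = (\<Sum>i\<in>I. p i * a i)" "m \<noteq> 0"
    and step: "\<And>t. t1 \<le> t \<Longrightarrow> j t \<le> (\<Sum>i\<in>I. p i * j (t - a i)) + E"
    and base: "\<And>t. t1 - A \<le> t \<Longrightarrow> t \<le> t1 \<Longrightarrow> j t \<le> E / m * t + d"
    and t: "t1 - A \<le> t"
  shows "j t \<le> E / m * t + d"
proof -
  have "\<forall>t. t1 - A \<le> t \<longrightarrow> t \<le> t1 + real n * \<alpha> \<longrightarrow> j t \<le> E / m * t + d" for n :: nat
  proof (induction n)
    case 0
    then show ?case using base by simp
  next
    case (Suc n)
    show ?case
    proof (intro allI impI)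
      fix t assume t: "t1 - A \<le> t" "t \<le> t1 + real (Suc n) * \<alpha>"
      show "j t \<le> E / m * t + d"
      proof (cases "t \<le> t1")
        case True
        then show ?thesis using base t by simp
      next
        case False
        have "j t \<le> (\<Sum>i\<in>I. p i * j (t - a i)) + E" using False step by simp
        also have "(\<Sum>i\<in>I. p i * j (t - a i)) \<le> (\<Sum>i\<in>I. p i * (E / m * (t - a i) + d))"
        proof (intro sum_mono mult_left_mono p)
          fix i assume i: "i \<in> I"
          have "t1 - A \<le> t - a i" "t - a i \<le> t1 + real n * \<alpha>"
            using a(2)[OF i] t(2) False by (auto simp: algebra_simps)
          then show "j (t - a i) \<le> E / m * (t - a i) + d" using Suc by simp
        qed
        also have "\<dots> = (\<Sum>i\<in>I. (E / m * t + d) * p i - E / m * (p i * a i))"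
          by (intro sum.cong) (auto simp: algebra_simps)
        also have "\<dots> = (E / m * t + d) * sum p I - E / m * m"
          unfolding m(1) by (simp add: sum_subtractf sum_distrib_left)
        also have "\<dots> = E / m * t + d - E" using p(2) m(2) by simp
        finally show ?thesis by simp
      qed
    qed
  qed
  moreover obtain n :: nat where "t - t1 \<le> real n * \<alpha>"
    using real_arch_simple[of "(t - t1) / \<alpha>"] a(1) by (auto simp: field_simps)
  then have "t \<le> t1 + real n * \<alpha>" by simp
  ultimately show ?thesis using t by blast
qed

text \<open>From some t1 on the driving term lies within \<theta> of E, which traps j between two
  affine functions of nearby slopes; division by t removes the constants. Monotonicity bounds j on
  the initial window by its values at the ends.\<close>

lemma renewal_limit:
  fixes p a :: "'i \<Rightarrow> real" and j e :: "real \<Rightarrow> real"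
  assumes fin: "finite I" and p: "\<And>i. i \<in> I \<Longrightarrow> 0 \<le> p i" "sum p I = 1"
    and a: "0 < \<alpha>" "\<And>i. i \<in> I \<Longrightarrow> \<alpha> \<le> a i \<and> a i \<le> A"
    and m: "m = (\<Sum>i\<in>I. p i * a i)" "0 < m"
    and mono: "mono j"
    and eq: "\<And>t. j t = (\<Sum>i\<in>I. p i * j (t - a i)) + e t"
    and e: "(e \<longlongrightarrow> E) at_top"
  shows "((\<lambda>t. j t / t) \<longlongrightarrow> E / m) at_top"
proof (rule tendstoI)
  fix \<eta> :: real assume \<eta>: "0 < \<eta>"
  \<comment> \<open>An error \<theta> in the driving term changes the slope by \<theta> / m = \<eta>
    / 2; the other half of \<eta> pays for the constant term d / t.\<close>
  define \<theta> where "\<theta> = \<eta> * m / 2"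
  have \<theta>: "0 < \<theta>" "\<theta> / m = \<eta> / 2" using \<eta> m by (auto simp: \<theta>_def)
  obtain t1 where t1: "\<And>t. t1 \<le> t \<Longrightarrow> dist (e t) E < \<theta>"
    using tendstoD[OF e \<theta>(1)] by (auto simp: eventually_at_top_linorder)
  have e1: "e t \<le> E + \<theta>" "E - \<theta> \<le> e t" if "t1 \<le> t" for t
    using t1[OF that] unfolding dist_real_def by linarith+
  have lin: "\<bar>c * t\<bar> \<le> \<bar>c\<bar> * (\<bar>t1\<bar> + \<bar>A\<bar>)" if "t1 - A \<le> t" "t \<le> t1" for c t :: real
  proof -
    have "t \<le> \<bar>t1\<bar>" using that(2) abs_ge_self by (rule order_trans)
    moreover have "- t \<le> \<bar>t1\<bar> + \<bar>A\<bar>"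
      using that(1) add_mono[OF abs_ge_minus_self[of t1] abs_ge_self[of A]] by simp
    ultimately have "\<bar>t\<bar> \<le> \<bar>t1\<bar> + \<bar>A\<bar>"
      using add_increasing2[OF abs_ge_zero[of A], of t "\<bar>t1\<bar>"] by (simp only: abs_le_iff)
    then show ?thesis unfolding abs_mult by (rule mult_left_mono) simp
  qed
  define U where "U = (E + \<theta>) / m"
  \<comment> \<open>The slope for the negated function, whose driving term is eventually at most
    \<open>- (E - \<theta>)\<close>.\<close>
  define L where "L = - (E - \<theta>) / m"
  have neg_lin: "- (c * t) \<le> \<bar>c\<bar> * (\<bar>t1\<bar> + \<bar>A\<bar>)" if "t1 - A \<le> t" "t \<le> t1" for c t :: real
    using abs_ge_minus_self lin[OF that] by (rule order_trans)
  obtain bU where bU: "j t - U * t \<le> bU" if "t1 - A \<le> t" "t \<le> t1" for t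
  proof
    fix t assume t: "t1 - A \<le> t" "t \<le> t1"
    show "j t - U * t \<le> j t1 + \<bar>U\<bar> * (\<bar>t1\<bar> + \<bar>A\<bar>)"
      using add_mono[OF monoD[OF mono t(2)] neg_lin[OF t, of U]] by (simp only: diff_conv_add_uminus)
  qed
  obtain bL where bL: "- j t - L * t \<le> bL" if "t1 - A \<le> t" "t \<le> t1" for t
  proof
    fix t assume t: "t1 - A \<le> t" "t \<le> t1"
    show "- j t - L * t \<le> - j (t1 - A) + \<bar>L\<bar> * (\<bar>t1\<bar> + \<bar>A\<bar>)"
      using add_mono[OF le_imp_neg_le[OF monoD[OF mono t(1)]] neg_lin[OF t, of L]]
      by (simp only: diff_conv_add_uminus)
  qed
  define d where "d = max bU bL"
  have d: "bU \<le> d" "bL \<le> d" by (auto simp: d_def)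
  have up: "j t \<le> U * t + d" if t: "t1 - A \<le> t" for t
    unfolding U_def
  proof (rule renewal_upper[OF fin p a m(1) _ _ _ t])
    fix t assume "t1 - A \<le> t" "t \<le> t1"
    then show "j t \<le> (E + \<theta>) / m * t + d"
      using bU[of t] d(1) unfolding U_def by linarith
  next
    fix t assume "t1 \<le> t"
    then show "j t \<le> (\<Sum>i\<in>I. p i * j (t - a i)) + (E + \<theta>)" using eq[of t] e1 by simp
  qed (use m in auto)
  have low: "- j t \<le> L * t + d" if t: "t1 - A \<le> t" for t
    unfolding L_def
  proof (rule renewal_upper[OF fin p a m(1) _ _ _ t])
    fix t assume "t1 - A \<le> t" "t \<le> t1"
    then show "- j t \<le> - (E - \<theta>) / m * t + d"
      using bL[of t] d(2) unfolding L_def by linarith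
  next
    fix t assume "t1 \<le> t"
    then show "- j t \<le> (\<Sum>i\<in>I. p i * - j (t - a i)) + - (E - \<theta>)" using eq[of t] e1[of t] by (simp add: sum_negf)
  qed (use m in auto)
  have "\<forall>\<^sub>F t in at_top. dist (d / t) 0 < \<eta> / 2"
    using \<eta> by (intro tendstoD real_tendsto_divide_at_top[OF tendsto_const] filterlim_ident) auto
  moreover have "\<forall>\<^sub>F t in at_top. max (t1 - A) 1 \<le> t" by (rule eventually_ge_at_top)
  ultimately show "\<forall>\<^sub>F t in at_top. dist (j t / t) (E / m) < \<eta>"
  proof eventually_elim
    case (elim t)
    then have t: "t1 - A \<le> t" "0 < t" by auto
    have "j t / t \<le> U + d / t" using up[OF t(1)] t(2) by (simp add: field_simps)
    moreover have "- (j t / t) \<le> L + d / t" using low[OF t(1)] t(2) by (simp add: field_simps)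
    moreover have "U = E / m + \<eta> / 2" "L = - (E / m) + \<eta> / 2"
      using \<theta>(2) unfolding U_def L_def by (simp_all add: add_divide_distrib diff_divide_distrib)
    moreover have "d / t < \<eta> / 2"
      using le_less_trans[OF abs_ge_self elim(1)[unfolded dist_real_def diff_0_right]] .
    ultimately have "j t / t - E / m < \<eta>" "- (j t / t - E / m) < \<eta>" by linarith+
    then show ?case by (simp only: dist_real_def abs_less_iff)
  qed
qed

section \<open>From power bounds to scaling exponents, and from partitions to weak limits\<close>

lemma powr_at_right_0: "0 < s \<Longrightarrow> ((\<lambda>\<epsilon>::real. \<epsilon> powr s) \<longlongrightarrow> 0) (at_right 0)"
  using tendsto_powr'[of "\<lambda>\<epsilon>. \<epsilon>" 0 "at_right 0" "\<lambda>_. s" s]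
  by (auto simp: eventually_at_right_less eventually_at_filter tendsto_ident_at)

text \<open>Under two-sided bounds of order -s the product tends to 0 exactly for t > s: for t \<le>
  s and \<epsilon> < 1 it stays above c. The set under the infimum is thus the open ray beyond
  s.\<close>

lemma Inf_scaling_exponent:
  fixes g :: "real \<Rightarrow> ennreal"
  assumes c: "0 < c" and low: "\<forall>\<^sub>F \<epsilon> in at_right 0. ennreal (c * \<epsilon> powr - s) \<le> g \<epsilon>"
    and up: "\<forall>\<^sub>F \<epsilon> in at_right 0. g \<epsilon> \<le> ennreal (C * \<epsilon> powr - s)"
  shows "Inf {t. ((\<lambda>\<epsilon>. ennreal (\<epsilon> powr t) * g \<epsilon>) \<longlongrightarrow> 0) (at_right 0)} = s"
proof -
  have pos: "\<forall>\<^sub>F \<epsilon>::real in at_right 0. 0 < \<epsilon> \<and> \<epsilon> < 1"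
    by (auto simp: eventually_at_right_field intro: exI[of _ 1])
  have "((\<lambda>\<epsilon>. ennreal (\<epsilon> powr t) * g \<epsilon>) \<longlongrightarrow> 0) (at_right 0) \<longleftrightarrow> s < t" for t
  proof
    assume t: "s < t"
    have "((\<lambda>\<epsilon>. C * \<epsilon> powr (t - s)) \<longlongrightarrow> C * 0) (at_right 0)"
      using t by (intro tendsto_mult tendsto_const powr_at_right_0) simp
    then have 1: "((\<lambda>\<epsilon>. ennreal (C * \<epsilon> powr (t - s))) \<longlongrightarrow> 0) (at_right 0)"
      using tendsto_ennrealI by fastforce
    have 2: "\<forall>\<^sub>F \<epsilon> in at_right 0. ennreal (\<epsilon> powr t) * g \<epsilon> \<le> ennreal (C * \<epsilon> powr (t - s))"
      using up pos
    proof eventually_elim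
      case (elim \<epsilon>)
      have "ennreal (\<epsilon> powr t) * g \<epsilon> \<le> ennreal (\<epsilon> powr t) * ennreal (C * \<epsilon> powr - s)"
        using elim by (intro mult_left_mono) auto
      also have "\<dots> = ennreal (C * \<epsilon> powr (t - s))"
        unfolding ennreal_mult'[OF powr_ge_zero, symmetric] by (simp add: powr_diff powr_minus_divide mult.commute)
      finally show ?case .
    qed
    show "((\<lambda>\<epsilon>. ennreal (\<epsilon> powr t) * g \<epsilon>) \<longlongrightarrow> 0) (at_right 0)"
      by (rule tendsto_sandwich[OF _ 2 tendsto_const 1]) (rule always_eventually, simp)
  next
    assume lim: "((\<lambda>\<epsilon>. ennreal (\<epsilon> powr t) * g \<epsilon>) \<longlongrightarrow> 0) (at_right 0)"
    show "s < t"
    proof (rule ccontr)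
      assume t: "\<not> s < t"
      have "\<forall>\<^sub>F \<epsilon> in at_right 0. ennreal c \<le> ennreal (\<epsilon> powr t) * g \<epsilon>"
        using low pos
      proof eventually_elim
        case (elim \<epsilon>)
        have "1 powr (t - s) \<le> \<epsilon> powr (t - s)" using elim t by (intro powr_mono2') auto
        then have "c \<le> c * \<epsilon> powr (t - s)" using c by simp
        also have "\<dots> = \<epsilon> powr t * (c * \<epsilon> powr - s)" by (simp add: powr_diff powr_minus_divide mult.commute)
        finally have "ennreal c \<le> ennreal (\<epsilon> powr t) * ennreal (c * \<epsilon> powr - s)"
          unfolding ennreal_mult'[OF powr_ge_zero, symmetric] by (rule ennreal_leI)
        also have "\<dots> \<le> ennreal (\<epsilon> powr t) * g \<epsilon>" using elim by (intro mult_left_mono) auto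
        finally show ?case .
      qed
      from tendsto_lowerbound[OF lim this] c show False by simp
    qed
  qed
  then have "{t. ((\<lambda>\<epsilon>. ennreal (\<epsilon> powr t) * g \<epsilon>) \<longlongrightarrow> 0) (at_right 0)} = {s<..}" by auto
  then show ?thesis by simp
qed

text \<open>Almost every point lies in at most one cell. On the covered part f differs from the step
  function by at most \<eta>, elsewhere by at most K. The uncovered mass is written as total mass
  minus the sum of the cell masses, a form that passes to limits; with f = 1 and \<eta> = 0 the
  bound says that this difference is nonnegative.\<close>

lemma integral_partition_bound:
  fixes f :: "real \<Rightarrow> real"
  assumes M: "finite_measure M" "sets M = sets borel"
    and f: "f \<in> borel_measurable borel" "\<And>x. \<bar>f x\<bar> \<le> K"
    and I: "finite I" "\<And>i. i \<in> I \<Longrightarrow> S i \<in> sets borel"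
    and null: "\<And>i j. i \<in> I \<Longrightarrow> j \<in> I \<Longrightarrow> i \<noteq> j \<Longrightarrow> emeasure M (S i \<inter> S j) = 0"
    and c: "\<And>i x. i \<in> I \<Longrightarrow> x \<in> S i \<Longrightarrow> \<bar>f x - c i\<bar> \<le> \<eta>" "0 \<le> \<eta>"
  shows "\<bar>(\<integral>x. f x \<partial>M) - (\<Sum>i\<in>I. c i * measure M (S i))\<bar> \<le>
    \<eta> * measure M UNIV + K * (measure M UNIV - (\<Sum>i\<in>I. measure M (S i)))"
proof -
  interpret finite_measure M by fact
  have sp: "space M = UNIV" using sets_eq_imp_space_eq[OF M(2)] by simp
  have SM: "S i \<in> sets M" if "i \<in> I" for i using I(2)[OF that] M(2) by simp
  have fM: "f \<in> borel_measurable M" using f(1) measurable_cong_sets[OF M(2) refl] by blast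
  have int_f: "integrable M f"
    using fM f(2) by (intro integrable_const_bound[where B = K]) auto
  have int_i: "integrable M (indicator (S i) :: real \<Rightarrow> real)" if "i \<in> I" for i
    using SM[OF that] by (simp add: emeasure_finite less_top[symmetric])
  define g where "g = (\<lambda>x. \<Sum>i\<in>I. c i * indicator (S i) x)"
  define h where "h = (\<lambda>x. \<Sum>i\<in>I. indicator (S i) x :: real)"
  have int_g: "integrable M g" and int_h: "integrable M h"
    unfolding g_def h_def using int_i by (auto intro!: Bochner_Integration.integrable_sum)
  have gi: "(\<integral>x. g x \<partial>M) = (\<Sum>i\<in>I. c i * measure M (S i))"
    unfolding g_def using int_i SM by (subst Bochner_Integration.integral_sum) auto
  have hi: "(\<integral>x. h x \<partial>M) = (\<Sum>i\<in>I. measure M (S i))"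
    unfolding h_def using int_i SM by (subst Bochner_Integration.integral_sum) auto
  have "AE x in M. \<forall>i\<in>I. \<forall>j\<in>I. i \<noteq> j \<longrightarrow> x \<notin> S i \<inter> S j"
  proof -
    have "AE x in M. i \<noteq> j \<longrightarrow> x \<notin> S i \<inter> S j" if "i \<in> I" "j \<in> I" for i j
    proof (cases "i = j")
      case False
      then have "S i \<inter> S j \<in> null_sets M" using null[OF that] SM that by auto
      then show ?thesis using AE_not_in by fastforce
    qed simp
    then show ?thesis using I(1) by (simp add: AE_finite_all)
  qed
  then have bound: "AE x in M. \<bar>f x - g x\<bar> \<le> \<eta> + K * (1 - h x)"
  proof eventually_elim
    case (elim x)
    show ?case
    proof (cases "\<exists>i\<in>I. x \<in> S i")
      case True
      then obtain i where i: "i \<in> I" "x \<in> S i" by blast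
      have o: "indicator (S k) x = (if k = i then 1 else 0 :: real)" if "k \<in> I" for k
        using elim i that by (auto simp: indicator_def)
      have "g x = (\<Sum>k\<in>I. if k = i then c k else 0)"
        unfolding g_def by (intro sum.cong) (auto simp: o)
      then have "g x = c i" using I(1) i(1) by simp
      moreover have "h x = 1"
        unfolding h_def using o I(1) i(1) by (simp cong: sum.cong)
      ultimately show ?thesis using c i by simp
    next
      case False
      then have "g x = 0" "h x = 0" unfolding g_def h_def by (auto intro!: sum.neutral)
      then show ?thesis using f(2)[of x] c(2) by simp
    qed
  qed
  have "\<bar>(\<integral>x. f x \<partial>M) - (\<Sum>i\<in>I. c i * measure M (S i))\<bar> = \<bar>\<integral>x. f x - g x \<partial>M\<bar>"
    using int_f int_g gi by simp
  also have "\<dots> \<le> (\<integral>x. \<bar>f x - g x\<bar> \<partial>M)" by (rule integral_abs_bound)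
  also have "\<dots> \<le> (\<integral>x. \<eta> + K * (1 - h x) \<partial>M)"
    using bound int_f int_g int_h by (intro integral_mono_AE) auto
  also have "\<dots> = \<eta> * measure M UNIV + K * (measure M UNIV - (\<Sum>i\<in>I. measure M (S i)))"
    using int_h hi by (simp add: sp)
  finally show ?thesis .
qed

text \<open>Convergence on the cells of arbitrarily fine partitions determines the limit of
  integrals of functions that are uniformly continuous on J. Since the cells exhaust the limit
  measure, convergence of the total mass makes the mass outside the cells vanish asymptotically,
  wherever on the line it sits.\<close>

lemma weak_limit_partitions:
  fixes M :: "'a \<Rightarrow> real measure" and S :: "'i \<Rightarrow> real set" and I :: "nat \<Rightarrow> 'i set"
  assumes \<nu>: "finite_measure \<nu>" "sets \<nu> = sets borel"
    and M: "\<forall>\<^sub>F T in A. finite_measure (M T) \<and> sets (M T) = sets borel"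
    and I: "\<And>n. finite (I n)" "\<And>n i. i \<in> I n \<Longrightarrow> S i \<in> sets borel"
    and null_M: "\<And>n. \<forall>\<^sub>F T in A. \<forall>i\<in>I n. \<forall>j\<in>I n. i \<noteq> j \<longrightarrow> emeasure (M T) (S i \<inter> S j) = 0"
    and null_\<nu>: "\<And>n i j. i \<in> I n \<Longrightarrow> j \<in> I n \<Longrightarrow> i \<noteq> j \<Longrightarrow> emeasure \<nu> (S i \<inter> S j) = 0"
    and lim: "\<And>n i. i \<in> I n \<Longrightarrow> ((\<lambda>T. measure (M T) (S i)) \<longlongrightarrow> measure \<nu> (S i)) A"
    and total: "((\<lambda>T. measure (M T) UNIV) \<longlongrightarrow> measure \<nu> UNIV) A"
    and cover: "\<And>n. (\<Sum>i\<in>I n. measure \<nu> (S i)) = measure \<nu> UNIV"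
    and small: "\<And>e. 0 < e \<Longrightarrow> \<exists>n. \<forall>i\<in>I n. \<forall>x\<in>S i. \<forall>y\<in>S i. dist x y < e"
    and bdd: "\<And>n i. i \<in> I n \<Longrightarrow> S i \<subseteq> J" and J: "compact J"
  shows "weak_limit M \<nu> A"
  unfolding weak_limit_def
proof (intro conjI allI impI)
  fix f :: "real \<Rightarrow> real" assume f: "continuous_on UNIV f \<and> bounded (range f)"
  then have fb: "f \<in> borel_measurable borel" by (intro borel_measurable_continuous_onI) simp
  obtain K where "\<forall>y\<in>range f. norm y \<le> K" using conjunct2[OF f] unfolding bounded_iff by blast
  then have K: "\<bar>f x\<bar> \<le> K" for x by simp
  have uc: "uniformly_continuous_on J f"
    using continuous_on_subset[OF conjunct1[OF f] subset_UNIV] J by (rule compact_uniformly_continuous)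
  show "((\<lambda>T. \<integral>x. f x \<partial>M T) \<longlongrightarrow> (\<integral>x. f x \<partial>\<nu>)) A"
  proof (rule tendstoI)
    fix e :: real assume e: "0 < e"
    \<comment> \<open>The oscillation error occurs twice, once for \<open>M T\<close> and once for
      the limit, so \<eta> times twice the total mass has to stay below e; the added 1 covers the
      case of total mass 0.\<close>
    define \<eta> where "\<eta> = e / (2 * (measure \<nu> UNIV + 1))"
    have mp: "0 < measure \<nu> UNIV + 1" using measure_nonneg[of \<nu> UNIV] by linarith
    have \<eta>: "0 < \<eta>" "2 * (\<eta> * measure \<nu> UNIV) < e"
      using e mp by (auto simp: \<eta>_def field_simps)
    obtain \<rho> where \<rho>: "0 < \<rho>" "\<And>x y. x \<in> J \<Longrightarrow> y \<in> J \<Longrightarrow> dist x y < \<rho> \<Longrightarrow> dist (f x) (f y) < \<eta>"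
      using uc \<eta>(1) unfolding uniformly_continuous_on_def by metis
    obtain n where n: "\<And>i x y. i \<in> I n \<Longrightarrow> x \<in> S i \<Longrightarrow> y \<in> S i \<Longrightarrow> dist x y < \<rho>"
      using small[OF \<rho>(1)] by blast
    \<comment> \<open>For an empty cell the chosen value is arbitrary, but it is only ever
      multiplied by the measure of that cell.\<close>
    define c where "c = (\<lambda>i. f (SOME x. x \<in> S i))"
    have c: "\<bar>f x - c i\<bar> \<le> \<eta>" if i: "i \<in> I n" "x \<in> S i" for i x
    proof -
      have "(SOME x. x \<in> S i) \<in> S i" using someI[of "\<lambda>x. x \<in> S i", OF i(2)] .
      then have "dist (f x) (c i) < \<eta>"
        unfolding c_def using bdd[OF i(1)] i by (intro \<rho>(2) n[OF i(1)]) auto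
      then show ?thesis by (simp add: dist_real_def)
    qed
    have \<nu>_bound: "\<bar>(\<integral>x. f x \<partial>\<nu>) - (\<Sum>i\<in>I n. c i * measure \<nu> (S i))\<bar> \<le> \<eta> * measure \<nu> UNIV"
    proof -
      have "\<bar>(\<integral>x. f x \<partial>\<nu>) - (\<Sum>i\<in>I n. c i * measure \<nu> (S i))\<bar> \<le>
          \<eta> * measure \<nu> UNIV + K * (measure \<nu> UNIV - (\<Sum>i\<in>I n. measure \<nu> (S i)))"
        by (rule integral_partition_bound[where I = "I n" and S = S and c = c, OF \<nu> fb K I null_\<nu> c])
          (use \<eta>(1) in simp_all)
      then show ?thesis by (simp add: cover)
    qed
    let ?U = "\<lambda>T. \<eta> * measure (M T) UNIV + K * (measure (M T) UNIV - (\<Sum>i\<in>I n. measure (M T) (S i)))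
       + \<bar>\<Sum>i\<in>I n. c i * (measure (M T) (S i) - measure \<nu> (S i))\<bar> + \<eta> * measure \<nu> UNIV"
    have "(?U \<longlongrightarrow> \<eta> * measure \<nu> UNIV + K * (measure \<nu> UNIV - (\<Sum>i\<in>I n. measure \<nu> (S i)))
       + \<bar>\<Sum>i\<in>I n. c i * (measure \<nu> (S i) - measure \<nu> (S i))\<bar> + \<eta> * measure \<nu> UNIV) A"
      by (intro tendsto_intros total lim)
    then have "\<forall>\<^sub>F T in A. ?U T < e"
      using \<eta>(2) by (intro order_tendstoD(2)) (auto simp: cover)
    with M null_M[of n] show "\<forall>\<^sub>F T in A. dist (\<integral>x. f x \<partial>M T) (\<integral>x. f x \<partial>\<nu>) < e"
    proof eventually_elim
      case (elim T)
      have "\<bar>(\<integral>x. f x \<partial>M T) - (\<Sum>i\<in>I n. c i * measure (M T) (S i))\<bar> \<le>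
          \<eta> * measure (M T) UNIV + K * (measure (M T) UNIV - (\<Sum>i\<in>I n. measure (M T) (S i)))"
        by (rule integral_partition_bound[where I = "I n" and S = S and c = c, OF _ _ fb K I _ c])
          (use elim \<eta>(1) in simp_all)
      moreover have "(\<Sum>i\<in>I n. c i * (measure (M T) (S i) - measure \<nu> (S i))) =
          (\<Sum>i\<in>I n. c i * measure (M T) (S i)) - (\<Sum>i\<in>I n. c i * measure \<nu> (S i))"
        by (simp add: right_diff_distrib sum_subtractf)
      ultimately show ?case using \<nu>_bound elim(3) unfolding dist_real_def by linarith
    qed
  qed
qed (use \<nu> M in auto)

text \<open>If both limits coincided, g would converge, and the lower bound k1 would make the limit
  positive. Excluding positive real limits is therefore enough for strictness.\<close>

lemma Liminf_less_Limsup: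
  fixes g :: "real \<Rightarrow> real"
  assumes k: "0 < k1" "\<forall>\<^sub>F \<epsilon> in at_right 0. k1 \<le> g \<epsilon>" "\<forall>\<^sub>F \<epsilon> in at_right 0. g \<epsilon> \<le> k2"
    and no_lim: "\<And>c. 0 < c \<Longrightarrow> \<not> (g \<longlongrightarrow> c) (at_right 0)"
  shows "0 < Liminf (at_right 0) (\<lambda>\<epsilon>. ennreal (g \<epsilon>)) \<and>
    Liminf (at_right 0) (\<lambda>\<epsilon>. ennreal (g \<epsilon>)) < Limsup (at_right 0) (\<lambda>\<epsilon>. ennreal (g \<epsilon>)) \<and>
    Limsup (at_right 0) (\<lambda>\<epsilon>. ennreal (g \<epsilon>)) < \<infinity>"
proof -
  let ?l = "Liminf (at_right 0) (\<lambda>\<epsilon>. ennreal (g \<epsilon>))" and ?u = "Limsup (at_right 0) (\<lambda>\<epsilon>. ennreal (g \<epsilon>))"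
  have l: "ennreal k1 \<le> ?l"
    using k(2) by (intro Liminf_bounded) (auto elim!: eventually_mono intro: ennreal_leI)
  have u: "?u \<le> ennreal k2"
    using k(3) by (intro Limsup_bounded) (auto elim!: eventually_mono intro: ennreal_leI)
  have lu: "?l \<le> ?u" by (intro Liminf_le_Limsup) simp
  have "?l \<noteq> ?u"
  proof
    assume eq: "?l = ?u"
    obtain c where c: "0 \<le> c" "?u = ennreal c"
      using u by (cases ?u) (auto simp: top_unique)
    then have "ennreal k1 \<le> ennreal c" using l eq by simp
    then have "0 < c" using k(1) c(1) by (auto simp: ennreal_le_iff2)
    have "((\<lambda>\<epsilon>. ennreal (g \<epsilon>)) \<longlongrightarrow> ennreal c) (at_right 0)"
      using eq c by (subst tendsto_iff_Liminf_eq_Limsup) auto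
    moreover have "\<forall>\<^sub>F \<epsilon> in at_right 0. 0 \<le> g \<epsilon>"
      using k(2) by eventually_elim (use k(1) in simp)
    ultimately have "(g \<longlongrightarrow> c) (at_right 0)"
      using c(1) by (subst (asm) tendsto_ennreal_iff) auto
    then show False using no_lim \<open>0 < c\<close> by blast
  qed
  moreover have "0 < ?l" using l k(1) by (metis ennreal_less_zero_iff less_le_trans)
  moreover have "?u < \<infinity>" using u by (metis ennreal_less_top infinity_ennreal_def le_less_trans)
  ultimately show ?thesis using lu by simp
qed

text \<open>Isolation of 0 becomes, by subtraction, a distance of at least e between any two
  different elements. Hence the infimum h of the positive elements is attained: otherwise two of
  them would lie within e of each other. Subtracting the integer part of x / h leaves an element of
  [0, h), which must be 0.\<close>

lemma discrete_subgroup_cyclic: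
  assumes G: "discrete_subgroup G" and a: "a \<in> G" "0 < a"
  obtains h where "0 < h" "\<And>x. x \<in> G \<Longrightarrow> \<exists>k::int. x = h * of_int k"
proof -
  have G0: "0 \<in> G" and Gadd: "\<And>x y. x \<in> G \<Longrightarrow> y \<in> G \<Longrightarrow> x + y \<in> G"
    and Gneg: "\<And>x. x \<in> G \<Longrightarrow> - x \<in> G" and "discrete G"
    using G by (auto simp: discrete_subgroup_def)
  have Gdiff: "x - y \<in> G" if "x \<in> G" "y \<in> G" for x y
    using Gadd[OF that(1) Gneg[OF that(2)]] by simp
  have Gnat: "of_nat n * x \<in> G" if "x \<in> G" for x and n :: nat
    by (induction n) (auto simp: algebra_simps G0 intro: Gadd that)
  have Gint: "of_int k * x \<in> G" if "x \<in> G" for x and k :: int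
    using Gnat[OF that, of "nat k"] Gneg[OF Gnat[OF that, of "nat (- k)"]] by (cases "0 \<le> k") auto
  have "0 isolated_in G" using \<open>discrete G\<close> G0 by (simp add: discrete_def)
  then obtain e where "0 < e" "\<forall>y\<in>G. dist 0 y < e \<longrightarrow> y = 0"
    unfolding isolated_in_dist_Ex_iff by blast
  then have e: "0 < e" "\<And>x. x \<in> G \<Longrightarrow> \<bar>x\<bar> < e \<Longrightarrow> x = 0" by simp_all
  define h where "h = Inf {x \<in> G. 0 < x}"
  have bdd: "bdd_below {x \<in> G. 0 < x}" by (auto intro!: bdd_belowI[of _ 0])
  have eh: "e \<le> h" unfolding h_def
  proof (rule cInf_greatest)
    show "e \<le> x" if "x \<in> {x \<in> G. 0 < x}" for x using e(2)[of x] that by fastforce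
  qed (use a in auto)
  have h_le: "h \<le> x" if "x \<in> G" "0 < x" for x
    unfolding h_def using that by (intro cInf_lower[OF _ bdd]) simp
  have "h \<in> G"
  proof (rule ccontr)
    assume n: "h \<notin> G"
    obtain x where x: "x \<in> G" "0 < x" "x < h + e"
      using cInf_lessD[of "{x \<in> G. 0 < x}" "h + e"] a e(1) unfolding h_def by auto
    have "h \<noteq> x" using n x(1) by blast
    then have "h < x" using h_le[OF x(1,2)] by simp
    then obtain y where y: "y \<in> G" "0 < y" "y < x"
      using cInf_lessD[of "{x \<in> G. 0 < x}" x] a unfolding h_def by auto
    have "h \<le> y" using y by (intro h_le)
    then have "\<bar>x - y\<bar> < e" using x y by linarith
    then show False using e(2)[OF Gdiff[OF x(1) y(1)]] y by simp
  qed
  have "\<exists>k::int. x = h * of_int k" if x: "x \<in> G" for x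
  proof (intro exI)
    define k where "k = \<lfloor>x / h\<rfloor>"
    have h: "0 < h" using e(1) eh by linarith
    let ?y = "x - of_int k * h"
    have "?y \<in> G" using Gdiff[OF x Gint[OF \<open>h \<in> G\<close>]] .
    moreover have "0 \<le> ?y" "?y < h"
    proof -
      have "of_int k \<le> x / h" "x / h < of_int k + 1" by (simp_all add: k_def)
      then show "0 \<le> ?y" "?y < h"
        using h by (simp_all add: pos_le_divide_eq pos_divide_less_eq distrib_right)
    qed
    ultimately have "?y = 0" using h_le[of ?y] by linarith
    then show "x = h * of_int k" by simp
  qed
  then show thesis using that e(1) eh by (meson less_le_trans)
qed

text \<open>The mean value theorem on each half of the interval, where the derivative is strictly
  decreasing.\<close>

lemma powr_strictly_midpoint_concave:
  fixes x y s :: real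
  assumes x: "0 < x" "x < y" and s: "0 < s" "s < 1"
  shows "x powr s + y powr s < 2 * ((x + y) / 2) powr s"
proof -
  define z where "z = (x + y) / 2"
  have z: "x < z" "z < y" "z - x = y - z" using x by (auto simp: z_def field_simps)
  have D: "((\<lambda>t. t powr s) has_real_derivative s * t powr (s - 1)) (at t)" if "0 < t" for t
    using that by (auto intro!: derivative_eq_intros)
  obtain \<xi>1 where \<xi>1: "x < \<xi>1" "\<xi>1 < z" "z powr s - x powr s = (z - x) * (s * \<xi>1 powr (s - 1))"
    using MVT2[OF z(1), of "\<lambda>t. t powr s" "\<lambda>t. s * t powr (s - 1)"] D x by auto
  obtain \<xi>2 where \<xi>2: "z < \<xi>2" "\<xi>2 < y" "y powr s - z powr s = (y - z) * (s * \<xi>2 powr (s - 1))"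
    using MVT2[OF z(2), of "\<lambda>t. t powr s" "\<lambda>t. s * t powr (s - 1)"] D x z by auto
  have "\<xi>2 powr (s - 1) < \<xi>1 powr (s - 1)"
    using \<xi>1 \<xi>2 x s by (intro powr_less_mono2_neg) auto
  then have "y powr s - z powr s < z powr s - x powr s"
    unfolding \<xi>1(3) \<xi>2(3) z(3) using s z by (intro mult_strict_left_mono) auto
  then show ?thesis unfolding z_def by simp
qed

section \<open>Geometry of the iterated function system\<close>

text \<open>A negative slope swaps the endpoints; giving them as an unordered pair lets later
  arguments ignore the orientation of the maps.\<close>

lemma affine_image_interval:
  fixes k s u v :: real
  assumes "s \<noteq> 0" "u \<le> v"
  obtains c d where "{c, d} = {k + s * u, k + s * v}" "d - c = \<bar>s\<bar> * (v - u)"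
    "(\<lambda>x. k + s * x) ` {u<..<v} = {c<..<d}" "(\<lambda>x. k + s * x) ` {u..v} = {c..d}"
proof -
  have im: "(\<lambda>x. k + s * x) ` A = {x. (x - k) / s \<in> A}" for A
    using assms(1) by (auto simp: image_iff intro!: bexI[of _ "(x - k) / s" for x])
  show thesis
  proof (cases "0 < s")
    case True
    show thesis
      by (rule that[of "k + s * u" "k + s * v"], unfold im)
        (use True in \<open>auto simp: set_eq_iff pos_le_divide_eq pos_divide_le_eq pos_less_divide_eq
          pos_divide_less_eq algebra_simps\<close>)
  next
    case False
    then have "s < 0" using assms by simp
    then show thesis
      by (intro that[of "k + s * v" "k + s * u"], unfold im)
        (auto simp: set_eq_iff neg_le_divide_eq neg_divide_le_eq neg_less_divide_eq
          neg_divide_less_eq algebra_simps)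
  qed
qed

text \<open>For p = min X, x and q = max X the distances of the images add up as those of p, x, q
  do. Equality in the triangle inequality forces f x to lie between f p and f q, which fixes the
  sign of the slope for all x at once.\<close>

lemma similarity_on_interval_affine:
  assumes f: "similarity_on X c f" and X: "compact X" "X \<noteq> {}" and c: "0 \<le> c"
  obtains k s where "\<bar>s\<bar> = c" "\<And>x. x \<in> X \<Longrightarrow> f x = k + s * x"
proof -
  have bdd: "bdd_below X" "bdd_above X" and "closed X"
    using X by (auto simp: compact_imp_closed compact_imp_bounded bounded_imp_bdd_below bounded_imp_bdd_above)
  define p q where "p = Inf X" and "q = Sup X"
  have pq: "p \<in> X" "q \<in> X"
    unfolding p_def q_def using bdd \<open>closed X\<close> X by (auto intro: closed_contains_Inf closed_contains_Sup)
  have between: "p \<le> x" "x \<le> q" if "x \<in> X" for x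
    unfolding p_def q_def using bdd that by (auto intro: cInf_lower cSup_upper)
  have dist: "\<bar>f x - f y\<bar> = c * \<bar>x - y\<bar>" if "x \<in> X" "y \<in> X" for x y
    using f that by (auto simp: similarity_on_def dist_real_def)
  define s where "s = (if f p \<le> f q then c else - c)"
  have "f x = (f p - s * p) + s * x" if x: "x \<in> X" for x
  proof -
    define A B where "A = c * (x - p)" and "B = c * (q - x)"
    have AB: "0 \<le> A" "0 \<le> B" "c * (q - p) = A + B"
      unfolding A_def B_def using c between[OF x] by (simp_all flip: distrib_left)
    have "\<bar>f x - f p\<bar> = A" "\<bar>f q - f x\<bar> = B" "\<bar>f q - f p\<bar> = A + B"
      using dist[OF x pq(1)] dist[OF pq(2) x] dist[OF pq(2) pq(1)] between[OF x] between[OF pq(1)] AB(3)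
      by (simp_all add: A_def B_def)
    then have "f x - f p = (if f p \<le> f q then A else - A)"
      using AB(1,2) by (auto split: if_splits)
    then show ?thesis by (auto simp: s_def A_def algebra_simps)
  qed
  moreover have "\<bar>s\<bar> = c" using c by (simp add: s_def)
  ultimately show thesis by (rule that[rotated])
qed

locale interval_ifs =
  fixes X F :: "real set" and N :: nat and \<phi> :: "nat \<Rightarrow> real \<Rightarrow> real" and r :: "nat \<Rightarrow> real"
  assumes ifs: "similarity_ifs X N \<phi> r"
    and self_similar: "self_similar_set X N \<phi> F"
    and osc: "feasible_open_set N \<phi> (interior X)"
    and null_F: "emeasure lborel F = 0"
begin

lemma X: "X \<noteq> {}" "is_interval X" "compact X"
  and two_maps: "2 \<le> N"
  and maps_X: "i \<in> {1..N} \<Longrightarrow> \<phi> i ` X \<subseteq> X"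
  and ratio: "i \<in> {1..N} \<Longrightarrow> 0 < r i" "i \<in> {1..N} \<Longrightarrow> r i < 1"
  and similarity: "i \<in> {1..N} \<Longrightarrow> similarity_on X (r i) (\<phi> i)"
  using ifs by (auto simp: similarity_ifs_def)

lemma F_X: "F \<subseteq> X" and F_eq: "F = (\<Union>i\<in>{1..N}. \<phi> i ` F)"
  using self_similar unfolding self_similar_set_def by blast+

sublocale compact_real F
  using self_similar by unfold_locales (auto simp: self_similar_set_def)

lemma interval_X: "u \<in> X \<Longrightarrow> v \<in> X \<Longrightarrow> {u..v} \<subseteq> X"
  using X(2) unfolding is_interval_1 by (meson atLeastAtMost_iff subsetI)

lemma hull_X: "{lo..hi} \<subseteq> X"
  using interval_X lo_in hi_in F_X by blast

section \<open>Pieces of the hull of F\<close>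

lemma affine:
  assumes "i \<in> {1..N}"
  obtains k s where "\<bar>s\<bar> = r i" "s \<noteq> 0" "\<And>x. x \<in> X \<Longrightarrow> \<phi> i x = k + s * x"
proof -
  obtain k s where ks: "\<bar>s\<bar> = r i" "\<And>x. x \<in> X \<Longrightarrow> \<phi> i x = k + s * x"
    using similarity_on_interval_affine[OF similarity[OF assms] X(3,1)] ratio[OF assms] by (metis less_imp_le)
  then have "s \<noteq> 0" using ratio(1)[OF assms] by auto
  then show thesis using ks that by blast
qed

lemma dist_map: "i \<in> {1..N} \<Longrightarrow> x \<in> X \<Longrightarrow> y \<in> X \<Longrightarrow> dist (\<phi> i x) (\<phi> i y) = r i * dist x y"
  using similarity by (auto simp: similarity_on_def)

lemma inj_map: "i \<in> {1..N} \<Longrightarrow> inj_on (\<phi> i) X"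
  by (rule inj_onI) (metis dist_map dist_eq_0_iff mult_eq_0_iff ratio(1) less_irrefl)

lemma image_interval:
  assumes i: "i \<in> {1..N}" and uv: "u \<in> X" "v \<in> X" "u \<le> v"
  obtains c d where "{c, d} = {\<phi> i u, \<phi> i v}" "d - c = r i * (v - u)"
    "\<phi> i ` {u<..<v} = {c<..<d}" "\<phi> i ` {u..v} = {c..d}"
proof -
  obtain k s where ks: "\<bar>s\<bar> = r i" "s \<noteq> 0" "\<And>x. x \<in> X \<Longrightarrow> \<phi> i x = k + s * x"
    using affine[OF i] by blast
  obtain c d where cd: "{c, d} = {k + s * u, k + s * v}" "d - c = \<bar>s\<bar> * (v - u)"
    "(\<lambda>x. k + s * x) ` {u<..<v} = {c<..<d}" "(\<lambda>x. k + s * x) ` {u..v} = {c..d}"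
    using affine_image_interval[OF ks(2) uv(3)] by blast
  have sub: "{u..v} \<subseteq> X" "{u<..<v} \<subseteq> X" using interval_X[OF uv(1,2)] by auto
  have "\<phi> i ` A = (\<lambda>x. k + s * x) ` A" if "A \<subseteq> X" for A
    using that ks(3) by (intro image_cong) auto
  then show thesis using that[of c d] cd sub ks uv by simp
qed

lemma map_F: "i \<in> {1..N} \<Longrightarrow> u \<in> F \<Longrightarrow> \<phi> i u \<in> F"
  by (rule equalityD2[OF F_eq, THEN subsetD]) blast

lemma F_cases:
  assumes "z \<in> F"
  obtains j x where "j \<in> {1..N}" "x \<in> F" "z = \<phi> j x"
  using equalityD1[OF F_eq, THEN subsetD, OF assms] by blast

abbreviation piece :: "nat \<Rightarrow> real set" where "piece i \<equiv> \<phi> i ` {lo..hi}"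

lemma lo_X: "lo \<in> X" and hi_X: "hi \<in> X"
  using lo_in hi_in F_X by auto

lemma piece_interval:
  assumes i: "i \<in> {1..N}"
  obtains c d where "c \<in> F" "d \<in> F" "d - c = r i * (hi - lo)" "\<phi> i ` {lo<..<hi} = {c<..<d}"
    "piece i = {c..d}"
proof (rule image_interval[OF i lo_X hi_X lo_le_hi])
  fix c d
  assume cd: "{c, d} = {\<phi> i lo, \<phi> i hi}" "d - c = r i * (hi - lo)"
    "\<phi> i ` {lo<..<hi} = {c<..<d}" "piece i = {c..d}"
  have "{\<phi> i lo, \<phi> i hi} \<subseteq> F" using map_F[OF i lo_in] map_F[OF i hi_in] by simp
  then have "c \<in> F" "d \<in> F" unfolding cd(1)[symmetric] by simp_all
  then show thesis using cd(2-4) by (rule that)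
qed

lemma piece_subset:
  assumes i: "i \<in> {1..N}"
  shows "piece i \<subseteq> {lo..hi}"
proof -
  obtain c d where cd: "c \<in> F" "d \<in> F" "d - c = r i * (hi - lo)" "\<phi> i ` {lo<..<hi} = {c<..<d}"
    "piece i = {c..d}" by (rule piece_interval[OF i])
  have "lo \<le> c" "d \<le> hi" using subsetD[OF F_subset cd(1)] subsetD[OF F_subset cd(2)] by simp_all
  then show ?thesis unfolding cd(5) by simp
qed

lemma F_subset_pieces: "F \<subseteq> (\<Union>i\<in>{1..N}. piece i)"
proof
  fix z assume "z \<in> F"
  then obtain j x where "j \<in> {1..N}" "x \<in> F" "z = \<phi> j x" by (rule F_cases)
  then show "z \<in> (\<Union>i\<in>{1..N}. piece i)" using F_subset by blast
qed

text \<open>If F were a single point, every map would fix it. Two affine maps with a common fixed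
  point commute, so suitable compositions in either order send an interior point of X to the same
  place, contradicting the disjointness of the images of the interior.\<close>

lemma lo_less_hi: "lo < hi"
proof (rule ccontr)
  assume "\<not> lo < hi"
  then have F1: "F = {lo}" using F_subset lo_in by force
  have fp: "\<phi> i lo = lo" if "i \<in> {1..N}" for i
    using map_F[OF that lo_in] F1 by blast
  obtain z where z: "z \<in> interior X" "z \<noteq> lo"
  proof -
    have "interior X \<noteq> {}" using osc by (simp add: feasible_open_set_def)
    then have "\<not> interior X \<subseteq> {lo}"
      using open_interior[of X] not_open_singleton[of lo] subset_singletonD by metis
    then show thesis using that by blast
  qed
  have zX: "z \<in> X" "lo \<in> X" using z(1) interior_subset lo_in F_X by blast+
  have seg: "lo + t * (z - lo) \<in> interior X" if "0 < t" "t \<le> 1" for t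
  proof -
    have "lo - t *\<^sub>R (lo - z) \<in> interior X"
      using is_interval_convex[OF X(2)] z(1) zX(2) that by (rule mem_interior_convex_shrink)
    then show ?thesis by (simp add: algebra_simps)
  qed
  have 12: "1 \<in> {1..N}" "2 \<in> {1..N}" using two_maps by auto
  obtain k1 s1 where a1: "\<bar>s1\<bar> = r 1" "\<And>x. x \<in> X \<Longrightarrow> \<phi> 1 x = k1 + s1 * x"
    using affine[OF 12(1)] by blast
  obtain k2 s2 where a2: "\<bar>s2\<bar> = r 2" "\<And>x. x \<in> X \<Longrightarrow> \<phi> 2 x = k2 + s2 * x"
    using affine[OF 12(2)] by blast
  have f1: "\<phi> 1 x = lo + s1 * (x - lo)" and f2: "\<phi> 2 x = lo + s2 * (x - lo)" if "x \<in> X" for x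
    using a1(2)[OF that] a1(2)[OF zX(2)] a2(2)[OF that] a2(2)[OF zX(2)] fp[OF 12(1)] fp[OF 12(2)]
    by (auto simp: algebra_simps)
  have comm: "\<phi> 1 ` interior X \<inter> \<phi> 2 ` interior X = {}"
    using osc 12 unfolding feasible_open_set_def by simp
  \<comment> \<open>Both maps fix \<open>lo\<close>; applying each of them twice makes the ratios positive.\<close>
  let ?p = "lo + s1\<^sup>2 * s2\<^sup>2 * (z - lo)"
  have map_int: "\<phi> i x \<in> interior X" if "i \<in> {1..N}" "x \<in> interior X" for i x
    using osc that unfolding feasible_open_set_def by blast
  have sq: "0 < s1\<^sup>2" "s1\<^sup>2 \<le> 1" "0 < s2\<^sup>2" "s2\<^sup>2 \<le> 1"
    using a1(1) a2(1) ratio[OF 12(1)] ratio[OF 12(2)] by (auto simp: abs_square_le_1)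
  have m: "lo + s1\<^sup>2 * (z - lo) \<in> X" "lo + s2\<^sup>2 * (z - lo) \<in> X"
    using seg sq interior_subset by blast+
  have "\<phi> 1 (\<phi> 1 x) = lo + s1\<^sup>2 * (x - lo)" "\<phi> 2 (\<phi> 2 x) = lo + s2\<^sup>2 * (x - lo)" if x: "x \<in> X" for x
  proof -
    have \<phi>x: "\<phi> 1 x \<in> X" "\<phi> 2 x \<in> X" using x maps_X 12 by blast+
    show "\<phi> 1 (\<phi> 1 x) = lo + s1\<^sup>2 * (x - lo)"
      by (subst f1[OF \<phi>x(1)], subst f1[OF x]) (simp add: power2_eq_square)
    show "\<phi> 2 (\<phi> 2 x) = lo + s2\<^sup>2 * (x - lo)"
      by (subst f2[OF \<phi>x(2)], subst f2[OF x]) (simp add: power2_eq_square)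
  qed
  from this(2)[OF m(1)] this(1)[OF m(2)]
  have "\<phi> 2 (\<phi> 2 (lo + s1\<^sup>2 * (z - lo))) = ?p" "\<phi> 1 (\<phi> 1 (lo + s2\<^sup>2 * (z - lo))) = ?p"
    by (simp_all only: add_diff_cancel_left' mult.assoc mult.left_commute)
  moreover have "\<phi> 1 (lo + s2\<^sup>2 * (z - lo)) \<in> interior X" "\<phi> 2 (lo + s1\<^sup>2 * (z - lo)) \<in> interior X"
    using map_int[OF 12(1) seg[OF sq(3,4)]] map_int[OF 12(2) seg[OF sq(1,2)]] by simp_all
  ultimately have "?p \<in> \<phi> 1 ` interior X \<inter> \<phi> 2 ` interior X" by (metis IntI image_eqI)
  then show False using comm by blast
qed

lemma hull_interior: "{lo<..<hi} \<subseteq> interior X"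
  using hull_X by (intro interior_maximal) auto

text \<open>Closed pieces may share an endpoint, so only the open image can avoid the other closed
  piece: an open set disjoint from an open interval is also disjoint from its closure.\<close>

lemma disjoint_pieces:
  assumes "i \<in> {1..N}" "j \<in> {1..N}" "i \<noteq> j"
  shows "\<phi> i ` {lo<..<hi} \<inter> piece j = {}"
proof -
  obtain c d where cd: "c \<in> F" "d \<in> F" "d - c = r i * (hi - lo)" "\<phi> i ` {lo<..<hi} = {c<..<d}"
    "piece i = {c..d}" by (rule piece_interval[OF assms(1)])
  obtain c' d' where cd': "c' \<in> F" "d' \<in> F" "d' - c' = r j * (hi - lo)" "\<phi> j ` {lo<..<hi} = {c'<..<d'}"
    "piece j = {c'..d'}" by (rule piece_interval[OF assms(2)])
  have "0 < r j * (hi - lo)" using ratio(1)[OF assms(2)] lo_less_hi by simp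
  then have "c' < d'" using cd'(3) by simp
  have "\<phi> i ` interior X \<inter> \<phi> j ` interior X = {}"
    using osc assms unfolding feasible_open_set_def by simp
  then have "{c<..<d} \<inter> {c'<..<d'} = {}" unfolding cd(4)[symmetric] cd'(4)[symmetric] using hull_interior by blast
  then have "{c<..<d} \<inter> closure {c'<..<d'} = {}" by (subst open_Int_closure_eq_empty) auto
  then show ?thesis unfolding cd(4) cd'(5) using \<open>c' < d'\<close> by simp
qed

text \<open>A point of F in piece i that comes from another map can only be an end of piece i, that
  is, the image of \<open>lo\<close> or \<open>hi\<close>; both of these belong to F.\<close>

lemma F_Int_piece:
  assumes i: "i \<in> {1..N}" shows "F \<inter> piece i = \<phi> i ` F"
proof
  show "\<phi> i ` F \<subseteq> F \<inter> piece i" using map_F[OF i] F_subset by blast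
  show "F \<inter> piece i \<subseteq> \<phi> i ` F"
  proof
    fix z assume z: "z \<in> F \<inter> piece i"
    then obtain y where y: "y \<in> {lo..hi}" "z = \<phi> i y" by blast
    have "z \<in> F" using z by simp
    then obtain j x where j: "j \<in> {1..N}" "x \<in> F" "z = \<phi> j x" by (rule F_cases)
    show "z \<in> \<phi> i ` F"
    proof (cases "i = j")
      case False
      have "z \<in> piece j" using j F_subset by blast
      then have "y \<notin> {lo<..<hi}" using disjoint_pieces[OF i j(1) False] y(2) by blast
      then have "y = lo \<or> y = hi" using y(1) by auto
      then show ?thesis using y(2) lo_in hi_in by blast
    qed (use j in blast)
  qed
qed

section \<open>How the maps act on the gaps\<close>

lemma gap_X: "C \<in> gaps F \<Longrightarrow> C \<subseteq> X"
  using gap_subset[of C] hull_X by (meson greaterThanLessThan_subseteq_atLeastAtMost_iff order_refl subset_trans)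

lemma gap_image:
  assumes i: "i \<in> {1..N}" and C: "C \<in> gaps F"
  shows "\<phi> i ` C \<in> gaps F" "measure lborel (\<phi> i ` C) = r i * measure lborel C" "\<phi> i ` C \<subseteq> piece i"
proof -
  from C obtain u v where uv: "C = {u<..<v}" "u < v" "u \<in> F" "v \<in> F" "{u<..<v} \<inter> F = {}" "measure lborel C = v - u"
    by (rule gapE)
  have uvX: "u \<in> X" "v \<in> X" "u \<le> v" using uv F_X by auto
  obtain c d where cd: "{c, d} = {\<phi> i u, \<phi> i v}" "d - c = r i * (v - u)" "\<phi> i ` {u<..<v} = {c<..<d}"
    "\<phi> i ` {u..v} = {c..d}" by (rule image_interval[OF i uvX])
  have "0 < r i * (v - u)" using ratio(1)[OF i] uv(2) by simp
  then have "c < d" using cd(2) by simp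
  show sub: "\<phi> i ` C \<subseteq> piece i"
    using gap_subset[OF C] by (intro image_mono) auto
  have "\<phi> i ` C \<inter> F = \<phi> i ` C \<inter> \<phi> i ` F" using sub F_Int_piece[OF i] by blast
  also have "\<dots> = \<phi> i ` (C \<inter> F)"
    using inj_on_image_Int[OF inj_map[OF i] gap_X[OF C] F_X] by simp
  also have "C \<inter> F = {}" using C by (rule gap_disjoint_set)
  finally have "\<phi> i ` C \<inter> F = {}" by simp
  moreover have "{\<phi> i u, \<phi> i v} \<subseteq> F" using map_F[OF i uv(3)] map_F[OF i uv(4)] by simp
  then have "{c, d} \<subseteq> F" unfolding cd(1) .
  ultimately show "\<phi> i ` C \<in> gaps F"
    using \<open>c < d\<close> unfolding uv(1) cd(3) by (intro gapI) auto
  show "measure lborel (\<phi> i ` C) = r i * measure lborel C"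
    using \<open>c < d\<close> cd(2) uv(6) unfolding uv(1) cd(3) by simp
qed

text \<open>A gap cannot cross the border of a piece. A common point has a preimage off F, this
  preimage lies in some gap, and the image of that gap is a gap meeting C; distinct gaps being
  disjoint, it is C.\<close>

lemma gap_preimage:
  assumes i: "i \<in> {1..N}" and C: "C \<in> gaps F" and meet: "C \<inter> piece i \<noteq> {}"
  obtains C' where "C' \<in> gaps F" "C = \<phi> i ` C'"
proof -
  obtain x where x: "x \<in> C" "x \<in> piece i" using meet by blast
  obtain y where y: "y \<in> {lo..hi}" "x = \<phi> i y" using x(2) by blast
  have "y \<notin> F" using x(1) y(2) map_F[OF i] gap_disjoint_set[OF C] by blast
  then obtain C' where C': "C' \<in> gaps F" "y \<in> C'" using in_gap[of y] y(1) by (metis atLeastAtMost_iff)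
  have "x \<in> \<phi> i ` C'" using C'(2) y(2) by blast
  then have "C = \<phi> i ` C'" using gaps_disjoint[OF C gap_image(1)[OF i C'(1)]] x(1) by blast
  then show thesis using that C'(1) by blast
qed

text \<open>The primary gaps singled out among the gaps of F, without connected components;
  \<open>primary_gaps_eq\<close> makes the connection.\<close>

definition prim :: "real set set" where
  "prim = {C \<in> gaps F. \<forall>i\<in>{1..N}. C \<inter> piece i = {}}"

lemma gaps_decomp: "gaps F = prim \<union> (\<Union>i\<in>{1..N}. (`) (\<phi> i) ` gaps F)"
proof
  show "gaps F \<subseteq> prim \<union> (\<Union>i\<in>{1..N}. (`) (\<phi> i) ` gaps F)"
  proof
    fix C assume C: "C \<in> gaps F"
    show "C \<in> prim \<union> (\<Union>i\<in>{1..N}. (`) (\<phi> i) ` gaps F)"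
    proof (cases "C \<in> prim")
      case False
      then obtain i where i: "i \<in> {1..N}" "C \<inter> piece i \<noteq> {}" using C unfolding prim_def by blast
      obtain D where "D \<in> gaps F" "C = \<phi> i ` D" by (rule gap_preimage[OF i(1) C i(2)])
      then show ?thesis using i(1) by blast
    qed simp
  qed
qed (use gap_image(1) in \<open>auto simp: prim_def\<close>)

lemma gap_image_nonempty: "C \<in> gaps F \<Longrightarrow> C \<noteq> {}"
  by (erule gapE) (simp add: dense)

lemma gap_images_disjoint:
  assumes "i \<in> {1..N}" "j \<in> {1..N}" "i \<noteq> j" "C \<in> gaps F" "D \<in> gaps F"
  shows "\<phi> i ` C \<noteq> \<phi> j ` D"
proof -
  have "\<phi> i ` C \<subseteq> \<phi> i ` {lo<..<hi}" "\<phi> j ` D \<subseteq> piece j"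
    using gap_subset[OF assms(4)] gap_image(3)[OF assms(2,5)] by blast+
  then show ?thesis using disjoint_pieces[OF assms(1-3)] gap_image_nonempty[OF assms(4)] by blast
qed

lemma gap_image_not_prim: "i \<in> {1..N} \<Longrightarrow> C \<in> gaps F \<Longrightarrow> \<phi> i ` C \<notin> prim"
  using gap_image(3)[of i C] gap_image_nonempty[of C] unfolding prim_def by blast

lemma inj_gap_image: "i \<in> {1..N} \<Longrightarrow> inj_on ((`) (\<phi> i)) (gaps F)"
  by (rule inj_on_subset[OF inj_on_image_Pow[OF inj_map]]) (use gap_X in auto)

text \<open>The renewal equation in its raw form: every long gap is either primary or the image,
  under exactly one map, of exactly one gap that is longer by the factor 1 / r_i. It is stated for
  an arbitrary function h of the length because it is used both for counting and for the
  moments.\<close>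

lemma sum_long_gaps:
  fixes h :: "real \<Rightarrow> real"
  assumes \<tau>: "0 < \<tau>"
  shows "(\<Sum>C\<in>long_gaps \<tau>. h (measure lborel C)) = (\<Sum>C\<in>prim \<inter> long_gaps \<tau>. h (measure lborel C)) +
    (\<Sum>i\<in>{1..N}. \<Sum>C\<in>long_gaps (\<tau> / r i). h (r i * measure lborel C))"
proof -
  have fin: "finite (long_gaps (\<tau> / r i))" if "i \<in> {1..N}" for i
    using \<tau> ratio(1)[OF that] by (intro finite_long_gaps) simp
  have lt: "\<tau> < r i * l \<longleftrightarrow> \<tau> / r i < l" if "i \<in> {1..N}" for i l
    using ratio(1)[OF that] by (simp add: pos_divide_less_eq mult.commute)
  have "long_gaps \<tau> = (prim \<inter> long_gaps \<tau>) \<union> (\<Union>i\<in>{1..N}. (`) (\<phi> i) ` long_gaps (\<tau> / r i))"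
  proof (intro equalityI subsetI)
    fix C assume C: "C \<in> long_gaps \<tau>"
    then consider "C \<in> prim" | i D where "i \<in> {1..N}" "D \<in> gaps F" "C = \<phi> i ` D"
      using gaps_decomp unfolding long_gaps_def by blast
    then show "C \<in> (prim \<inter> long_gaps \<tau>) \<union> (\<Union>i\<in>{1..N}. (`) (\<phi> i) ` long_gaps (\<tau> / r i))"
    proof cases
      case 2
      then have "D \<in> long_gaps (\<tau> / r i)" using C gap_image(2)[of i D] lt by (simp add: long_gaps_def)
      then show ?thesis using 2 by blast
    qed (use C in blast)
  next
    fix C assume "C \<in> (prim \<inter> long_gaps \<tau>) \<union> (\<Union>i\<in>{1..N}. (`) (\<phi> i) ` long_gaps (\<tau> / r i))"
    then consider "C \<in> long_gaps \<tau>" | i D where "i \<in> {1..N}" "D \<in> long_gaps (\<tau> / r i)" "C = \<phi> i ` D"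
      by blast
    then show "C \<in> long_gaps \<tau>"
    proof cases
      case 2
      then show ?thesis using gap_image(1,2)[of i D] lt by (simp add: long_gaps_def)
    qed
  qed
  then have "(\<Sum>C\<in>long_gaps \<tau>. h (measure lborel C)) =
      (\<Sum>C\<in>(prim \<inter> long_gaps \<tau>) \<union> (\<Union>i\<in>{1..N}. (`) (\<phi> i) ` long_gaps (\<tau> / r i)). h (measure lborel C))"
    by (rule arg_cong)
  also have "\<dots> = (\<Sum>C\<in>prim \<inter> long_gaps \<tau>. h (measure lborel C)) +
      (\<Sum>C\<in>(\<Union>i\<in>{1..N}. (`) (\<phi> i) ` long_gaps (\<tau> / r i)). h (measure lborel C))"
  proof (rule sum.union_disjoint)
    show "finite (prim \<inter> long_gaps \<tau>)" using finite_long_gaps[OF \<tau>] by simp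
    show "finite (\<Union>i\<in>{1..N}. (`) (\<phi> i) ` long_gaps (\<tau> / r i))" using fin by simp
    show "(prim \<inter> long_gaps \<tau>) \<inter> (\<Union>i\<in>{1..N}. (`) (\<phi> i) ` long_gaps (\<tau> / r i)) = {}"
      using gap_image_not_prim unfolding long_gaps_def by blast
  qed
  also have "(\<Sum>C\<in>(\<Union>i\<in>{1..N}. (`) (\<phi> i) ` long_gaps (\<tau> / r i)). h (measure lborel C)) =
      (\<Sum>i\<in>{1..N}. \<Sum>C\<in>(`) (\<phi> i) ` long_gaps (\<tau> / r i). h (measure lborel C))"
  proof (rule sum.UNION_disjoint)
    show "\<forall>i\<in>{1..N}. \<forall>j\<in>{1..N}. i \<noteq> j \<longrightarrow>
        (`) (\<phi> i) ` long_gaps (\<tau> / r i) \<inter> (`) (\<phi> j) ` long_gaps (\<tau> / r j) = {}"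
      using gap_images_disjoint unfolding long_gaps_def by blast
  qed (use fin in auto)
  also have "\<dots> = (\<Sum>i\<in>{1..N}. \<Sum>C\<in>long_gaps (\<tau> / r i). h (r i * measure lborel C))"
  proof (rule sum.cong[OF refl])
    fix i assume i: "i \<in> {1..N}"
    have inj: "inj_on ((`) (\<phi> i)) (long_gaps (\<tau> / r i))"
      using inj_gap_image[OF i] by (rule inj_on_subset) (auto simp: long_gaps_def)
    show "(\<Sum>C\<in>(`) (\<phi> i) ` long_gaps (\<tau> / r i). h (measure lborel C)) =
        (\<Sum>C\<in>long_gaps (\<tau> / r i). h (r i * measure lborel C))"
      unfolding sum.reindex[OF inj] o_def
      by (rule sum.cong[OF refl]) (use gap_image(2)[OF i] in \<open>simp add: long_gaps_def\<close>)
  qed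
  finally show ?thesis .
qed

text \<open>The order behind the induction is decreasing length: a non-primary gap is the image of a
  strictly longer one, and only finitely many gaps are at least as long as a given one. A
  counterexample of maximal length is therefore primary or yields a longer counterexample.\<close>

lemma gap_induct [consumes 1, case_names prim image]:
  assumes C: "C \<in> gaps F" and prim: "\<And>C. C \<in> prim \<Longrightarrow> P C"
    and image: "\<And>i C. i \<in> {1..N} \<Longrightarrow> C \<in> gaps F \<Longrightarrow> P C \<Longrightarrow> P (\<phi> i ` C)"
  shows "P C"
proof (rule ccontr)
  assume nP: "\<not> P C"
  let ?B = "{D \<in> gaps F. measure lborel C \<le> measure lborel D \<and> \<not> P D}"
  have "?B \<subseteq> long_gaps (measure lborel C / 2)"
    using gap_length_pos[OF C] by (auto simp: long_gaps_def)
  then have fin: "finite ?B" using gap_length_pos[OF C] by (meson finite_long_gaps finite_subset half_gt_zero)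
  have "C \<in> ?B" using C nP by simp
  obtain D where D: "D \<in> ?B" "\<And>E. E \<in> ?B \<Longrightarrow> measure lborel E \<le> measure lborel D"
  proof -
    have "Max (measure lborel ` ?B) \<in> measure lborel ` ?B" using fin \<open>C \<in> ?B\<close> by (intro Max_in) auto
    then obtain D where D: "Max (measure lborel ` ?B) = measure lborel D" "D \<in> ?B" by (rule imageE)
    have "measure lborel E \<le> measure lborel D" if "E \<in> ?B" for E
      unfolding D(1)[symmetric] using fin that by (intro Max_ge) auto
    then show thesis using that D(2) by blast
  qed
  have "D \<notin> prim" using D(1) prim by blast
  then obtain i E where E: "i \<in> {1..N}" "E \<in> gaps F" "D = \<phi> i ` E"
    using equalityD1[OF gaps_decomp, THEN subsetD, of D] D(1) by blast
  have "\<not> P E" using image[OF E(1,2)] E(3) D(1) by blast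
  have "measure lborel D < measure lborel E"
    using gap_image(2)[OF E(1,2)] ratio(2)[OF E(1)] gap_length_pos[OF E(2)] unfolding E(3) by simp
  moreover have "E \<in> ?B" using E(2) \<open>\<not> P E\<close> calculation D(1) by simp
  ultimately show False using D(2) by force
qed

text \<open>Without primary gaps the induction would leave no gaps at all, so F would be the whole
  hull, which has positive length.\<close>

lemma prim_nonempty: "prim \<noteq> {}"
proof
  assume e: "prim = {}"
  have "gaps F = {}"
  proof (rule ccontr)
    assume "gaps F \<noteq> {}"
    then obtain C where "C \<in> gaps F" by blast
    then show False by (induction rule: gap_induct) (use e in auto)
  qed
  then have "{lo..hi} \<subseteq> F" using in_gap by (metis atLeastAtMost_iff empty_iff subsetI)
  then have "emeasure lborel {lo..hi} \<le> emeasure lborel F"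
    using closed_F by (intro emeasure_mono) (auto intro: borel_closed)
  then show False using null_F lo_less_hi by simp
qed

lemma prim_gap: "C \<in> prim \<Longrightarrow> C \<in> gaps F"
  by (simp add: prim_def)

text \<open>The left end of a primary gap lies in F, hence in a piece that the gap itself avoids, so
  it is the right end of that piece. Gaps are determined by their left ends, and there are N
  pieces.\<close>

lemma finite_prim: "finite prim"
proof (rule inj_on_finite[of Inf])
  show "inj_on Inf prim"
  proof (rule inj_onI)
    fix C D assume CD: "C \<in> prim" "D \<in> prim" "Inf C = Inf D"
    from prim_gap[OF CD(1)] obtain u v where C: "C = {u<..<v}" "u < v" "Inf C = u" by (rule gapE)
    from prim_gap[OF CD(2)] obtain u' v' where D: "D = {u'<..<v'}" "u' < v'" "Inf D = u'" by (rule gapE)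
    have "u' = u" using CD(3) C(3) D(3) by simp
    then have "(u + min v v') / 2 \<in> C \<inter> D" using C D by (auto simp: min_def)
    then show "C = D" using gaps_disjoint[OF prim_gap[OF CD(1)] prim_gap[OF CD(2)]] by blast
  qed
  show "Inf ` prim \<subseteq> (\<lambda>i. Sup (piece i)) ` {1..N}"
  proof
    fix x assume "x \<in> Inf ` prim"
    then obtain C where C: "C \<in> prim" "x = Inf C" by blast
    from prim_gap[OF C(1)] obtain u v where uv: "C = {u<..<v}" "u < v" "u \<in> F" "Inf C = u" by (rule gapE)
    obtain i where i: "i \<in> {1..N}" "u \<in> piece i" using uv(3) F_subset_pieces by blast
    obtain c d where cd: "piece i = {c..d}" using piece_interval[OF i(1)] by metis
    have "u = d"
    proof (rule ccontr)
      assume "u \<noteq> d"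
      then have "(u + min v d) / 2 \<in> C \<inter> piece i" using i(2) uv(1,2) unfolding cd by (auto simp: min_def)
      then show False using C(1) i(1) unfolding prim_def by blast
    qed
    then have "x = Sup (piece i)" using C(2) uv(4) i(2) unfolding cd by simp
    then show "x \<in> (\<lambda>i. Sup (piece i)) ` {1..N}" using i(1) by blast
  qed
qed simp

section \<open>Primary gaps as components, and the total length of the pieces\<close>

lemma convex_hull_F: "convex hull F = {lo..hi}"
proof
  show "convex hull F \<subseteq> {lo..hi}" using F_subset by (intro hull_minimal) auto
  have "closed_segment lo hi \<subseteq> convex hull F"
    using lo_in hi_in by (intro closed_segment_subset convex_convex_hull hull_inc)
  then show "{lo..hi} \<subseteq> convex hull F" using lo_le_hi by (simp add: closed_segment_eq_real_ivl)
qed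

text \<open>The endpoints of a primary gap lie in F and therefore in pieces, so no larger connected
  set avoids the pieces. Conversely a point of the hull outside all pieces lies in a gap, and
  \<open>gap_preimage\<close> shows that this gap meets no piece.\<close>

lemma primary_gaps_eq: "primary_gaps N \<phi> F = prim"
proof -
  let ?U = "{lo..hi} - (\<Union>i\<in>{1..N}. piece i)"
  have sub: "C \<subseteq> ?U" if "C \<in> prim" for C
    using that gap_subset[of C] unfolding prim_def by auto
  have prim_comp: "C \<in> components ?U" if C: "C \<in> prim" for C
  proof -
    from prim_gap[OF C] obtain u v where uv: "C = {u<..<v}" "u < v" "u \<in> F" "v \<in> F" by (rule gapE)
    have nu: "u \<notin> ?U" "v \<notin> ?U" using uv F_subset_pieces by blast+
    have "D = C" if D: "D \<subseteq> ?U" "C \<subseteq> D" "connected D" for D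
    proof -
      have "x \<in> C" if x: "x \<in> D" for x
      proof (rule ccontr)
        assume nx: "x \<notin> C"
        let ?m = "(u + v) / 2"
        have m: "?m \<in> D" "u < ?m" "?m < v" using D(2) uv(1,2) by auto
        have iv: "{min x ?m..max x ?m} \<subseteq> D"
          using D(3) m(1) x by (metis connected_contains_Icc max_def min_def)
        have "u \<in> {min x ?m..max x ?m} \<or> v \<in> {min x ?m..max x ?m}"
          using nx m(2,3) uv(1) by (auto simp: min_def max_def)
        then show False using iv D(1) nu by blast
      qed
      then show ?thesis using D(2) by blast
    qed
    moreover have "connected C" "C \<noteq> {}" using uv gap_image_nonempty[OF prim_gap[OF C]] by auto
    ultimately show ?thesis using sub[OF C] unfolding in_components_maximal by metis
  qed
  have "C \<in> prim" if C: "C \<in> components ?U" for C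
  proof -
    obtain x where x: "x \<in> C" using in_components_nonempty[OF C] by blast
    then have xU: "x \<in> ?U" using in_components_subset[OF C] by blast
    then have "x \<notin> F" using F_subset_pieces by blast
    then obtain D where D: "D \<in> gaps F" "x \<in> D" using in_gap[of x] xU by (metis DiffD1 atLeastAtMost_iff)
    have "D \<inter> piece i = {}" if i: "i \<in> {1..N}" for i
    proof (rule ccontr)
      assume "D \<inter> piece i \<noteq> {}"
      then obtain E where "E \<in> gaps F" "D = \<phi> i ` E" using gap_preimage[OF i D(1)] by metis
      then have "D \<subseteq> piece i" using gap_image(3)[OF i] by blast
      then show False using D(2) xU i by blast
    qed
    then have "D \<in> prim" using D(1) unfolding prim_def by blast
    moreover have "C = D"
      using components_nonoverlap[OF C prim_comp[OF \<open>D \<in> prim\<close>]] x D(2) by blast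
    ultimately show ?thesis by simp
  qed
  then have "components ?U = prim" using prim_comp by blast
  then show ?thesis unfolding primary_gaps_def convex_hull_F by simp
qed

text \<open>The open pieces and one primary gap are disjoint inside the hull. The positive length of
  that gap makes the inequality strict, which is what later keeps \<delta> below 1.\<close>

lemma sum_ratios_less_1: "(\<Sum>i\<in>{1..N}. r i) < 1"
proof -
  let ?I = "\<lambda>i. \<phi> i ` {lo<..<hi}"
  have I: "\<exists>c d. c \<le> d \<and> ?I i = {c<..<d} \<and> measure lborel (?I i) = r i * (hi - lo)" if i: "i \<in> {1..N}" for i
  proof -
    obtain c d where cd: "d - c = r i * (hi - lo)" "?I i = {c<..<d}"
      using piece_interval[OF i] by metis
    have "0 \<le> r i * (hi - lo)" using ratio(1)[OF i] lo_le_hi by simp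
    then show ?thesis using cd by (intro exI[of _ c] exI[of _ d]) simp
  qed
  obtain L where L: "L \<in> prim" using prim_nonempty by blast
  have Lg: "L \<in> gaps F" using prim_gap[OF L] .
  have Lm: "L \<in> sets lborel" "emeasure lborel L \<noteq> \<infinity>" using Lg by (auto elim!: gapE)
  have Im: "?I i \<in> sets lborel" "emeasure lborel (?I i) \<noteq> \<infinity>" if "i \<in> {1..N}" for i
    using I[OF that] by auto
  have disj: "?I i \<inter> ?I j = {}" if "i \<in> {1..N}" "j \<in> {1..N}" "i \<noteq> j" for i j
  proof -
    have "?I j \<subseteq> piece j" by (intro image_mono) auto
    then show ?thesis using disjoint_pieces[OF that] by blast
  qed
  have "(\<Sum>i\<in>{1..N}. r i) * (hi - lo) = (\<Sum>i\<in>{1..N}. measure lborel (?I i))"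
    unfolding sum_distrib_right by (rule sum.cong[OF refl]) (use I in metis)
  also have "\<dots> = measure lborel (\<Union>i\<in>{1..N}. ?I i)"
  proof (rule measure_finite_Union[symmetric])
    show "disjoint_family_on ?I {1..N}" unfolding disjoint_family_on_def using disj by simp
    show "?I ` {1..N} \<subseteq> sets lborel" using Im(1) by blast
  qed (use Im(2) in simp_all)
  finally have 1: "measure lborel (\<Union>i\<in>{1..N}. ?I i) = (\<Sum>i\<in>{1..N}. r i) * (hi - lo)" by simp
  have UL: "(\<Union>i\<in>{1..N}. ?I i) \<inter> L = {}"
  proof -
    have "?I i \<inter> L = {}" if "i \<in> {1..N}" for i
    proof -
      have "?I i \<subseteq> piece i" by (intro image_mono) auto
      moreover have "L \<inter> piece i = {}" using L that by (simp add: prim_def)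
      ultimately show ?thesis by blast
    qed
    then show ?thesis by blast
  qed
  have UJ: "(\<Union>i\<in>{1..N}. ?I i) \<union> L \<subseteq> {lo..hi}"
  proof -
    have "?I i \<subseteq> {lo..hi}" if "i \<in> {1..N}" for i
    proof -
      have "?I i \<subseteq> piece i" by (intro image_mono) auto
      then show ?thesis using piece_subset[OF that] by (rule subset_trans)
    qed
    moreover have "{lo<..<hi} \<subseteq> {lo..hi}" by auto
    then have "L \<subseteq> {lo..hi}" using gap_subset[OF Lg] by (rule subset_trans[rotated])
    ultimately show ?thesis by (intro Un_least UN_least)
  qed
  have Um: "(\<Union>i\<in>{1..N}. ?I i) \<in> sets lborel" 
  proof (rule sets.finite_UN)
    fix i assume "i \<in> {1..N}"
    then show "?I i \<in> sets lborel" by (rule Im(1))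
  qed simp
  have hull_fm: "{lo..hi} \<in> fmeasurable lborel" using lo_le_hi by (simp add: fmeasurable_def)
  have fin: "A \<in> fmeasurable lborel" if "A \<in> sets lborel" "A \<subseteq> {lo..hi}" for A
    using hull_fm that(2,1) by (rule fmeasurableI2)
  have Uf: "(\<Union>i\<in>{1..N}. ?I i) \<in> fmeasurable lborel" "L \<in> fmeasurable lborel"
    using fin[OF Um] fin[OF Lm(1)] UJ unfolding Un_subset_iff by blast+
  have "measure lborel (\<Union>i\<in>{1..N}. ?I i) + measure lborel L = measure lborel ((\<Union>i\<in>{1..N}. ?I i) \<union> L)"
    by (rule measure_Union[symmetric])
      (use fmeasurableD2[OF Uf(1)] fmeasurableD2[OF Uf(2)] Um Lm(1) UL in \<open>simp_all only: infinity_ennreal_def not_False_eq_True\<close>)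
  also have "\<dots> \<le> measure lborel {lo..hi}"
    by (rule measure_mono_fmeasurable[OF UJ sets.Un[OF Um Lm(1)] hull_fm])
  finally have le: "(\<Sum>i\<in>{1..N}. r i) * (hi - lo) + measure lborel L \<le> hi - lo"
    using 1 lo_le_hi by simp
  have "(\<Sum>i\<in>{1..N}. r i) * (hi - lo) < (\<Sum>i\<in>{1..N}. r i) * (hi - lo) + measure lborel L"
    using gap_length_pos[OF Lg] by simp
  also note le
  finally have "(\<Sum>i\<in>{1..N}. r i) * (hi - lo) < 1 * (hi - lo)" by simp
  then show ?thesis using lo_less_hi by (simp add: mult_less_cancel_right)
qed

end

section \<open>The similarity dimension and the number of long gaps\<close>

lemma filterlim_neg_ln: "filterlim (\<lambda>T::real. - ln T) at_top (at_right 0)"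
  using ln_at_0 by (simp add: filterlim_uminus_at_top)

locale conformal_ifs = interval_ifs +
  fixes \<delta> :: real and \<nu> :: "real measure"
  assumes conformal: "conformal_measure X N \<phi> r F \<delta> \<nu>"
begin

section \<open>Consequences of conformality\<close>

lemma sets_\<nu> [simp]: "sets \<nu> = sets borel"
  and prob_\<nu>: "prob_space \<nu>"
  and \<nu>_compl_F: "emeasure \<nu> (- F) = 0"
  and \<nu>_overlap: "i \<in> {1..N} \<Longrightarrow> j \<in> {1..N} \<Longrightarrow> i \<noteq> j \<Longrightarrow> emeasure \<nu> (\<phi> i ` X \<inter> \<phi> j ` X) = 0"
  using conformal by (auto simp: conformal_measure_def)

lemma space_\<nu> [simp]: "space \<nu> = UNIV"
  using sets_eq_imp_space_eq[OF sets_\<nu>] by simp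

lemma emeasure_\<nu>_UNIV: "emeasure \<nu> UNIV = 1"
  using prob_space.emeasure_space_1[OF prob_\<nu>] by simp

lemma emeasure_\<nu>_image:
  assumes i: "i \<in> {1..N}" and B: "B \<in> sets borel" "B \<subseteq> X"
  shows "emeasure \<nu> (\<phi> i ` B) = ennreal (r i powr \<delta>) * emeasure \<nu> B"
proof -
  have "emeasure \<nu> (\<phi> i ` B) = (\<integral>\<^sup>+x\<in>B. ennreal (r i powr \<delta>) \<partial>\<nu>)"
    using conformal i B by (simp add: conformal_measure_def)
  also have "\<dots> = ennreal (r i powr \<delta>) * emeasure \<nu> B"
    using B by (intro nn_integral_cmult_indicator) simp
  finally show ?thesis .
qed

lemma F_borel: "F \<in> sets borel"
  using closed_F by (rule borel_closed)

lemma emeasure_\<nu>_superset: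
  assumes "F \<subseteq> B" "B \<in> sets borel"
  shows "emeasure \<nu> B = 1"
proof -
  have "emeasure \<nu> UNIV = emeasure \<nu> (UNIV - (- F))"
    using \<nu>_compl_F F_borel by (intro emeasure_Diff_null_set[symmetric]) (auto simp: null_sets_def)
  then have "emeasure \<nu> F = 1" using emeasure_\<nu>_UNIV by (simp add: Compl_eq_Diff_UNIV double_diff)
  moreover have "emeasure \<nu> F \<le> emeasure \<nu> B" using assms by (intro emeasure_mono) simp_all
  moreover have "emeasure \<nu> B \<le> emeasure \<nu> UNIV" by (intro emeasure_mono) simp_all
  ultimately show ?thesis using emeasure_\<nu>_UNIV by (intro antisym) simp_all
qed

lemma piece_borel: "i \<in> {1..N} \<Longrightarrow> piece i \<in> sets borel"
  using piece_interval[of i] by (metis atLeastAtMost_borel)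

lemma emeasure_\<nu>_piece: "i \<in> {1..N} \<Longrightarrow> emeasure \<nu> (piece i) = ennreal (r i powr \<delta>)"
  using emeasure_\<nu>_image[of i "{lo..hi}"] hull_X emeasure_\<nu>_superset[OF F_subset] by simp

lemma image_X_borel: "i \<in> {1..N} \<Longrightarrow> \<phi> i ` X \<in> sets borel"
proof -
  assume i: "i \<in> {1..N}"
  obtain k s where "\<And>x. x \<in> X \<Longrightarrow> \<phi> i x = k + s * x" using affine[OF i] by blast
  then have "\<phi> i ` X = (\<lambda>x. k + s * x) ` X" by (intro image_cong) auto
  also have "compact \<dots>" using X(3) by (intro compact_continuous_image continuous_intros)
  finally show ?thesis by (intro borel_closed compact_imp_closed)
qed

text \<open>Piece i has mass r_i^\<delta>. The pieces overlap in null sets, so their masses sum to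
  at most 1; they cover F, so the sum is at least 1.\<close>

lemma moran: "(\<Sum>i\<in>{1..N}. r i powr \<delta>) = 1"
proof (rule antisym)
  have m: "measure \<nu> (piece i) = r i powr \<delta>" if "i \<in> {1..N}" for i
    using emeasure_\<nu>_piece[OF that] by (simp add: measure_def)
  have fin: "finite_measure \<nu>" using prob_\<nu> by (rule prob_space.axioms)
  have "\<bar>(\<integral>x. 1 \<partial>\<nu>) - (\<Sum>i\<in>{1..N}. 1 * measure \<nu> (piece i))\<bar> \<le>
      0 * measure \<nu> UNIV + 1 * (measure \<nu> UNIV - (\<Sum>i\<in>{1..N}. measure \<nu> (piece i)))"
  proof (rule integral_partition_bound[OF fin sets_\<nu>])
    fix i j assume ij: "i \<in> {1..N}" "j \<in> {1..N}" "i \<noteq> j"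
    have "piece i \<inter> piece j \<subseteq> \<phi> i ` X \<inter> \<phi> j ` X" using hull_X by blast
    moreover have "\<phi> i ` X \<inter> \<phi> j ` X \<in> sets \<nu>"
      using image_X_borel[OF ij(1)] image_X_borel[OF ij(2)] by simp
    ultimately show "emeasure \<nu> (piece i \<inter> piece j) = 0"
      using \<nu>_overlap[OF ij] by (metis emeasure_eq_0)
  qed (use piece_borel in auto)
  then show "(\<Sum>i\<in>{1..N}. r i powr \<delta>) \<le> 1"
    using m prob_space.prob_space[OF prob_\<nu>] by simp
  have "1 = emeasure \<nu> (\<Union>i\<in>{1..N}. piece i)"
    using piece_borel by (intro emeasure_\<nu>_superset[symmetric] F_subset_pieces sets.finite_UN) auto
  also have "\<dots> \<le> (\<Sum>i\<in>{1..N}. emeasure \<nu> (piece i))"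
    using piece_borel by (intro emeasure_subadditive_finite) auto
  also have "\<dots> = (\<Sum>i\<in>{1..N}. ennreal (r i powr \<delta>))"
    by (rule sum.cong[OF refl emeasure_\<nu>_piece])
  also have "\<dots> = ennreal (\<Sum>i\<in>{1..N}. r i powr \<delta>)"
    by (rule sum_ennreal) simp
  finally show "1 \<le> (\<Sum>i\<in>{1..N}. r i powr \<delta>)" by (simp add: sum_nonneg flip: ennreal_1)
qed

lemma \<delta>_pos: "0 < \<delta>"
proof (rule ccontr)
  assume "\<not> 0 < \<delta>"
  have "(\<Sum>i\<in>{1..N}. (1::real)) \<le> (\<Sum>i\<in>{1..N}. r i powr \<delta>)"
  proof (rule sum_mono)
    fix i assume i: "i \<in> {1..N}"
    have "1 powr \<delta> \<le> r i powr \<delta>"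
      using \<open>\<not> 0 < \<delta>\<close> ratio[OF i] by (intro powr_mono2') auto
    then show "1 \<le> r i powr \<delta>" by simp
  qed
  then show False using moran two_maps by simp
qed

text \<open>For \<delta> \<ge> 1 the sum in \<open>moran\<close> would be at most the sum of the
  ratios, which is below 1.\<close>

lemma \<delta>_less_1: "\<delta> < 1"
proof (rule ccontr)
  assume d: "\<not> \<delta> < 1"
  have "(\<Sum>i\<in>{1..N}. r i powr \<delta>) \<le> (\<Sum>i\<in>{1..N}. r i)"
  proof (rule sum_mono)
    fix i assume i: "i \<in> {1..N}"
    have "r i powr \<delta> \<le> r i powr 1" using d ratio[OF i] by (intro powr_mono') auto
    then show "r i powr \<delta> \<le> r i" using ratio[OF i] by simp
  qed
  then show False using moran sum_ratios_less_1 by simp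
qed

section \<open>Order of growth of the number of long gaps\<close>

definition gap_count :: "real \<Rightarrow> real" where
  "gap_count \<epsilon> = real (card (long_gaps (2 * \<epsilon>)))"

text \<open>The mean delay of the renewal equation: by \<open>moran\<close> the weights r_i^\<delta>
  form a probability vector, and the delays in the variable t = -ln \<epsilon> are -ln r_i.\<close>

definition mean_log :: real where
  "mean_log = (\<Sum>i\<in>{1..N}. r i powr \<delta> * - ln (r i))"

lemma log_ratio_bounds:
  obtains \<alpha> A where "0 < \<alpha>" "0 < A" "\<forall>i\<in>{1..N}. \<alpha> \<le> - ln (r i) \<and> - ln (r i) \<le> A"
proof -
  let ?L = "(\<lambda>i. - ln (r i)) ` {1..N}"
  have ne: "?L \<noteq> {}" "finite ?L" using two_maps by auto
  have pos: "0 < x" if "x \<in> ?L" for x using that ratio by auto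
  have "0 < Min ?L" "0 < Max ?L" using Min_in[OF ne(2,1)] Max_in[OF ne(2,1)] pos by blast+
  moreover have "\<forall>i\<in>{1..N}. Min ?L \<le> - ln (r i) \<and> - ln (r i) \<le> Max ?L"
    using ne by (intro ballI conjI Min_le Max_ge) auto
  ultimately show thesis by (rule that)
qed

lemma mean_log_pos: "0 < mean_log"
  unfolding mean_log_def
proof (rule sum_pos)
  fix i assume i: "i \<in> {1..N}"
  show "0 < r i powr \<delta> * - ln (r i)" using ratio[OF i] by (intro mult_pos_pos) auto
qed (use two_maps in auto)

lemma long_gaps_antimono: "\<sigma> \<le> \<tau> \<Longrightarrow> long_gaps \<tau> \<subseteq> long_gaps \<sigma>"
  by (auto simp: long_gaps_def)

lemma gap_count_antimono: "0 < \<epsilon> \<Longrightarrow> \<epsilon> \<le> \<epsilon>' \<Longrightarrow> gap_count \<epsilon>' \<le> gap_count \<epsilon>"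
  unfolding gap_count_def by (auto intro!: card_mono finite_long_gaps long_gaps_antimono)

lemma gap_count_rec:
  assumes "0 < \<epsilon>"
  shows "gap_count \<epsilon> = card (prim \<inter> long_gaps (2 * \<epsilon>)) + (\<Sum>i\<in>{1..N}. gap_count (\<epsilon> / r i))"
  using sum_long_gaps[of "2 * \<epsilon>" "\<lambda>_. 1"] assms unfolding gap_count_def by simp

text \<open>The change of variables \<epsilon> = exp(-t) with normalisation exp(-\<delta> t):
  passing from \<epsilon> to \<epsilon> / r_i becomes the shift t + ln r_i with weight r_i^\<delta>,
  the form required by \<open>renewal_upper\<close>.\<close>

lemma weighted_rescale:
  assumes i: "i \<in> {1..N}"
  shows "r i powr \<delta> * (exp (- \<delta> * (t + ln (r i))) * g (exp (- (t + ln (r i))))) = exp (- \<delta> * t) * g (exp (- t) / r i)"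
proof -
  have "exp (- \<delta> * (t + ln (r i))) = exp (- \<delta> * t) * exp (- \<delta> * ln (r i))"
    by (simp add: exp_add[symmetric] algebra_simps)
  moreover have "r i powr \<delta> * exp (- \<delta> * ln (r i)) = 1"
    using ratio(1)[OF i] by (simp add: powr_def exp_minus)
  moreover have "exp (- (t + ln (r i))) = exp (- t) / r i"
    using ratio(1)[OF i] by (simp add: exp_diff exp_minus exp_add field_simps)
  ultimately show ?thesis by simp
qed

text \<open>The recursion for the count has an additive term of at most D, the number of primary
  gaps. Adding D to the count absorbs it, so the shifted count satisfies a renewal inequality with E
  = 0 and its normalisation is bounded.\<close>

lemma gap_count_upper:
  obtains C where "0 < C" "\<And>\<epsilon>. 0 < \<epsilon> \<Longrightarrow> \<epsilon> \<le> 1 \<Longrightarrow> gap_count \<epsilon> \<le> C * \<epsilon> powr - \<delta>"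
proof -
  obtain \<alpha> A where A: "0 < \<alpha>" "0 < A" "\<forall>i\<in>{1..N}. \<alpha> \<le> - ln (r i) \<and> - ln (r i) \<le> A"
    by (rule log_ratio_bounds)
  define D where "D = real (card prim)"
  define j where "j = (\<lambda>t. exp (- \<delta> * t) * (gap_count (exp (- t)) + D))"
  \<comment> \<open>The bound on the initial window [0, A]: the count decreases in \<epsilon>, so
    its value at exp(-A) is the largest there. The added 1 only makes K positive.\<close>
  define K where "K = gap_count (exp (- A)) + D + 1"
  have nn: "0 \<le> gap_count \<epsilon>" "0 \<le> D" for \<epsilon> unfolding gap_count_def D_def by auto
  have bound: "j t \<le> 0 / mean_log * t + K" if t: "A - A \<le> t" for t
  proof (rule renewal_upper[OF _ _ moran A(1) bspec[OF A(3)] _ _ _ _ t])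
    show "mean_log = (\<Sum>i\<in>{1..N}. r i powr \<delta> * - ln (r i))" by (simp add: mean_log_def)
    show "mean_log \<noteq> 0" using mean_log_pos by simp
  next
    fix t assume "A \<le> t"
    have "real (card (prim \<inter> long_gaps (2 * exp (- t)))) \<le> D"
      unfolding D_def by (simp add: card_mono finite_prim)
    then have "gap_count (exp (- t)) + D \<le> (\<Sum>i\<in>{1..N}. gap_count (exp (- t) / r i)) + 2 * D"
      using gap_count_rec[of "exp (- t)"] by simp
    \<comment> \<open>At least two maps are present, so distributing D to each summand on the right
      pays for both copies of D.\<close>
    also have "2 * D \<le> real N * D" using two_maps nn(2) by (intro mult_right_mono) auto
    also have "(\<Sum>i\<in>{1..N}. gap_count (exp (- t) / r i)) + real N * D = (\<Sum>i\<in>{1..N}. gap_count (exp (- t) / r i) + D)"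
      by (simp add: sum.distrib)
    finally have "j t \<le> exp (- \<delta> * t) * (\<Sum>i\<in>{1..N}. gap_count (exp (- t) / r i) + D)"
      unfolding j_def by simp
    also have "\<dots> = (\<Sum>i\<in>{1..N}. r i powr \<delta> * j (t - - ln (r i)))"
      unfolding j_def sum_distrib_left diff_minus_eq_add
      by (rule sum.cong[OF refl], rule weighted_rescale[where g = "\<lambda>\<epsilon>. gap_count \<epsilon> + D", symmetric])
    finally show "j t \<le> (\<Sum>i\<in>{1..N}. r i powr \<delta> * j (t - - ln (r i))) + 0" by simp
  next
    fix t assume t: "A - A \<le> t" "t \<le> A"
    have "j t \<le> 1 * (gap_count (exp (- A)) + D)"
      unfolding j_def using t \<delta>_pos nn by (intro mult_mono add_right_mono gap_count_antimono) auto
    then show "j t \<le> 0 / mean_log * t + K" by (simp add: K_def)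
  qed simp_all
  have "gap_count \<epsilon> \<le> K * \<epsilon> powr - \<delta>" if \<epsilon>: "0 < \<epsilon>" "\<epsilon> \<le> 1" for \<epsilon>
  proof -
    have "0 \<le> - ln \<epsilon>" using \<epsilon> by simp
    then have "j (- ln \<epsilon>) \<le> K" using bound[of "- ln \<epsilon>"] by simp
    moreover have "j (- ln \<epsilon>) = \<epsilon> powr \<delta> * (gap_count \<epsilon> + D)"
      unfolding j_def using \<epsilon> by (simp add: powr_def)
    moreover have "\<epsilon> powr \<delta> * gap_count \<epsilon> \<le> \<epsilon> powr \<delta> * (gap_count \<epsilon> + D)"
      using nn by (intro mult_left_mono) auto
    ultimately show ?thesis using \<epsilon> by (simp add: powr_minus field_simps)
  qed
  moreover have "0 < K" using nn(1)[of "exp (- A)"] nn(2) by (simp add: K_def)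
  ultimately show thesis using that by blast
qed

text \<open>Dropping the primary term leaves a renewal inequality with E = 0 for the negated count.
  The window starts as soon as one fixed gap is long enough to be counted.\<close>

lemma gap_count_lower:
  obtains c \<epsilon>1 where "0 < c" "0 < \<epsilon>1" "\<And>\<epsilon>. 0 < \<epsilon> \<Longrightarrow> \<epsilon> \<le> \<epsilon>1 \<Longrightarrow> c * \<epsilon> powr - \<delta> \<le> gap_count \<epsilon>"
proof -
  obtain \<alpha> A where A: "0 < \<alpha>" "0 < A" "\<forall>i\<in>{1..N}. \<alpha> \<le> - ln (r i) \<and> - ln (r i) \<le> A"
    by (rule log_ratio_bounds)
  obtain L where L: "L \<in> gaps F" using prim_nonempty prim_gap by blast
  let ?l = "measure lborel L"
  have l: "0 < ?l" using gap_length_pos[OF L] .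
  \<comment> \<open>From t0 on, 2 * exp(-t) lies strictly below the length of L. On the window from
    t0 to t0 + A the count is thus at least 1, and c is the smallest value of the factor
    exp(-\<delta> t).\<close>
  define t0 where "t0 = - ln (?l / 2) + 1"
  define c where "c = exp (- \<delta> * (t0 + A))"
  define j where "j = (\<lambda>t. exp (- \<delta> * t) * - gap_count (exp (- t)))"
  have large: "1 \<le> gap_count (exp (- t))" if t: "t0 \<le> t" for t
  proof -
    have "exp (- t) < exp (ln (?l / 2))" using t unfolding t0_def by (subst exp_less_cancel_iff) simp
    then have "L \<in> long_gaps (2 * exp (- t))" using L l by (simp add: long_gaps_def)
    then have "card (long_gaps (2 * exp (- t))) \<noteq> 0" using finite_long_gaps[of "2 * exp (- t)"] by auto
    then show ?thesis unfolding gap_count_def by simp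
  qed
  have bound: "j t \<le> 0 / mean_log * t + - c" if t: "(t0 + A) - A \<le> t" for t
  proof (rule renewal_upper[OF _ _ moran A(1) bspec[OF A(3)] _ _ _ _ t])
    show "mean_log = (\<Sum>i\<in>{1..N}. r i powr \<delta> * - ln (r i))" by (simp add: mean_log_def)
    show "mean_log \<noteq> 0" using mean_log_pos by simp
  next
    fix t
    have "- gap_count (exp (- t)) \<le> (\<Sum>i\<in>{1..N}. - gap_count (exp (- t) / r i))"
      using gap_count_rec[of "exp (- t)"] by (simp add: sum_negf)
    then have "j t \<le> exp (- \<delta> * t) * (\<Sum>i\<in>{1..N}. - gap_count (exp (- t) / r i))"
      unfolding j_def by (intro mult_left_mono) auto
    also have "\<dots> = (\<Sum>i\<in>{1..N}. r i powr \<delta> * j (t - - ln (r i)))"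
      unfolding j_def sum_distrib_left diff_minus_eq_add
      by (rule sum.cong[OF refl], rule weighted_rescale[where g = "\<lambda>\<epsilon>. - gap_count \<epsilon>", symmetric])
    finally show "j t \<le> (\<Sum>i\<in>{1..N}. r i powr \<delta> * j (t - - ln (r i))) + 0" by simp
  next
    fix t assume t: "(t0 + A) - A \<le> t" "t \<le> t0 + A"
    have "c * 1 \<le> exp (- \<delta> * t) * gap_count (exp (- t))"
      unfolding c_def using t \<delta>_pos by (intro mult_mono large) auto
    then show "j t \<le> 0 / mean_log * t + - c" by (simp add: j_def)
  qed simp_all
  have "c * \<epsilon> powr - \<delta> \<le> gap_count \<epsilon>" if \<epsilon>: "0 < \<epsilon>" "\<epsilon> \<le> exp (- t0)" for \<epsilon>
  proof -
    have "ln \<epsilon> \<le> - t0" using \<epsilon> by (metis exp_gt_zero ln_exp ln_le_cancel_iff)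
    then have "c \<le> - j (- ln \<epsilon>)" using bound[of "- ln \<epsilon>"] by simp
    moreover have "- j (- ln \<epsilon>) = \<epsilon> powr \<delta> * gap_count \<epsilon>"
      unfolding j_def using \<epsilon> by (simp add: powr_def)
    ultimately show ?thesis using \<epsilon> by (simp add: powr_minus field_simps)
  qed
  then show thesis using that[of c "exp (- t0)"] by (simp add: c_def)
qed

text \<open>The integral of \<epsilon>^(\<delta> - 1) \<open>gap_count \<epsilon>\<close> over all
  \<epsilon> > T, evaluated gap by gap. Integrating up to infinity instead of 1 makes the recursion
  exact.\<close>

definition gap_moment :: "real \<Rightarrow> real" where
  "gap_moment T = (\<Sum>C\<in>long_gaps (2 * T). ((measure lborel C / 2) powr \<delta> - T powr \<delta>) / \<delta>)"

text \<open>The part of the same integral due to the primary gaps, now taken from 0.\<close>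

definition prim_moment :: real where
  "prim_moment = (\<Sum>C\<in>prim. (measure lborel C / 2) powr \<delta> / \<delta>)"

lemma gap_moment_antimono:
  assumes "0 < S" "S \<le> T" shows "gap_moment T \<le> gap_moment S"
proof -
  have "gap_moment T \<le> (\<Sum>C\<in>long_gaps (2 * T). ((measure lborel C / 2) powr \<delta> - S powr \<delta>) / \<delta>)"
    unfolding gap_moment_def using assms \<delta>_pos
    by (intro sum_mono divide_right_mono diff_left_mono powr_mono2) auto
  also have "\<dots> \<le> gap_moment S"
    unfolding gap_moment_def
  proof (rule sum_mono2)
    show "finite (long_gaps (2 * S))" using assms by (intro finite_long_gaps) simp
    show "long_gaps (2 * T) \<subseteq> long_gaps (2 * S)" using assms by (intro long_gaps_antimono) simp
    fix C assume "C \<in> long_gaps (2 * S) - long_gaps (2 * T)"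
    then have "S powr \<delta> \<le> (measure lborel C / 2) powr \<delta>"
      using assms \<delta>_pos by (intro powr_mono2) (auto simp: long_gaps_def)
    then show "0 \<le> ((measure lborel C / 2) powr \<delta> - S powr \<delta>) / \<delta>" using \<delta>_pos by simp
  qed
  finally show ?thesis .
qed

text \<open>Each summand is homogeneous of degree \<delta> in length and T jointly, so the images
  under map i contribute r_i^\<delta> times the moment at T / r_i.\<close>

lemma gap_moment_rec:
  assumes T: "0 < T"
  shows "gap_moment T = (\<Sum>C\<in>prim \<inter> long_gaps (2 * T). ((measure lborel C / 2) powr \<delta> - T powr \<delta>) / \<delta>) +
    (\<Sum>i\<in>{1..N}. r i powr \<delta> * gap_moment (T / r i))"
proof -
  have "(\<Sum>C\<in>long_gaps (2 * T / r i). ((r i * measure lborel C / 2) powr \<delta> - T powr \<delta>) / \<delta>) =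
      r i powr \<delta> * gap_moment (T / r i)" if i: "i \<in> {1..N}" for i
    unfolding gap_moment_def sum_distrib_left times_divide_eq_right
  proof (rule sum.cong[OF refl])
    fix C
    have "(r i * measure lborel C / 2) powr \<delta> = r i powr \<delta> * (measure lborel C / 2) powr \<delta>"
      using ratio(1)[OF i] powr_mult[of "r i" "measure lborel C / 2" \<delta>] by simp
    moreover have "T powr \<delta> = r i powr \<delta> * (T / r i) powr \<delta>"
      using ratio(1)[OF i] T powr_mult[of "r i" "T / r i" \<delta>] by simp
    ultimately show "((r i * measure lborel C / 2) powr \<delta> - T powr \<delta>) / \<delta> =
        r i powr \<delta> * ((measure lborel C / 2) powr \<delta> - (T / r i) powr \<delta>) / \<delta>"
      by (simp add: right_diff_distrib)
  qed
  then have "(\<Sum>i\<in>{1..N}. \<Sum>C\<in>long_gaps (2 * T / r i). ((r i * measure lborel C / 2) powr \<delta> - T powr \<delta>) / \<delta>) =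
      (\<Sum>i\<in>{1..N}. r i powr \<delta> * gap_moment (T / r i))"
    by (rule sum.cong[OF refl])
  then show ?thesis
    using sum_long_gaps[of "2 * T" "\<lambda>l. ((l / 2) powr \<delta> - T powr \<delta>) / \<delta>"] T
    unfolding gap_moment_def[of T] by simp
qed

lemma prim_moment_tendsto:
  "((\<lambda>T. \<Sum>C\<in>prim \<inter> long_gaps (2 * T). ((measure lborel C / 2) powr \<delta> - T powr \<delta>) / \<delta>) \<longlongrightarrow> prim_moment) (at_right 0)"
proof -
  have "((\<lambda>T. \<Sum>C\<in>prim. ((measure lborel C / 2) powr \<delta> - T powr \<delta>) / \<delta>) \<longlongrightarrow>
      (\<Sum>C\<in>prim. ((measure lborel C / 2) powr \<delta> - 0) / \<delta>)) (at_right 0)"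
    using \<delta>_pos by (intro tendsto_intros powr_at_right_0) auto
  moreover have "\<forall>\<^sub>F T in at_right 0. prim \<inter> long_gaps (2 * T) = prim"
  proof -
    have "\<forall>\<^sub>F T in at_right 0. \<forall>C\<in>prim. 2 * T < measure lborel C"
    proof (intro eventually_ball_finite finite_prim ballI)
      fix C assume "C \<in> prim"
      then have "0 < measure lborel C / 2" using gap_length_pos[OF prim_gap] by simp
      then show "\<forall>\<^sub>F T in at_right 0. 2 * T < measure lborel C"
        unfolding eventually_at_right_field by (intro exI[of _ "measure lborel C / 2"]) auto
    qed
    then show ?thesis by eventually_elim (auto simp: long_gaps_def prim_gap)
  qed
  then have "\<forall>\<^sub>F T in at_right 0. (\<Sum>C\<in>prim. ((measure lborel C / 2) powr \<delta> - T powr \<delta>) / \<delta>) =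
      (\<Sum>C\<in>prim \<inter> long_gaps (2 * T). ((measure lborel C / 2) powr \<delta> - T powr \<delta>) / \<delta>)"
    by eventually_elim simp
  ultimately show ?thesis unfolding prim_moment_def
    by (simp add: tendsto_cong)
qed

text \<open>In t = -ln T the moment is monotone and solves a renewal equation whose driving term
  tends to \<open>prim_moment\<close>. Replacing T by T / \<rho> shifts t by the constant ln \<rho>,
  which disappears on division by t.\<close>

lemma gap_moment_limit:
  assumes \<rho>: "0 < \<rho>"
  shows "((\<lambda>T. gap_moment (T / \<rho>) / \<bar>ln T\<bar>) \<longlongrightarrow> prim_moment / mean_log) (at_right 0)"
proof -
  obtain \<alpha> A where A: "0 < \<alpha>" "0 < A" "\<forall>i\<in>{1..N}. \<alpha> \<le> - ln (r i) \<and> - ln (r i) \<le> A"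
    by (rule log_ratio_bounds)
  define j where "j = (\<lambda>t. gap_moment (exp (- t)))"
  define e where "e = (\<lambda>t. \<Sum>C\<in>prim \<inter> long_gaps (2 * exp (- t)).
    ((measure lborel C / 2) powr \<delta> - exp (- t) powr \<delta>) / \<delta>)"
  have "((\<lambda>t. j t / t) \<longlongrightarrow> prim_moment / mean_log) at_top"
  proof (rule renewal_limit[OF _ _ moran A(1) bspec[OF A(3)]])
    show "mean_log = (\<Sum>i\<in>{1..N}. r i powr \<delta> * - ln (r i))" by (simp add: mean_log_def)
    show "0 < mean_log" by (rule mean_log_pos)
    show "mono j" unfolding j_def by (intro monoI gap_moment_antimono) auto
    have "filterlim (\<lambda>t::real. exp (- t)) (at_right 0) at_top"
    proof (rule filterlim_at_withinI)
      show "((\<lambda>t::real. exp (- t)) \<longlongrightarrow> 0) at_top"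
        using exp_at_bot filterlim_compose filterlim_uminus_at_bot_at_top by blast
    qed simp
    from filterlim_compose[OF prim_moment_tendsto this]
    show "(e \<longlongrightarrow> prim_moment) at_top" unfolding e_def .
  next
    fix t
    have "exp (- t) / r i = exp (- (t - - ln (r i)))" if "i \<in> {1..N}" for i
      using ratio(1)[OF that] by (simp add: exp_diff exp_minus exp_add field_simps)
    then have "(\<Sum>i\<in>{1..N}. r i powr \<delta> * gap_moment (exp (- t) / r i)) =
        (\<Sum>i\<in>{1..N}. r i powr \<delta> * j (t - - ln (r i)))"
      unfolding j_def by (intro sum.cong[OF refl]) (simp only:)
    then show "j t = (\<Sum>i\<in>{1..N}. r i powr \<delta> * j (t - - ln (r i))) + e t"
      using gap_moment_rec[of "exp (- t)"] by (simp add: e_def fun_cong[OF j_def, of t])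
  qed simp_all
  moreover have "filterlim (\<lambda>t. t + ln \<rho>) at_top at_top"
    by (subst add.commute) (rule filterlim_tendsto_add_at_top[OF tendsto_const filterlim_ident])
  ultimately have "((\<lambda>t. j (t + ln \<rho>) / (t + ln \<rho>)) \<longlongrightarrow> prim_moment / mean_log) at_top"
    by (rule filterlim_compose)
  moreover have "((\<lambda>t. (t + ln \<rho>) / t) \<longlongrightarrow> 1) at_top"
  proof -
    have "((\<lambda>t. 1 + ln \<rho> / t) \<longlongrightarrow> 1 + 0) at_top"
      by (intro tendsto_add tendsto_const real_tendsto_divide_at_top[OF tendsto_const] filterlim_ident)
    moreover have "\<forall>\<^sub>F t in at_top. 1 + ln \<rho> / t = (t + ln \<rho>) / t"
      using eventually_gt_at_top[of 0] by eventually_elim (simp add: field_simps)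
    ultimately show ?thesis by (simp add: tendsto_cong)
  qed
  ultimately have "((\<lambda>t. j (t + ln \<rho>) / (t + ln \<rho>) * ((t + ln \<rho>) / t)) \<longlongrightarrow> prim_moment / mean_log * 1) at_top"
    by (rule tendsto_mult)
  moreover have "\<forall>\<^sub>F t in at_top. j (t + ln \<rho>) / (t + ln \<rho>) * ((t + ln \<rho>) / t) = j (t + ln \<rho>) / t"
    using eventually_gt_at_top[of "- ln \<rho>"] by eventually_elim simp
  ultimately have "((\<lambda>t. j (t + ln \<rho>) / t) \<longlongrightarrow> prim_moment / mean_log * 1) at_top"
    by (rule Lim_transform_eventually)
  then have "((\<lambda>t. j (t + ln \<rho>) / t) \<longlongrightarrow> prim_moment / mean_log) at_top" by (simp only: mult_1_right)
  from filterlim_compose[OF this filterlim_neg_ln]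
  have "((\<lambda>T. j (- ln T + ln \<rho>) / - ln T) \<longlongrightarrow> prim_moment / mean_log) (at_right 0)" .
  moreover have "\<forall>\<^sub>F T in at_right 0. j (- ln T + ln \<rho>) / - ln T = gap_moment (T / \<rho>) / \<bar>ln T\<bar>"
  proof -
    have "\<forall>\<^sub>F T::real in at_right 0. 0 < T \<and> T < 1"
      by (auto simp: eventually_at_right_field intro: exI[of _ 1])
    then show ?thesis
    proof eventually_elim
      case (elim T)
      have "exp (- (- ln T + ln \<rho>)) = T / \<rho>" using elim \<rho> by (simp add: exp_diff)
      moreover have "\<bar>ln T\<bar> = - ln T" using elim by (simp add: abs_if)
      ultimately show ?case by (simp add: j_def)
    qed
  qed
  ultimately show ?thesis by (rule Lim_transform_eventually)
qed

text \<open>Formally the substitution \<epsilon> = \<rho> * s; it is carried out for each gap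
  separately. A gap contributes for \<epsilon> up to \<rho> l / 2 or up to 1, whichever is smaller,
  and the truncation at 1 is accounted for by the subtracted moment at 1 / \<rho>.\<close>

lemma gap_count_integral:
  assumes T: "0 < T" "T \<le> 1" and \<rho>: "0 < \<rho>"
  shows "(\<integral>\<^sup>+\<epsilon>\<in>{T..1}. ennreal (\<epsilon> powr (\<delta> - 1)) * ennreal (gap_count (\<epsilon> / \<rho>)) \<partial>lborel) =
    ennreal (\<rho> powr \<delta> * (gap_moment (T / \<rho>) - gap_moment (1 / \<rho>)))"
proof -
  let ?G = "long_gaps (2 * (T / \<rho>))"
  let ?l = "\<lambda>C. \<rho> * measure lborel C / 2"
  have fin: "finite ?G" using T \<rho> by (intro finite_long_gaps) simp
  have lT: "T < ?l C" if "C \<in> ?G" for C using that \<rho> by (simp add: long_gaps_def field_simps)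
  have count: "gap_count (\<epsilon> / \<rho>) = (\<Sum>C\<in>?G. indicator {..<?l C} \<epsilon>)" if "T \<le> \<epsilon>" for \<epsilon>
  proof -
    have "long_gaps (2 * (\<epsilon> / \<rho>)) = {C \<in> ?G. \<epsilon> < ?l C}"
    proof -
      have "2 * (T / \<rho>) \<le> 2 * (\<epsilon> / \<rho>)" using that \<rho> by (simp add: divide_right_mono)
      then have "long_gaps (2 * (\<epsilon> / \<rho>)) \<subseteq> ?G" by (rule long_gaps_antimono)
      moreover have "2 * (\<epsilon> / \<rho>) < measure lborel C \<longleftrightarrow> \<epsilon> < ?l C" for C
        using \<rho> by (simp add: field_simps)
      ultimately show ?thesis unfolding long_gaps_def by blast
    qed
    then have "gap_count (\<epsilon> / \<rho>) = real (card {C \<in> ?G. \<epsilon> < ?l C})" by (simp add: gap_count_def)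
    also have "\<dots> = (\<Sum>C\<in>?G. if \<epsilon> < ?l C then 1 else 0)"
      using fin by (simp add: sum.If_cases Int_def)
    finally show ?thesis by (simp add: indicator_def of_bool_def)
  qed
  have part: "(\<integral>\<^sup>+\<epsilon>. ennreal (\<epsilon> powr (\<delta> - 1) * indicator {..<?l C} \<epsilon>) * indicator {T..1} \<epsilon> \<partial>lborel) =
      ennreal ((min 1 (?l C) powr \<delta> - T powr \<delta>) / \<delta>)" if C: "C \<in> ?G" for C
  proof -
    have "(\<integral>\<^sup>+\<epsilon>. ennreal (\<epsilon> powr (\<delta> - 1) * indicator {..<?l C} \<epsilon>) * indicator {T..1} \<epsilon> \<partial>lborel) =
        (\<integral>\<^sup>+\<epsilon>\<in>{T..min 1 (?l C)}. ennreal (\<epsilon> powr (\<delta> - 1)) \<partial>lborel)"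
    proof (rule nn_integral_cong_AE, rule AE_mp[OF AE_lborel_singleton[of "?l C"] AE_I2], rule impI)
      fix \<epsilon> assume "\<epsilon> \<noteq> ?l C"
      then show "ennreal (\<epsilon> powr (\<delta> - 1) * indicator {..<?l C} \<epsilon>) * indicator {T..1} \<epsilon> =
          ennreal (\<epsilon> powr (\<delta> - 1)) * indicator {T..min 1 (?l C)} \<epsilon>"
        by (auto split: split_indicator)
    qed
    also have "\<dots> = ennreal ((min 1 (?l C) powr \<delta> - T powr \<delta>) / \<delta>)"
      using nn_integral_powr_Icc[of "\<delta> - 1" T "min 1 (?l C)"] T lT[OF C] \<delta>_pos by simp
    finally show ?thesis .
  qed
  have "(\<integral>\<^sup>+\<epsilon>\<in>{T..1}. ennreal (\<epsilon> powr (\<delta> - 1)) * ennreal (gap_count (\<epsilon> / \<rho>)) \<partial>lborel) =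
      (\<integral>\<^sup>+\<epsilon>. (\<Sum>C\<in>?G. ennreal (\<epsilon> powr (\<delta> - 1) * indicator {..<?l C} \<epsilon>) * indicator {T..1} \<epsilon>) \<partial>lborel)"
  proof (rule nn_integral_cong)
    fix \<epsilon>
    show "ennreal (\<epsilon> powr (\<delta> - 1)) * ennreal (gap_count (\<epsilon> / \<rho>)) * indicator {T..1} \<epsilon> =
        (\<Sum>C\<in>?G. ennreal (\<epsilon> powr (\<delta> - 1) * indicator {..<?l C} \<epsilon>) * indicator {T..1} \<epsilon>)"
    proof (cases "T \<le> \<epsilon>")
      case True
      have "ennreal (\<epsilon> powr (\<delta> - 1)) * ennreal (gap_count (\<epsilon> / \<rho>)) =
          ennreal (\<Sum>C\<in>?G. \<epsilon> powr (\<delta> - 1) * indicator {..<?l C} \<epsilon>)"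
        unfolding count[OF True] by (simp add: ennreal_mult'[symmetric] sum_distrib_left)
      also have "\<dots> = (\<Sum>C\<in>?G. ennreal (\<epsilon> powr (\<delta> - 1) * indicator {..<?l C} \<epsilon>))"
        by (rule sum_ennreal[symmetric]) simp
      finally show ?thesis by (simp only: sum_distrib_right)
    qed simp
  qed
  also have "\<dots> = (\<Sum>C\<in>?G. ennreal ((min 1 (?l C) powr \<delta> - T powr \<delta>) / \<delta>))"
    by (subst nn_integral_sum) (simp_all add: part)
  also have "\<dots> = ennreal (\<Sum>C\<in>?G. (min 1 (?l C) powr \<delta> - T powr \<delta>) / \<delta>)"
  proof (rule sum_ennreal)
    fix C assume "C \<in> ?G"
    then have "T powr \<delta> \<le> min 1 (?l C) powr \<delta>" using lT[of C] T \<delta>_pos by (intro powr_mono2) auto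
    then show "0 \<le> (min 1 (?l C) powr \<delta> - T powr \<delta>) / \<delta>" using \<delta>_pos by simp
  qed
  also have "(\<Sum>C\<in>?G. (min 1 (?l C) powr \<delta> - T powr \<delta>) / \<delta>) = \<rho> powr \<delta> * (gap_moment (T / \<rho>) - gap_moment (1 / \<rho>))"
  proof -
    let ?H = "long_gaps (2 * (1 / \<rho>))"
    have sub: "?H \<subseteq> ?G" using T \<rho> by (intro long_gaps_antimono) (simp add: divide_right_mono)
    have "gap_moment (1 / \<rho>) = (\<Sum>C\<in>?G. if C \<in> ?H then ((measure lborel C / 2) powr \<delta> - (1 / \<rho>) powr \<delta>) / \<delta> else 0)"
      unfolding gap_moment_def using fin sub by (simp add: sum.If_cases Int_absorb1)
    then have "\<rho> powr \<delta> * (gap_moment (T / \<rho>) - gap_moment (1 / \<rho>)) =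
        (\<Sum>C\<in>?G. \<rho> powr \<delta> * (((measure lborel C / 2) powr \<delta> - (T / \<rho>) powr \<delta>) / \<delta> -
          (if C \<in> ?H then ((measure lborel C / 2) powr \<delta> - (1 / \<rho>) powr \<delta>) / \<delta> else 0)))"
      unfolding gap_moment_def[of "T / \<rho>"] by (simp only: sum_distrib_left sum_subtractf[symmetric])
    also have "\<dots> = (\<Sum>C\<in>?G. (min 1 (?l C) powr \<delta> - T powr \<delta>) / \<delta>)"
    proof (rule sum.cong[OF refl])
      fix C assume C: "C \<in> ?G"
      have H: "C \<in> ?H \<longleftrightarrow> 1 < ?l C" using C \<rho> by (simp add: long_gaps_def field_simps)
      have pw: "\<rho> powr \<delta> * (measure lborel C / 2) powr \<delta> = ?l C powr \<delta>"
        "\<rho> powr \<delta> * (T / \<rho>) powr \<delta> = T powr \<delta>" "\<rho> powr \<delta> * (1 / \<rho>) powr \<delta> = 1"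
        using \<rho> T powr_mult[of \<rho> "measure lborel C / 2" \<delta>] powr_mult[of \<rho> "T / \<rho>" \<delta>] powr_mult[of \<rho> "1 / \<rho>" \<delta>]
        by simp_all
      show "\<rho> powr \<delta> * (((measure lborel C / 2) powr \<delta> - (T / \<rho>) powr \<delta>) / \<delta> -
          (if C \<in> ?H then ((measure lborel C / 2) powr \<delta> - (1 / \<rho>) powr \<delta>) / \<delta> else 0)) =
          (min 1 (?l C) powr \<delta> - T powr \<delta>) / \<delta>"
      proof (cases "1 < ?l C")
        case True
        have "\<rho> powr \<delta> * (((measure lborel C / 2) powr \<delta> - (T / \<rho>) powr \<delta>) / \<delta> -
            ((measure lborel C / 2) powr \<delta> - (1 / \<rho>) powr \<delta>) / \<delta>) =
            (\<rho> powr \<delta> * (1 / \<rho>) powr \<delta> - \<rho> powr \<delta> * (T / \<rho>) powr \<delta>) / \<delta>"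
          by (simp add: diff_divide_distrib right_diff_distrib)
        then show ?thesis using True H pw by simp
      next
        case False
        have "\<rho> powr \<delta> * (((measure lborel C / 2) powr \<delta> - (T / \<rho>) powr \<delta>) / \<delta>) =
            (\<rho> powr \<delta> * (measure lborel C / 2) powr \<delta> - \<rho> powr \<delta> * (T / \<rho>) powr \<delta>) / \<delta>"
          by (simp add: diff_divide_distrib right_diff_distrib)
        then show ?thesis using False H pw by simp
      qed
    qed
    finally show ?thesis by simp
  qed
  finally show ?thesis .
qed

end

section \<open>Cylinder sets\<close>

lemma nn_integral_powr_from_0:
  fixes a \<epsilon> :: real
  assumes "-1 < a" "0 \<le> \<epsilon>"
  shows "(\<integral>\<^sup>+s\<in>{0<..\<epsilon>}. ennreal (s powr a) \<partial>lborel) = ennreal (\<epsilon> powr (a + 1) / (a + 1))"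
proof -
  have "(\<integral>\<^sup>+s\<in>{0<..\<epsilon>}. ennreal (s powr a) \<partial>lborel) = (\<integral>\<^sup>+s\<in>{0..\<epsilon>}. ennreal (s powr a) \<partial>lborel)"
    by (intro nn_integral_cong) (auto split: split_indicator)
  also have "\<dots> = ennreal (\<epsilon> powr (a + 1) / (a + 1))"
    by (rule nn_integral_has_integral_lebesgue'[OF _ has_integral_powr_from_0[OF assms]]) simp
  finally show ?thesis .
qed

context compact_real
begin

lemma boundary_count_null: "0 < \<epsilon> \<Longrightarrow> B \<subseteq> F \<Longrightarrow> boundary_count B \<epsilon> = 0"
proof -
  assume "0 < \<epsilon>" "B \<subseteq> F"
  then have "frontier (parallel_set F \<epsilon>) \<inter> B = {}" using frontier_disjoint by blast
  then show ?thesis by (simp only: emeasure_empty)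
qed

text \<open>The volume is the integral of the count over radii from 0 to \<epsilon>, and
  s^(-\<delta>) is integrable at 0 because \<delta> < 1. A count of order \<epsilon>^(-\<delta>)
  therefore gives a volume of order \<epsilon>^(1 - \<delta>).\<close>

lemma volume_bounds:
  assumes null: "emeasure lborel F = 0" and B: "B \<in> sets borel" and d: "\<delta> < 1" and \<epsilon>: "0 < \<epsilon>"
  shows "(\<And>s. 0 < s \<Longrightarrow> s \<le> \<epsilon> \<Longrightarrow> boundary_count B s \<le> ennreal (C * s powr - \<delta>)) \<Longrightarrow> 0 \<le> C \<Longrightarrow>
      emeasure lborel (parallel_set F \<epsilon> \<inter> B) \<le> ennreal (C / (1 - \<delta>) * \<epsilon> powr (1 - \<delta>))"
    and "(\<And>s. 0 < s \<Longrightarrow> s \<le> \<epsilon> \<Longrightarrow> ennreal (C * s powr - \<delta>) \<le> boundary_count B s) \<Longrightarrow> 0 \<le> C \<Longrightarrow>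
      ennreal (C / (1 - \<delta>) * \<epsilon> powr (1 - \<delta>)) \<le> emeasure lborel (parallel_set F \<epsilon> \<inter> B)"
proof -
  obtain n where n: "n \<in> borel_measurable borel" "\<And>\<epsilon>. 0 < \<epsilon> \<Longrightarrow> boundary_count B \<epsilon> = n \<epsilon>"
    "\<And>\<epsilon>. 0 < \<epsilon> \<Longrightarrow> emeasure lborel F = 0 \<Longrightarrow>
       emeasure lborel (parallel_set F \<epsilon> \<inter> B) = (\<integral>\<^sup>+s\<in>{0<..\<epsilon>}. n s \<partial>lborel)"
    using boundary_count_measurable[OF B] by blast
  have V: "emeasure lborel (parallel_set F \<epsilon> \<inter> B) = (\<integral>\<^sup>+s\<in>{0<..\<epsilon>}. n s \<partial>lborel)"
    by (rule n(3)[OF \<epsilon> null])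
  have I: "(\<integral>\<^sup>+s\<in>{0<..\<epsilon>}. ennreal (C * s powr - \<delta>) \<partial>lborel) = ennreal (C / (1 - \<delta>) * \<epsilon> powr (1 - \<delta>))"
    if C: "0 \<le> C"
  proof -
    have "(\<integral>\<^sup>+s\<in>{0<..\<epsilon>}. ennreal (C * s powr - \<delta>) \<partial>lborel) =
        (\<integral>\<^sup>+s. ennreal C * (ennreal (s powr - \<delta>) * indicator {0<..\<epsilon>} s) \<partial>lborel)"
      using C by (intro nn_integral_cong) (simp add: ennreal_mult mult.assoc)
    also have "\<dots> = ennreal C * ennreal (\<epsilon> powr (1 - \<delta>) / (1 - \<delta>))"
      using nn_integral_powr_from_0[of "- \<delta>" \<epsilon>] d \<epsilon> by (subst nn_integral_cmult) (simp_all add: add.commute)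
    also have "\<dots> = ennreal (C / (1 - \<delta>) * \<epsilon> powr (1 - \<delta>))"
      unfolding ennreal_mult'[OF C, symmetric] by simp
    finally show ?thesis .
  qed
  show "emeasure lborel (parallel_set F \<epsilon> \<inter> B) \<le> ennreal (C / (1 - \<delta>) * \<epsilon> powr (1 - \<delta>))"
    if b: "\<And>s. 0 < s \<Longrightarrow> s \<le> \<epsilon> \<Longrightarrow> boundary_count B s \<le> ennreal (C * s powr - \<delta>)" and C: "0 \<le> C"
    unfolding V I[OF C, symmetric]
  proof (rule nn_integral_mono)
    fix s
    show "n s * indicator {0<..\<epsilon>} s \<le> ennreal (C * s powr - \<delta>) * indicator {0<..\<epsilon>} s"
      using b[of s] n(2)[of s] by (cases "0 < s \<and> s \<le> \<epsilon>") (simp_all del: emeasure_count_space)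
  qed
  show "ennreal (C / (1 - \<delta>) * \<epsilon> powr (1 - \<delta>)) \<le> emeasure lborel (parallel_set F \<epsilon> \<inter> B)"
    if b: "\<And>s. 0 < s \<Longrightarrow> s \<le> \<epsilon> \<Longrightarrow> ennreal (C * s powr - \<delta>) \<le> boundary_count B s" and C: "0 \<le> C"
    unfolding V I[OF C, symmetric]
  proof (rule nn_integral_mono)
    fix s
    show "ennreal (C * s powr - \<delta>) * indicator {0<..\<epsilon>} s \<le> n s * indicator {0<..\<epsilon>} s"
      using b[of s] n(2)[of s] by (cases "0 < s \<and> s \<le> \<epsilon>") (simp_all del: emeasure_count_space)
  qed
qed

lemma boundary_count_UNIV:
  "0 < \<epsilon> \<Longrightarrow> boundary_count UNIV \<epsilon> = ennreal (2 + 2 * real (card (long_gaps (2 * \<epsilon>))))"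
proof -
  assume "0 < \<epsilon>"
  have "(1::ennreal) + 1 + of_nat k * (1 + 1) = ennreal (2 + 2 * real k)" for k
    by (simp add: ennreal_plus[symmetric] ennreal_of_nat_eq_real_of_nat ennreal_mult'[symmetric]
        one_add_one mult.commute flip: ennreal_1 ennreal_numeral del: ennreal_plus)
  then show ?thesis
    unfolding boundary_count_formula[OF \<open>0 < \<epsilon>\<close>] by simp
qed

end

context interval_ifs
begin

text \<open>Images of the hull and not of F: boundary points lie in the gaps, so the average
  measures charge the cylinders only through the gaps these contain.\<close>

definition cyl :: "nat list \<Rightarrow> real set" where "cyl w = word_map \<phi> w ` {lo..hi}"
definition word_ratio :: "nat list \<Rightarrow> real" where "word_ratio w = prod_list (map r w)"
definition words :: "nat \<Rightarrow> nat list set" where "words n = {w. set w \<subseteq> {1..N} \<and> length w = n}"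

lemma word_map_simps [simp]: "word_map \<phi> [] = id" "word_map \<phi> (i # w) = \<phi> i \<circ> word_map \<phi> w"
  by (simp_all add: word_map_def)

lemma word_ratio_simps [simp]: "word_ratio [] = 1" "word_ratio (i # w) = r i * word_ratio w"
  by (simp_all add: word_ratio_def)

lemma cyl_simps: "cyl [] = {lo..hi}" "cyl (i # w) = \<phi> i ` cyl w"
  by (simp_all add: cyl_def image_comp)

lemma word_ratio_pos: "set w \<subseteq> {1..N} \<Longrightarrow> 0 < word_ratio w"
proof (induction w)
  case (Cons i w)
  then have "i \<in> {1..N}" "0 < word_ratio w" by simp_all
  then show ?case using ratio(1) by simp
qed simp

lemma word_map_X: "set w \<subseteq> {1..N} \<Longrightarrow> word_map \<phi> w ` X \<subseteq> X"
proof (induction w)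
  case (Cons i w)
  then have "i \<in> {1..N}" "word_map \<phi> w ` X \<subseteq> X" by simp_all
  then show ?case using maps_X[of i] by (fastforce simp: image_comp[symmetric])
qed simp

lemma word_map_F: "set w \<subseteq> {1..N} \<Longrightarrow> u \<in> F \<Longrightarrow> word_map \<phi> w u \<in> F"
proof (induction w)
  case (Cons i w)
  then have "i \<in> {1..N}" "word_map \<phi> w u \<in> F" by simp_all
  then show ?case using map_F by simp
qed simp

text \<open>The endpoints are recorded as points of the image of F. This confines every nearest
  point in F of a point of the cylinder to the cylinder, as used for the lower bound in
  \<open>count_B_bounds\<close>.\<close>

lemma cyl_interval:
  assumes "set w \<subseteq> {1..N}"
  shows "\<exists>c\<in>word_map \<phi> w ` F. \<exists>d\<in>word_map \<phi> w ` F. cyl w = {c..d} \<and> d - c = word_ratio w * (hi - lo)"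
  using assms
proof (induction w)
  case Nil
  then show ?case using lo_in hi_in by (auto simp: cyl_simps)
next
  case (Cons i w)
  then have i: "i \<in> {1..N}" and w: "set w \<subseteq> {1..N}" by simp_all
  obtain c d where cd: "c \<in> word_map \<phi> w ` F" "d \<in> word_map \<phi> w ` F" "cyl w = {c..d}"
    "d - c = word_ratio w * (hi - lo)" using Cons.IH[OF w] by blast
  have "0 \<le> word_ratio w * (hi - lo)" using word_ratio_pos[OF w] lo_le_hi by simp
  then have le: "c \<le> d" using cd(4) by simp
  have "c \<in> F" "d \<in> F" using cd(1,2) word_map_F[OF w] by auto
  then have cX: "c \<in> X" "d \<in> X" using F_X by auto
  obtain c' d' where cd': "{c', d'} = {\<phi> i c, \<phi> i d}" "d' - c' = r i * (d - c)"
    "\<phi> i ` {c<..<d} = {c'<..<d'}" "\<phi> i ` {c..d} = {c'..d'}"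
    by (rule image_interval[OF i cX le])
  have "{\<phi> i c, \<phi> i d} \<subseteq> word_map \<phi> (i # w) ` F" using cd(1,2) by auto
  then have "{c', d'} \<subseteq> word_map \<phi> (i # w) ` F" unfolding cd'(1) .
  then have "c' \<in> word_map \<phi> (i # w) ` F" "d' \<in> word_map \<phi> (i # w) ` F" by simp_all
  moreover have "cyl (i # w) = {c'..d'}" unfolding cyl_simps cd(3) by (rule cd'(4))
  moreover have "d' - c' = word_ratio (i # w) * (hi - lo)" unfolding cd'(2) cd(4) by simp
  ultimately show ?case by blast
qed

lemma cyl_subset: "set w \<subseteq> {1..N} \<Longrightarrow> cyl w \<subseteq> {lo..hi}"
proof (induction w)
  case (Cons i w)
  then have "i \<in> {1..N}" "cyl w \<subseteq> {lo..hi}" by simp_all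
  then show ?case using piece_subset[of i] image_mono[of "cyl w" "{lo..hi}" "\<phi> i"] by (simp add: cyl_simps)
qed (simp add: cyl_simps)

lemma cyl_X: "set w \<subseteq> {1..N} \<Longrightarrow> cyl w \<subseteq> X"
  using cyl_subset hull_X by blast

lemma cyl_borel: "set w \<subseteq> {1..N} \<Longrightarrow> cyl w \<in> sets borel"
  using cyl_interval[of w] by auto

lemma gap_word_image:
  assumes w: "set w \<subseteq> {1..N}" and C: "C \<in> gaps F"
  shows "word_map \<phi> w ` C \<in> gaps F \<and> measure lborel (word_map \<phi> w ` C) = word_ratio w * measure lborel C \<and>
    word_map \<phi> w ` C \<subseteq> cyl w"
  using w
proof (induction w)
  case Nil
  then show ?case using C gap_subset[OF C] by (auto simp: cyl_simps)
next
  case (Cons i w)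
  then have i: "i \<in> {1..N}" and w: "set w \<subseteq> {1..N}" by simp_all
  note IH = Cons.IH[OF w]
  have "word_map \<phi> (i # w) ` C = \<phi> i ` (word_map \<phi> w ` C)" by (simp add: image_comp)
  then show ?case using IH gap_image(1,2)[OF i conjunct1[OF IH]] by (simp add: cyl_simps image_mono)
qed

lemma gap_word_preimage:
  assumes "set w \<subseteq> {1..N}" "C \<in> gaps F" "C \<inter> cyl w \<noteq> {}"
  shows "\<exists>D\<in>gaps F. C = word_map \<phi> w ` D"
  using assms
proof (induction w arbitrary: C)
  case (Cons i w)
  then have i: "i \<in> {1..N}" and w: "set w \<subseteq> {1..N}" by simp_all
  have "cyl (i # w) \<subseteq> piece i" unfolding cyl_simps using cyl_subset[OF w] by (rule image_mono)
  then have "C \<inter> piece i \<noteq> {}" using Cons.prems(3) by blast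
  then obtain D where D: "D \<in> gaps F" "C = \<phi> i ` D" by (rule gap_preimage[OF i Cons.prems(2)])
  have "C \<inter> cyl (i # w) = \<phi> i ` (D \<inter> cyl w)"
    unfolding D(2) cyl_simps using inj_on_image_Int[OF inj_map[OF i] gap_X[OF D(1)] cyl_X[OF w]] by simp
  then have "D \<inter> cyl w \<noteq> {}" using Cons.prems(3) by auto
  then obtain E where "E \<in> gaps F" "D = word_map \<phi> w ` E" using Cons.IH[OF w D(1)] by blast
  then show ?case using D(2) by (intro bexI[of _ E]) (simp_all add: image_comp)
qed simp

lemma word_map_inj: "set w \<subseteq> {1..N} \<Longrightarrow> inj_on (word_map \<phi> w) X"
proof (induction w)
  case (Cons i w)
  then have i: "i \<in> {1..N}" and w: "inj_on (word_map \<phi> w) X" "word_map \<phi> w ` X \<subseteq> X" using word_map_X by simp_all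
  show ?case unfolding word_map_simps by (rule comp_inj_on[OF w(1) inj_on_subset[OF inj_map[OF i] w(2)]])
qed simp

lemma cyl_Cons_Int:
  assumes "i \<in> {1..N}" "set w \<subseteq> {1..N}" "set v \<subseteq> {1..N}"
  shows "cyl (i # w) \<inter> cyl (i # v) = \<phi> i ` (cyl w \<inter> cyl v)"
  unfolding cyl_simps
  by (rule inj_on_image_Int[OF inj_map[OF assms(1)] cyl_X[OF assms(2)] cyl_X[OF assms(3)], symmetric])

text \<open>At the first letter where the words differ the cylinders lie in different pieces, which
  meet only in images of \<open>lo\<close> or \<open>hi\<close>. Overlaps inside F carry no boundary
  points and no length.\<close>

lemma cyl_overlap:
  assumes "set w \<subseteq> {1..N}" "set w' \<subseteq> {1..N}" "length w = length w'" "w \<noteq> w'"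
  shows "cyl w \<inter> cyl w' \<subseteq> F"
  using assms
proof (induction w arbitrary: w')
  case (Cons i w)
  then obtain j v where w': "w' = j # v" by (cases w') auto
  have ij: "i \<in> {1..N}" "j \<in> {1..N}" and w: "set w \<subseteq> {1..N}" "set v \<subseteq> {1..N}"
    using Cons.prems w' by simp_all
  show ?case
  proof (cases "i = j")
    case True
    then have "cyl w \<inter> cyl v \<subseteq> F" using Cons w' by simp
    then have "\<phi> i ` (cyl w \<inter> cyl v) \<subseteq> \<phi> i ` F" by (rule image_mono)
    also have "\<phi> i ` F \<subseteq> F" using map_F[OF ij(1)] by (rule image_subsetI)
    finally show ?thesis unfolding w' True[symmetric] cyl_Cons_Int[OF ij(1) w] .
  next
    case False
    show ?thesis
    proof
      fix z assume z: "z \<in> cyl (i # w) \<inter> cyl w'"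
      then obtain y where y: "y \<in> {lo..hi}" "z = \<phi> i y" using cyl_subset[OF w(1)] by (auto simp: cyl_simps)
      have "z \<in> piece j" using z cyl_subset[OF w(2)] by (auto simp: cyl_simps w')
      then have "y \<notin> {lo<..<hi}" using disjoint_pieces[OF ij False] y(2) by blast
      then have "y = lo \<or> y = hi" using y(1) by auto
      then show "z \<in> F" using map_F[OF ij(1)] lo_in hi_in y(2) by blast
    qed
  qed
qed simp

lemma finite_words: "finite (words n)"
  unfolding words_def by (rule finite_lists_length_eq) simp

lemma cyl_small:
  assumes e: "0 < e"
  shows "\<exists>n. \<forall>w\<in>words n. \<forall>x\<in>cyl w. \<forall>y\<in>cyl w. dist x y < e"
proof -
  define \<rho> where "\<rho> = Max (r ` {1..N})"
  have ne: "r ` {1..N} \<noteq> {}" using two_maps by auto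
  have \<rho>: "r i \<le> \<rho>" if "i \<in> {1..N}" for i unfolding \<rho>_def using that by (intro Max_ge) auto
  have "\<rho> \<in> r ` {1..N}" unfolding \<rho>_def using ne by (intro Max_in) auto
  then have \<rho>1: "0 < \<rho>" "\<rho> < 1" using ratio by auto
  have le: "word_ratio w \<le> \<rho> ^ length w" if "set w \<subseteq> {1..N}" for w
    using that
  proof (induction w)
    case (Cons i w)
    then have i: "i \<in> {1..N}" and w: "set w \<subseteq> {1..N}" by simp_all
    have "r i * word_ratio w \<le> \<rho> * \<rho> ^ length w"
      using \<rho>[OF i] Cons.IH[OF w] word_ratio_pos[OF w] \<rho>1 by (intro mult_mono) auto
    then show ?case by simp
  qed simp
  have pos: "0 < hi - lo" using lo_less_hi by simp
  obtain n where n: "\<rho> ^ n < e / (hi - lo)"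
    using real_arch_pow_inv[of "e / (hi - lo)" \<rho>] e pos \<rho>1 by auto
  have "dist x y < e" if w: "w \<in> words n" and xy: "x \<in> cyl w" "y \<in> cyl w" for w x y
  proof -
    have w': "set w \<subseteq> {1..N}" "length w = n" using w by (simp_all add: words_def)
    obtain c d where cd: "cyl w = {c..d}" "d - c = word_ratio w * (hi - lo)"
      using cyl_interval[OF w'(1)] by blast
    have "dist x y \<le> d - c" using xy unfolding cd(1) by (auto simp: dist_real_def)
    also have "\<dots> \<le> \<rho> ^ n * (hi - lo)"
      unfolding cd(2) using le[OF w'(1)] w'(2) pos by (intro mult_right_mono) auto
    also have "\<dots> < e" using n pos by (simp add: field_simps)
    finally show ?thesis .
  qed
  then show ?thesis by blast
qed

text \<open>The two outer boundary points lie outside the hull. Every other one lies in its gap, and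
  a gap meeting the cylinder is the image of a gap under the word map and so lies inside it. A long
  gap thus contributes both of its points or none, and lengths scale by
  \<open>word_ratio w\<close>.\<close>

lemma boundary_count_cyl:
  assumes w: "set w \<subseteq> {1..N}" and \<epsilon>: "0 < \<epsilon>"
  shows "boundary_count (cyl w) \<epsilon> = ennreal (2 * real (card (long_gaps (2 * (\<epsilon> / word_ratio w)))))"
proof -
  let ?G = "long_gaps (2 * \<epsilon>)" and ?H = "long_gaps (2 * (\<epsilon> / word_ratio w))"
  have rw: "0 < word_ratio w" using word_ratio_pos[OF w] .
  have fin: "finite ?G" "finite ?H" using \<epsilon> rw by (auto intro!: finite_long_gaps)
  have out: "lo - \<epsilon> \<notin> cyl w" "hi + \<epsilon> \<notin> cyl w" using cyl_subset[OF w] \<epsilon> by auto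
  have inside: "Inf C + \<epsilon> \<in> cyl w \<longleftrightarrow> C \<in> (`) (word_map \<phi> w) ` ?H"
    "Sup C - \<epsilon> \<in> cyl w \<longleftrightarrow> C \<in> (`) (word_map \<phi> w) ` ?H" if C: "C \<in> ?G" for C
  proof -
    have CF: "C \<in> gaps F" and l: "2 * \<epsilon> < measure lborel C" using C by (simp_all add: long_gaps_def)
    from CF obtain u v where uv: "C = {u<..<v}" "u < v" "measure lborel C = v - u" "Inf C = u" "Sup C = v"
      by (rule gapE)
    have pts: "Inf C + \<epsilon> \<in> C" "Sup C - \<epsilon> \<in> C" using uv l \<epsilon> by auto
    have 1: "C \<in> (`) (word_map \<phi> w) ` ?H" if meet: "C \<inter> cyl w \<noteq> {}"
    proof -
      obtain D where D: "D \<in> gaps F" "C = word_map \<phi> w ` D" using gap_word_preimage[OF w CF meet] by blast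
      then have "D \<in> ?H" using l gap_word_image[OF w D(1)] rw by (simp add: long_gaps_def field_simps)
      then show ?thesis using D(2) by blast
    qed
    have 2: "C \<subseteq> cyl w" if "C \<in> (`) (word_map \<phi> w) ` ?H"
      using that gap_word_image[OF w] by (auto simp: long_gaps_def)
    show "Inf C + \<epsilon> \<in> cyl w \<longleftrightarrow> C \<in> (`) (word_map \<phi> w) ` ?H" using 1 2 pts(1) by blast
    show "Sup C - \<epsilon> \<in> cyl w \<longleftrightarrow> C \<in> (`) (word_map \<phi> w) ` ?H" using 1 2 pts(2) by blast
  qed
  have sub: "(`) (word_map \<phi> w) ` ?H \<subseteq> ?G"
  proof
    fix C assume "C \<in> (`) (word_map \<phi> w) ` ?H"
    then obtain D where D: "D \<in> ?H" "C = word_map \<phi> w ` D" by blast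
    then have "D \<in> gaps F" "2 * (\<epsilon> / word_ratio w) < measure lborel D" by (simp_all add: long_gaps_def)
    then show "C \<in> ?G" using gap_word_image[OF w \<open>D \<in> gaps F\<close>] D(2) rw by (simp add: long_gaps_def field_simps)
  qed
  have inj: "inj_on ((`) (word_map \<phi> w)) ?H"
    by (rule inj_on_subset[OF inj_on_image_Pow[OF word_map_inj[OF w]]]) (use gap_X in \<open>auto simp: long_gaps_def\<close>)
  have "boundary_count (cyl w) \<epsilon> = (\<Sum>C\<in>?G. indicator (cyl w) (Inf C + \<epsilon>) + indicator (cyl w) (Sup C - \<epsilon>))"
    unfolding boundary_count_formula[OF \<epsilon>] using out by simp
  also have "\<dots> = (\<Sum>C\<in>?G. if C \<in> (`) (word_map \<phi> w) ` ?H then 2 else 0)"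
    by (rule sum.cong[OF refl]) (simp add: indicator_def inside one_add_one)
  also have "\<dots> = of_nat (card ((`) (word_map \<phi> w) ` ?H)) * 2"
    using fin(1) sub by (simp add: sum.If_cases Int_absorb1)
  also have "card ((`) (word_map \<phi> w) ` ?H) = card ?H" by (rule card_image[OF inj])
  also have "of_nat (card ?H) * 2 = ennreal (2 * real (card ?H))"
    by (simp add: ennreal_of_nat_eq_real_of_nat ennreal_mult' mult.commute)
  finally show ?thesis .
qed

end

context conformal_ifs
begin

lemma emeasure_\<nu>_cyl: "set w \<subseteq> {1..N} \<Longrightarrow> emeasure \<nu> (cyl w) = ennreal (word_ratio w powr \<delta>)"
proof (induction w)
  case Nil
  then show ?case using emeasure_\<nu>_superset[OF F_subset] by (simp add: cyl_simps)
next
  case (Cons i w)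
  then have i: "i \<in> {1..N}" and w: "set w \<subseteq> {1..N}" by simp_all
  have "emeasure \<nu> (cyl (i # w)) = ennreal (r i powr \<delta>) * ennreal (word_ratio w powr \<delta>)"
    unfolding cyl_simps using emeasure_\<nu>_image[OF i cyl_borel[OF w] cyl_X[OF w]] Cons.IH[OF w] by simp
  then show ?case using ratio(1)[OF i] word_ratio_pos[OF w] by (simp add: powr_mult ennreal_mult'[symmetric])
qed

text \<open>That the overlap lies in F does not help here, since F has full mass. At the first
  differing letter the assumed null overlap of the images of X applies, and conformality transports
  it through the common prefix.\<close>

lemma emeasure_\<nu>_cyl_overlap:
  assumes "set w \<subseteq> {1..N}" "set w' \<subseteq> {1..N}" "length w = length w'" "w \<noteq> w'"
  shows "emeasure \<nu> (cyl w \<inter> cyl w') = 0"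
  using assms
proof (induction w arbitrary: w')
  case (Cons i w)
  then obtain j v where w': "w' = j # v" by (cases w') auto
  have ij: "i \<in> {1..N}" "j \<in> {1..N}" and w: "set w \<subseteq> {1..N}" "set v \<subseteq> {1..N}"
    using Cons.prems w' by simp_all
  show ?case
  proof (cases "i = j")
    case True
    then have "emeasure \<nu> (cyl w \<inter> cyl v) = 0" using Cons w' by simp
    moreover have "cyl (i # w) \<inter> cyl w' = \<phi> i ` (cyl w \<inter> cyl v)"
      unfolding w' True[symmetric] by (rule cyl_Cons_Int[OF ij(1) w])
    moreover have "cyl w \<inter> cyl v \<in> sets borel" "cyl w \<inter> cyl v \<subseteq> X"
      using cyl_borel w cyl_X[OF w(1)] by auto
    ultimately show ?thesis using emeasure_\<nu>_image[OF ij(1), of "cyl w \<inter> cyl v"] by simp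
  next
    case False
    have "cyl (i # w) \<inter> cyl w' \<subseteq> \<phi> i ` X \<inter> \<phi> j ` X"
      unfolding w' cyl_simps by (rule Int_mono[OF image_mono[OF cyl_X[OF w(1)]] image_mono[OF cyl_X[OF w(2)]]])
    moreover have "\<phi> i ` X \<inter> \<phi> j ` X \<in> sets \<nu>"
      using image_X_borel[OF ij(1)] image_X_borel[OF ij(2)] by simp
    ultimately show ?thesis using \<nu>_overlap[OF ij False] by (metis emeasure_eq_0)
  qed
qed simp

lemma sum_word_ratio: "(\<Sum>w\<in>words n. word_ratio w powr \<delta>) = 1"
proof (induction n)
  case 0
  have "words 0 = {[]}" by (auto simp: words_def)
  then show ?case by simp
next
  case (Suc n)
  let ?f = "\<lambda>(i, w). i # w"
  have "words (Suc n) = ?f ` ({1..N} \<times> words n)"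
    by (auto simp: words_def length_Suc_conv image_iff)
  moreover have "inj_on ?f ({1..N} \<times> words n)" by (auto simp: inj_on_def)
  ultimately have "(\<Sum>w\<in>words (Suc n). word_ratio w powr \<delta>) =
      (\<Sum>x\<in>{1..N} \<times> words n. word_ratio (?f x) powr \<delta>)"
    by (simp add: sum.reindex)
  also have "\<dots> = (\<Sum>x\<in>{1..N} \<times> words n. case x of (i, w) \<Rightarrow> r i powr \<delta> * word_ratio w powr \<delta>)"
  proof (rule sum.cong[OF refl])
    fix x assume "x \<in> {1..N} \<times> words n"
    then obtain i w where x: "x = (i, w)" "i \<in> {1..N}" "w \<in> words n" by blast
    then have "0 < r i" "0 < word_ratio w" using ratio(1) word_ratio_pos by (simp_all add: words_def)
    then show "word_ratio (?f x) powr \<delta> = (case x of (i, w) \<Rightarrow> r i powr \<delta> * word_ratio w powr \<delta>)"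
      using x(1) by (simp add: powr_mult)
  qed
  also have "\<dots> = (\<Sum>i\<in>{1..N}. \<Sum>w\<in>words n. r i powr \<delta> * word_ratio w powr \<delta>)"
    by (rule sum.cartesian_product[symmetric])
  also have "\<dots> = (\<Sum>i\<in>{1..N}. r i powr \<delta> * 1)"
    unfolding sum_distrib_left[symmetric] Suc.IH ..
  also have "\<dots> = 1" using moran by simp
  finally show ?case .
qed

section \<open>The scaling exponents of F\<close>

lemma boundary_count_total_bounds:
  obtains c C \<epsilon>1 where "0 < c" "0 < C" "0 < \<epsilon>1" "\<epsilon>1 \<le> 1"
    "\<And>\<epsilon>. 0 < \<epsilon> \<Longrightarrow> \<epsilon> \<le> \<epsilon>1 \<Longrightarrow> ennreal (c * \<epsilon> powr - \<delta>) \<le> boundary_count UNIV \<epsilon>"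
    "\<And>\<epsilon>. 0 < \<epsilon> \<Longrightarrow> \<epsilon> \<le> 1 \<Longrightarrow> boundary_count UNIV \<epsilon> \<le> ennreal (C * \<epsilon> powr - \<delta>)"
proof -
  obtain C where C: "0 < C" "\<And>\<epsilon>. 0 < \<epsilon> \<Longrightarrow> \<epsilon> \<le> 1 \<Longrightarrow> gap_count \<epsilon> \<le> C * \<epsilon> powr - \<delta>"
    using gap_count_upper by blast
  obtain c \<epsilon>1 where c: "0 < c" "0 < \<epsilon>1" "\<And>\<epsilon>. 0 < \<epsilon> \<Longrightarrow> \<epsilon> \<le> \<epsilon>1 \<Longrightarrow> c * \<epsilon> powr - \<delta> \<le> gap_count \<epsilon>"
    using gap_count_lower by blast
  have b: "boundary_count UNIV \<epsilon> = ennreal (2 + 2 * gap_count \<epsilon>)" if "0 < \<epsilon>" for \<epsilon>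
    unfolding gap_count_def by (rule boundary_count_UNIV[OF that])
  show thesis
  proof (rule that[of c "2 + 2 * C" "min \<epsilon>1 1"])
    fix \<epsilon> assume \<epsilon>: "0 < \<epsilon>" "\<epsilon> \<le> min \<epsilon>1 1"
    have "0 \<le> gap_count \<epsilon>" by (simp add: gap_count_def)
    then have "c * \<epsilon> powr - \<delta> \<le> 2 + 2 * gap_count \<epsilon>" using c(3)[of \<epsilon>] \<epsilon> by simp
    then show "ennreal (c * \<epsilon> powr - \<delta>) \<le> boundary_count UNIV \<epsilon>" unfolding b[OF \<epsilon>(1)] by (rule ennreal_leI)
  next
    fix \<epsilon> :: real assume \<epsilon>: "0 < \<epsilon>" "\<epsilon> \<le> 1"
    \<comment> \<open>The two outer boundary points are absorbed into the power because
      \<epsilon>^(-\<delta>) \<ge> 1 for \<epsilon> \<le> 1.\<close>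
    have "1 powr - \<delta> \<le> \<epsilon> powr - \<delta>" using \<epsilon> \<delta>_pos by (intro powr_mono2') auto
    then have "2 + 2 * gap_count \<epsilon> \<le> (2 + 2 * C) * \<epsilon> powr - \<delta>"
      using C(2)[OF \<epsilon>] by (simp add: distrib_right)
    then show "boundary_count UNIV \<epsilon> \<le> ennreal ((2 + 2 * C) * \<epsilon> powr - \<delta>)"
      unfolding b[OF \<epsilon>(1)] by (rule ennreal_leI)
  qed (use c C in auto)
qed

lemma eventually_at_right_le:
  "0 < a \<Longrightarrow> \<forall>\<^sub>F \<epsilon>::real in at_right 0. 0 < \<epsilon> \<and> \<epsilon> \<le> a"
  unfolding eventually_at_right_field by (intro exI[of _ a]) auto

lemma scaling_exponent0_F: "scaling_exponent0 F = \<delta>"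
proof -
  obtain c C \<epsilon>1 where b: "0 < c" "0 < C" "0 < \<epsilon>1" "\<epsilon>1 \<le> 1"
    "\<And>\<epsilon>. 0 < \<epsilon> \<Longrightarrow> \<epsilon> \<le> \<epsilon>1 \<Longrightarrow> ennreal (c * \<epsilon> powr - \<delta>) \<le> boundary_count UNIV \<epsilon>"
    "\<And>\<epsilon>. 0 < \<epsilon> \<Longrightarrow> \<epsilon> \<le> 1 \<Longrightarrow> boundary_count UNIV \<epsilon> \<le> ennreal (C * \<epsilon> powr - \<delta>)"
    by (rule boundary_count_total_bounds) blast
  have "Inf {t. ((\<lambda>\<epsilon>. ennreal (\<epsilon> powr t) * boundary_count UNIV \<epsilon>) \<longlongrightarrow> 0) (at_right 0)} = \<delta>"
  proof (rule Inf_scaling_exponent[OF b(1)])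
    show "\<forall>\<^sub>F \<epsilon> in at_right 0. ennreal (c * \<epsilon> powr - \<delta>) \<le> boundary_count UNIV \<epsilon>"
      using eventually_at_right_le[OF b(3)] by eventually_elim (rule b(5), auto)
    show "\<forall>\<^sub>F \<epsilon> in at_right 0. boundary_count UNIV \<epsilon> \<le> ennreal (C * \<epsilon> powr - \<delta>)"
      using eventually_at_right_le[OF zero_less_one] by eventually_elim (rule b(6), auto)
  qed
  then show ?thesis unfolding scaling_exponent0_def by (simp only: Int_UNIV_right)
qed

lemma volume_total_upper:
  obtains K where "0 < K"
    "\<And>\<epsilon>. 0 < \<epsilon> \<Longrightarrow> \<epsilon> \<le> 1 \<Longrightarrow> emeasure lborel (parallel_set F \<epsilon>) \<le> ennreal (K * \<epsilon> powr (1 - \<delta>))"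
proof -
  obtain c C \<epsilon>1 where b: "0 < c" "0 < C" "0 < \<epsilon>1" "\<epsilon>1 \<le> 1"
    "\<And>\<epsilon>. 0 < \<epsilon> \<Longrightarrow> \<epsilon> \<le> \<epsilon>1 \<Longrightarrow> ennreal (c * \<epsilon> powr - \<delta>) \<le> boundary_count UNIV \<epsilon>"
    "\<And>\<epsilon>. 0 < \<epsilon> \<Longrightarrow> \<epsilon> \<le> 1 \<Longrightarrow> boundary_count UNIV \<epsilon> \<le> ennreal (C * \<epsilon> powr - \<delta>)"
    by (rule boundary_count_total_bounds) blast
  show thesis
  proof (rule that[of "C / (1 - \<delta>)"])
    show "0 < C / (1 - \<delta>)" using b(2) \<delta>_less_1 by simp
    fix \<epsilon> :: real assume \<epsilon>: "0 < \<epsilon>" "\<epsilon> \<le> 1"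
    have "emeasure lborel (parallel_set F \<epsilon> \<inter> UNIV) \<le> ennreal (C / (1 - \<delta>) * \<epsilon> powr (1 - \<delta>))"
      by (rule volume_bounds(1)[OF null_F _ \<delta>_less_1 \<epsilon>(1) b(6)]) (use \<epsilon> b(2) in auto)
    then show "emeasure lborel (parallel_set F \<epsilon>) \<le> ennreal (C / (1 - \<delta>) * \<epsilon> powr (1 - \<delta>))" by simp
  qed
qed

lemma scaling_exponent1_F: "scaling_exponent1 F = \<delta> - 1"
proof -
  obtain c C \<epsilon>1 where b: "0 < c" "0 < C" "0 < \<epsilon>1" "\<epsilon>1 \<le> 1"
    "\<And>\<epsilon>. 0 < \<epsilon> \<Longrightarrow> \<epsilon> \<le> \<epsilon>1 \<Longrightarrow> ennreal (c * \<epsilon> powr - \<delta>) \<le> boundary_count UNIV \<epsilon>"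
    "\<And>\<epsilon>. 0 < \<epsilon> \<Longrightarrow> \<epsilon> \<le> 1 \<Longrightarrow> boundary_count UNIV \<epsilon> \<le> ennreal (C * \<epsilon> powr - \<delta>)"
    by (rule boundary_count_total_bounds) blast
  obtain K where K: "0 < K"
    "\<And>\<epsilon>. 0 < \<epsilon> \<Longrightarrow> \<epsilon> \<le> 1 \<Longrightarrow> emeasure lborel (parallel_set F \<epsilon>) \<le> ennreal (K * \<epsilon> powr (1 - \<delta>))"
    by (rule volume_total_upper) blast
  have c': "0 < c / (1 - \<delta>)" using b(1) \<delta>_less_1 by simp
  have "Inf {t. ((\<lambda>\<epsilon>. ennreal (\<epsilon> powr t) * emeasure lborel (parallel_set F \<epsilon>)) \<longlongrightarrow> 0) (at_right 0)} = \<delta> - 1"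
  proof (rule Inf_scaling_exponent[OF c', where C = K])
    show "\<forall>\<^sub>F \<epsilon> in at_right 0. ennreal (c / (1 - \<delta>) * \<epsilon> powr - (\<delta> - 1)) \<le> emeasure lborel (parallel_set F \<epsilon>)"
      using eventually_at_right_le[OF b(3)]
    proof eventually_elim
      case (elim \<epsilon>)
      have "ennreal (c / (1 - \<delta>) * \<epsilon> powr (1 - \<delta>)) \<le> emeasure lborel (parallel_set F \<epsilon> \<inter> UNIV)"
        by (rule volume_bounds(2)[OF null_F _ \<delta>_less_1 _ b(5)]) (use elim b(1) in auto)
      then show ?case by simp
    qed
    show "\<forall>\<^sub>F \<epsilon> in at_right 0. emeasure lborel (parallel_set F \<epsilon>) \<le> ennreal (K * \<epsilon> powr - (\<delta> - 1))"
      using eventually_at_right_le[OF zero_less_one]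
    proof eventually_elim
      case (elim \<epsilon>)
      then show ?case using K(2)[of \<epsilon>] by simp
    qed
  qed
  then show ?thesis unfolding scaling_exponent1_def .
qed

end

section \<open>Limits of the average curvature measures\<close>

lemma filterlim_abs_ln: "filterlim (\<lambda>T::real. \<bar>ln T\<bar>) at_top (at_right 0)"
  by (rule filterlim_at_top_mono[OF filterlim_neg_ln]) (simp add: abs_ge_minus_self)

lemma const_over_abs_ln: "((\<lambda>T::real. c / \<bar>ln T\<bar>) \<longlongrightarrow> (0::real)) (at_right 0)"
  by (rule real_tendsto_divide_at_top[OF tendsto_const filterlim_abs_ln])

lemma eventually_unit_interval: "\<forall>\<^sub>F T::real in at_right 0. 0 < T \<and> T < 1"
  unfolding eventually_at_right_field by (intro exI[of _ 1]) auto

context conformal_ifs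
begin

abbreviation limit_const :: real where "limit_const \<equiv> prim_moment / mean_log"

text \<open>One computation for two uses: a cylinder has A = 0 and \<rho> =
  \<open>word_ratio w\<close>, the whole line has A = 2, the outer points, and \<rho> = 1.\<close>

lemma boundary_count_integral:
  assumes T: "0 < T" "T \<le> 1" and \<rho>: "0 < \<rho>" and A: "0 \<le> A"
    and B: "\<And>\<epsilon>. 0 < \<epsilon> \<Longrightarrow> boundary_count B \<epsilon> = ennreal (A + 2 * gap_count (\<epsilon> / \<rho>))"
  shows "(\<integral>\<^sup>+\<epsilon>\<in>{T..1}. ennreal (\<epsilon> powr (\<delta> - 1)) * boundary_count B \<epsilon> \<partial>lborel) =
    ennreal (A * ((1 - T powr \<delta>) / \<delta>) + 2 * (\<rho> powr \<delta> * (gap_moment (T / \<rho>) - gap_moment (1 / \<rho>))))"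
proof -
  \<comment> \<open>Clamping at T yields a function that is monotone on the whole line and hence
    Borel. For \<epsilon> \<le> 0 the set of long gaps is infinite and its \<open>card\<close> is 0,
    which would destroy monotonicity.\<close>
  let ?N = "\<lambda>\<epsilon>. gap_count (max \<epsilon> T / \<rho>)"
  have nn: "0 \<le> gap_count \<epsilon>" for \<epsilon> by (simp add: gap_count_def)
  have "mono (\<lambda>\<epsilon>. - ?N \<epsilon>)"
  proof (rule monoI)
    fix x y :: real assume "x \<le> y"
    then have "max x T / \<rho> \<le> max y T / \<rho>" using \<rho> by (intro divide_right_mono) auto
    moreover have "0 < max x T / \<rho>" using T \<rho> by (intro divide_pos_pos) auto
    ultimately show "- ?N x \<le> - ?N y" using gap_count_antimono by simp
  qed
  then have "(\<lambda>\<epsilon>. - (- ?N \<epsilon>)) \<in> borel_measurable borel"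
    by (intro borel_measurable_uminus borel_measurable_mono)
  then have [measurable]: "?N \<in> borel_measurable borel" by simp
  have eqN: "ennreal (gap_count (\<epsilon> / \<rho>)) * indicator {T..1} \<epsilon> = ennreal (?N \<epsilon>) * indicator {T..1} \<epsilon>" for \<epsilon>
    by (cases "T \<le> \<epsilon>") (simp_all add: max_def)
  have "(\<integral>\<^sup>+\<epsilon>\<in>{T..1}. ennreal (\<epsilon> powr (\<delta> - 1)) * boundary_count B \<epsilon> \<partial>lborel) =
      (\<integral>\<^sup>+\<epsilon>. ennreal A * (ennreal (\<epsilon> powr (\<delta> - 1)) * indicator {T..1} \<epsilon>) +
        2 * (ennreal (\<epsilon> powr (\<delta> - 1)) * ennreal (?N \<epsilon>) * indicator {T..1} \<epsilon>) \<partial>lborel)"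
  proof (rule nn_integral_cong)
    fix \<epsilon>
    show "ennreal (\<epsilon> powr (\<delta> - 1)) * boundary_count B \<epsilon> * indicator {T..1} \<epsilon> =
        ennreal A * (ennreal (\<epsilon> powr (\<delta> - 1)) * indicator {T..1} \<epsilon>) +
        2 * (ennreal (\<epsilon> powr (\<delta> - 1)) * ennreal (?N \<epsilon>) * indicator {T..1} \<epsilon>)"
    proof (cases "\<epsilon> \<in> {T..1}")
      case True
      then have e: "0 < \<epsilon>" "max \<epsilon> T = \<epsilon>" using T by auto
      have "boundary_count B \<epsilon> = ennreal A + 2 * ennreal (?N \<epsilon>)"
        unfolding B[OF e(1)] e(2) using A nn by (simp add: ennreal_mult')
      then show ?thesis using True by (simp only: indicator_simps(1) mult_1_right distrib_left ac_simps)
    qed simp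
  qed
  also have "\<dots> = ennreal A * (\<integral>\<^sup>+\<epsilon>\<in>{T..1}. ennreal (\<epsilon> powr (\<delta> - 1)) \<partial>lborel) +
      2 * (\<integral>\<^sup>+\<epsilon>\<in>{T..1}. ennreal (\<epsilon> powr (\<delta> - 1)) * ennreal (?N \<epsilon>) \<partial>lborel)"
    by (subst nn_integral_add, measurable, subst nn_integral_cmult, measurable, subst nn_integral_cmult, measurable)
  also have "(\<integral>\<^sup>+\<epsilon>\<in>{T..1}. ennreal (\<epsilon> powr (\<delta> - 1)) \<partial>lborel) = ennreal ((1 - T powr \<delta>) / \<delta>)"
    using nn_integral_powr_Icc[of "\<delta> - 1" T 1] T \<delta>_pos by simp
  also have "(\<integral>\<^sup>+\<epsilon>\<in>{T..1}. ennreal (\<epsilon> powr (\<delta> - 1)) * ennreal (?N \<epsilon>) \<partial>lborel) =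
      (\<integral>\<^sup>+\<epsilon>\<in>{T..1}. ennreal (\<epsilon> powr (\<delta> - 1)) * ennreal (gap_count (\<epsilon> / \<rho>)) \<partial>lborel)"
    by (rule nn_integral_cong) (simp only: mult.assoc eqN)
  also have "\<dots> = ennreal (\<rho> powr \<delta> * (gap_moment (T / \<rho>) - gap_moment (1 / \<rho>)))"
    by (rule gap_count_integral[OF T \<rho>])
  also have "ennreal A * ennreal ((1 - T powr \<delta>) / \<delta>) +
      2 * ennreal (\<rho> powr \<delta> * (gap_moment (T / \<rho>) - gap_moment (1 / \<rho>))) =
      ennreal (A * ((1 - T powr \<delta>) / \<delta>) + 2 * (\<rho> powr \<delta> * (gap_moment (T / \<rho>) - gap_moment (1 / \<rho>))))"
  proof -
    have "T powr \<delta> \<le> 1" using T \<delta>_pos by (intro powr_le1) auto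
    then have 1: "0 \<le> A * ((1 - T powr \<delta>) / \<delta>)" using A \<delta>_pos by simp
    have "gap_moment (1 / \<rho>) \<le> gap_moment (T / \<rho>)"
      using T \<rho> by (intro gap_moment_antimono) (auto intro: divide_right_mono)
    then have 2: "0 \<le> 2 * (\<rho> powr \<delta> * (gap_moment (T / \<rho>) - gap_moment (1 / \<rho>)))" by simp
    show ?thesis
      unfolding ennreal_plus[OF 1 2] using A by (simp only: ennreal_mult' ennreal_numeral zero_le_numeral)
  qed
  finally show ?thesis .
qed

text \<open>The 2 in front of the moments cancels with the 2 of the normalisation. The contribution
  of A and the moment at 1 / \<rho> stay bounded and vanish on division by |ln T|.\<close>

lemma avg_curv0_tendsto:
  assumes \<rho>: "0 < \<rho>" and A: "0 \<le> A" and Bs: "B \<in> sets borel"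
    and B: "\<And>\<epsilon>. 0 < \<epsilon> \<Longrightarrow> boundary_count B \<epsilon> = ennreal (A + 2 * gap_count (\<epsilon> / \<rho>))"
  shows "((\<lambda>T. measure (avg_curv0 F T) B) \<longlongrightarrow> limit_const * \<rho> powr \<delta>) (at_right 0)"
proof -
  have ev: "\<forall>\<^sub>F T in at_right 0. A / (2 * \<delta>) * ((1 - T powr \<delta>) / \<bar>ln T\<bar>) +
      \<rho> powr \<delta> * (gap_moment (T / \<rho>) / \<bar>ln T\<bar> - gap_moment (1 / \<rho>) / \<bar>ln T\<bar>) = measure (avg_curv0 F T) B"
    using eventually_unit_interval
  proof eventually_elim
    case (elim T)
    then have T: "0 < T" "T \<le> 1" by auto
    have "T powr \<delta> \<le> 1" using T \<delta>_pos by (intro powr_le1) auto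
    then have 1: "0 \<le> A * ((1 - T powr \<delta>) / \<delta>)" using A \<delta>_pos by simp
    have "gap_moment (1 / \<rho>) \<le> gap_moment (T / \<rho>)"
      using T \<rho> by (intro gap_moment_antimono) (auto intro: divide_right_mono)
    then have 2: "0 \<le> 2 * (\<rho> powr \<delta> * (gap_moment (T / \<rho>) - gap_moment (1 / \<rho>)))" by simp
    have I: "(\<integral>\<^sup>+\<epsilon>\<in>{T..1}. ennreal (\<epsilon> powr (scaling_exponent0 F - 1)) * boundary_count B \<epsilon> \<partial>lborel) =
        ennreal (A * ((1 - T powr \<delta>) / \<delta>) + 2 * (\<rho> powr \<delta> * (gap_moment (T / \<rho>) - gap_moment (1 / \<rho>))))"
      unfolding scaling_exponent0_F by (rule boundary_count_integral[OF T \<rho> A B])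
    have "measure (avg_curv0 F T) B = (A * ((1 - T powr \<delta>) / \<delta>) +
        2 * (\<rho> powr \<delta> * (gap_moment (T / \<rho>) - gap_moment (1 / \<rho>)))) / (2 * \<bar>ln T\<bar>)"
      unfolding measure_def emeasure_avg_curv0[OF T(1) Bs] I using add_nonneg_nonneg[OF 1 2]
      by (simp add: enn2real_mult)
    also have "\<dots> = A / (2 * \<delta>) * ((1 - T powr \<delta>) / \<bar>ln T\<bar>) +
        \<rho> powr \<delta> * (gap_moment (T / \<rho>) / \<bar>ln T\<bar> - gap_moment (1 / \<rho>) / \<bar>ln T\<bar>)"
      using \<delta>_pos elim by (simp add: field_simps)
    finally show ?case by simp
  qed
  have "((\<lambda>T. A / (2 * \<delta>) * ((1 - T powr \<delta>) / \<bar>ln T\<bar>) +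
      \<rho> powr \<delta> * (gap_moment (T / \<rho>) / \<bar>ln T\<bar> - gap_moment (1 / \<rho>) / \<bar>ln T\<bar>)) \<longlongrightarrow>
      A / (2 * \<delta>) * 0 + \<rho> powr \<delta> * (limit_const - 0)) (at_right 0)"
    by (intro tendsto_add tendsto_mult tendsto_diff tendsto_const gap_moment_limit[OF \<rho>] const_over_abs_ln
        real_tendsto_divide_at_top[OF tendsto_diff[OF tendsto_const powr_at_right_0[OF \<delta>_pos]] filterlim_abs_ln])
  from Lim_transform_eventually[OF this ev] show ?thesis by (simp add: mult.commute)
qed

lemma boundary_count_cyl': "set w \<subseteq> {1..N} \<Longrightarrow> 0 < \<epsilon> \<Longrightarrow>
    boundary_count (cyl w) \<epsilon> = ennreal (0 + 2 * gap_count (\<epsilon> / word_ratio w))"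
  using boundary_count_cyl by (simp only: gap_count_def add_0)

lemma boundary_count_UNIV': "0 < \<epsilon> \<Longrightarrow> boundary_count UNIV \<epsilon> = ennreal (2 + 2 * gap_count (\<epsilon> / 1))"
  using boundary_count_UNIV by (simp only: gap_count_def div_by_1)

lemma avg_curv0_cyl:
  "set w \<subseteq> {1..N} \<Longrightarrow>
    ((\<lambda>T. measure (avg_curv0 F T) (cyl w)) \<longlongrightarrow> limit_const * word_ratio w powr \<delta>) (at_right 0)"
  by (rule avg_curv0_tendsto[OF word_ratio_pos order_refl cyl_borel boundary_count_cyl'])

lemma avg_curv0_total: "((\<lambda>T. measure (avg_curv0 F T) UNIV) \<longlongrightarrow> limit_const) (at_right 0)"
  using avg_curv0_tendsto[of 1 2 UNIV, OF _ _ _ boundary_count_UNIV'] by simp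

lemma avg_integral0_finite:
  assumes "0 < T" "T \<le> 1"
  shows "(\<integral>\<^sup>+\<epsilon>\<in>{T..1}. ennreal (\<epsilon> powr (\<delta> - 1)) * boundary_count B \<epsilon> \<partial>lborel) < \<infinity>"
proof -
  have "(\<integral>\<^sup>+\<epsilon>\<in>{T..1}. ennreal (\<epsilon> powr (\<delta> - 1)) * boundary_count B \<epsilon> \<partial>lborel) \<le>
      (\<integral>\<^sup>+\<epsilon>\<in>{T..1}. ennreal (\<epsilon> powr (\<delta> - 1)) * boundary_count UNIV \<epsilon> \<partial>lborel)"
    by (intro nn_integral_mono mult_right_mono mult_left_mono emeasure_mono) auto
  also have "\<dots> < \<infinity>"
    by (subst boundary_count_integral[OF assms zero_less_one _ boundary_count_UNIV']) simp_all
  finally show ?thesis .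
qed

lemma finite_avg_curv0:
  assumes "0 < T" "T \<le> 1" shows "finite_measure (avg_curv0 F T)"
proof (rule finite_measureI)
  have U: "UNIV \<in> sets (borel :: real measure)" by simp
  have "emeasure (avg_curv0 F T) UNIV < \<infinity>"
    unfolding emeasure_avg_curv0[OF assms(1) U] scaling_exponent0_F
    using avg_integral0_finite[OF assms, of UNIV] by (simp add: ennreal_mult_less_top del: emeasure_count_space)
  then show "emeasure (avg_curv0 F T) (space (avg_curv0 F T)) \<noteq> \<infinity>" by simp
qed

text \<open>This is \<open>surface_volume_identity\<close> divided by (1 - \<delta>) |ln T|; the
  factor 2 undoes the extra 1/2 in the average for k = 0. Passing to the reals requires finiteness
  of all terms, and for the volume integral this follows from the identity itself.\<close>

lemma avg_curv1_eq:
  assumes Bs: "B \<in> sets borel" and T: "0 < T" "T < 1"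
  shows "emeasure (avg_curv1 F T) B < \<infinity>"
    and "measure (avg_curv1 F T) B = 2 / (1 - \<delta>) * measure (avg_curv0 F T) B +
      (T powr (\<delta> - 1) * measure lborel (parallel_set F T \<inter> B) - measure lborel (parallel_set F 1 \<inter> B))
        / ((1 - \<delta>) * \<bar>ln T\<bar>)"
proof -
  let ?I0 = "\<integral>\<^sup>+\<epsilon>\<in>{T..1}. ennreal (\<epsilon> powr (\<delta> - 1)) * boundary_count B \<epsilon> \<partial>lborel"
  let ?I1 = "\<integral>\<^sup>+\<epsilon>\<in>{T..1}. ennreal (\<epsilon> powr (\<delta> - 2)) * emeasure lborel (parallel_set F \<epsilon> \<inter> B) \<partial>lborel"
  have d: "0 < 1 - \<delta>" using \<delta>_less_1 by simp
  have ln: "0 < \<bar>ln T\<bar>" using T by simp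
  obtain K where K: "0 < K"
    "\<And>\<epsilon>. 0 < \<epsilon> \<Longrightarrow> \<epsilon> \<le> 1 \<Longrightarrow> emeasure lborel (parallel_set F \<epsilon>) \<le> ennreal (K * \<epsilon> powr (1 - \<delta>))"
    by (rule volume_total_upper) blast
  have V: "emeasure lborel (parallel_set F \<epsilon> \<inter> B) = ennreal (measure lborel (parallel_set F \<epsilon> \<inter> B))"
    if \<epsilon>: "0 < \<epsilon>" "\<epsilon> \<le> 1" for \<epsilon>
  proof (rule emeasure_eq_ennreal_measure)
    have "emeasure lborel (parallel_set F \<epsilon> \<inter> B) \<le> emeasure lborel (parallel_set F \<epsilon>)"
      by (intro emeasure_mono) auto
    also have "\<dots> < top" using K(2)[OF \<epsilon>] by (rule le_less_trans) simp
    finally show "emeasure lborel (parallel_set F \<epsilon> \<inter> B) \<noteq> top" by simp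
  qed
  have id: "ennreal (1 - \<delta>) * ?I1 + emeasure lborel (parallel_set F 1 \<inter> B) =
      ?I0 + ennreal (T powr (\<delta> - 1)) * emeasure lborel (parallel_set F T \<inter> B)"
    by (rule surface_volume_identity[OF null_F Bs \<delta>_less_1 T(1)]) (use T in simp)
  have I0: "?I0 < \<infinity>" using avg_integral0_finite[of T B] T by simp
  then have "ennreal (1 - \<delta>) * ?I1 + emeasure lborel (parallel_set F 1 \<inter> B) < \<infinity>"
    unfolding id using T V[of T] by (simp add: ennreal_mult_less_top)
  then have I1: "?I1 < \<infinity>" using d by (auto simp: ennreal_mult_less_top)
  obtain i0 where i0: "?I0 = ennreal i0" "0 \<le> i0" using I0 by (cases ?I0) auto
  obtain i1 where i1: "?I1 = ennreal i1" "0 \<le> i1" using I1 by (cases ?I1) auto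
  let ?v1 = "measure lborel (parallel_set F 1 \<inter> B)" and ?vT = "measure lborel (parallel_set F T \<inter> B)"
  have "ennreal ((1 - \<delta>) * i1 + ?v1) = ennreal (i0 + T powr (\<delta> - 1) * ?vT)"
    using id d i0 i1 T V[of T] V[of 1] by (simp add: ennreal_mult' ennreal_plus)
  then have real: "(1 - \<delta>) * i1 + ?v1 = i0 + T powr (\<delta> - 1) * ?vT"
    using d i0 i1 by (subst (asm) ennreal_inj) auto
  have e1: "emeasure (avg_curv1 F T) B = ennreal (1 / \<bar>ln T\<bar>) * ?I1"
    unfolding emeasure_avg_curv1[OF Bs] scaling_exponent1_F by simp
  show "emeasure (avg_curv1 F T) B < \<infinity>" unfolding e1 using I1 by (simp add: ennreal_mult_less_top)
  have m1: "measure (avg_curv1 F T) B = i1 / \<bar>ln T\<bar>"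
    unfolding measure_def e1 i1(1) using i1(2) by (simp add: enn2real_mult)
  have m0: "measure (avg_curv0 F T) B = i0 / (2 * \<bar>ln T\<bar>)"
    unfolding measure_def emeasure_avg_curv0[OF T(1) Bs] scaling_exponent0_F i0(1)
    using i0(2) by (simp add: enn2real_mult)
  have "i1 = (i0 + (T powr (\<delta> - 1) * ?vT - ?v1)) / (1 - \<delta>)" using real d by (simp add: field_simps)
  then show "measure (avg_curv1 F T) B = 2 / (1 - \<delta>) * measure (avg_curv0 F T) B +
      (T powr (\<delta> - 1) * ?vT - ?v1) / ((1 - \<delta>) * \<bar>ln T\<bar>)"
    unfolding m0 m1 by (simp add: add_divide_distrib)
qed

text \<open>The boundary terms of the integration by parts are bounded, because V(T) is of order at
  most T^(1 - \<delta>), and disappear on division by |ln T|.\<close>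

lemma avg_curv1_tendsto:
  assumes Bs: "B \<in> sets borel"
    and lim: "((\<lambda>T. measure (avg_curv0 F T) B) \<longlongrightarrow> l) (at_right 0)"
  shows "((\<lambda>T. measure (avg_curv1 F T) B) \<longlongrightarrow> 2 / (1 - \<delta>) * l) (at_right 0)"
proof -
  obtain K where K: "0 < K"
    "\<And>\<epsilon>. 0 < \<epsilon> \<Longrightarrow> \<epsilon> \<le> 1 \<Longrightarrow> emeasure lborel (parallel_set F \<epsilon>) \<le> ennreal (K * \<epsilon> powr (1 - \<delta>))"
    by (rule volume_total_upper) blast
  have v: "measure lborel (parallel_set F \<epsilon> \<inter> B) \<le> K * \<epsilon> powr (1 - \<delta>)" if \<epsilon>: "0 < \<epsilon>" "\<epsilon> \<le> 1" for \<epsilon>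
  proof -
    have "emeasure lborel (parallel_set F \<epsilon> \<inter> B) \<le> emeasure lborel (parallel_set F \<epsilon>)"
      by (intro emeasure_mono) auto
    also note K(2)[OF \<epsilon>]
    finally have "enn2real (emeasure lborel (parallel_set F \<epsilon> \<inter> B)) \<le> enn2real (ennreal (K * \<epsilon> powr (1 - \<delta>)))"
      by (intro enn2real_mono) auto
    then show ?thesis using K(1) by (simp add: measure_def)
  qed
  let ?e = "\<lambda>T. (T powr (\<delta> - 1) * measure lborel (parallel_set F T \<inter> B) - measure lborel (parallel_set F 1 \<inter> B))
    / ((1 - \<delta>) * \<bar>ln T\<bar>)"
  have "(?e \<longlongrightarrow> 0) (at_right 0)"
  proof (rule Lim_null_comparison[OF _ const_over_abs_ln[of "2 * K / (1 - \<delta>)"]])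
    show "\<forall>\<^sub>F T in at_right 0. norm (?e T) \<le> 2 * K / (1 - \<delta>) / \<bar>ln T\<bar>"
      using eventually_unit_interval
    proof eventually_elim
      case (elim T)
      have "T powr (\<delta> - 1) * measure lborel (parallel_set F T \<inter> B) \<le> T powr (\<delta> - 1) * (K * T powr (1 - \<delta>))"
        using v[of T] elim by (intro mult_left_mono) auto
      also have "\<dots> = K * T powr (\<delta> - 1 + (1 - \<delta>))" unfolding powr_add by simp
      also have "\<dots> = K" using elim by simp
      finally have 1: "T powr (\<delta> - 1) * measure lborel (parallel_set F T \<inter> B) \<le> K" .
      have 2: "measure lborel (parallel_set F 1 \<inter> B) \<le> K" using v[of 1] by simp
      have 3: "0 \<le> T powr (\<delta> - 1) * measure lborel (parallel_set F T \<inter> B)" "0 \<le> measure lborel (parallel_set F 1 \<inter> B)"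
        by simp_all
      have "\<bar>T powr (\<delta> - 1) * measure lborel (parallel_set F T \<inter> B) - measure lborel (parallel_set F 1 \<inter> B)\<bar> \<le> 2 * K"
        using 1 2 3 by (intro abs_leI) linarith+
      then have "norm (?e T) \<le> 2 * K / \<bar>(1 - \<delta>) * \<bar>ln T\<bar>\<bar>"
        unfolding real_norm_def abs_divide by (rule divide_right_mono) simp
      also have "\<bar>(1 - \<delta>) * \<bar>ln T\<bar>\<bar> = (1 - \<delta>) * \<bar>ln T\<bar>" using \<delta>_less_1 by (simp add: abs_mult)
      finally show ?case by simp
    qed
  qed
  with lim have "((\<lambda>T. 2 / (1 - \<delta>) * measure (avg_curv0 F T) B + ?e T) \<longlongrightarrow> 2 / (1 - \<delta>) * l + 0) (at_right 0)"
    by (intro tendsto_add tendsto_mult tendsto_const)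
  moreover have "\<forall>\<^sub>F T in at_right 0. 2 / (1 - \<delta>) * measure (avg_curv0 F T) B + ?e T = measure (avg_curv1 F T) B"
    using eventually_unit_interval by eventually_elim (simp add: avg_curv1_eq(2)[OF Bs])
  ultimately have "((\<lambda>T. measure (avg_curv1 F T) B) \<longlongrightarrow> 2 / (1 - \<delta>) * l + 0) (at_right 0)"
    by (rule Lim_transform_eventually)
  then show ?thesis by simp
qed

text \<open>Here the two sides need different reasons for null overlaps of cylinders: the measures
  \<open>M T\<close> vanish on Borel subsets of F, which contain the overlaps, while the limit
  measure is concentrated on F and uses \<open>emeasure_\<nu>_cyl_overlap\<close>.\<close>

lemma weak_limit_of_cylinders:
  assumes c: "0 \<le> c"
    and M: "\<forall>\<^sub>F T in at_right 0. finite_measure (M T) \<and> sets (M T) = sets borel"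
    and null: "\<forall>\<^sub>F T in at_right 0. \<forall>A. A \<in> sets borel \<longrightarrow> A \<subseteq> F \<longrightarrow> emeasure (M T) A = 0"
    and total: "((\<lambda>T. measure (M T) UNIV) \<longlongrightarrow> c) (at_right 0)"
    and cyl: "\<And>w. set w \<subseteq> {1..N} \<Longrightarrow> ((\<lambda>T. measure (M T) (cyl w)) \<longlongrightarrow> c * word_ratio w powr \<delta>) (at_right 0)"
  shows "weak_limit M (scale_measure (ennreal c) \<nu>) (at_right 0)"
proof -
  let ?\<nu> = "scale_measure (ennreal c) \<nu>"
  have W: "set w \<subseteq> {1..N}" "length w = n" if "w \<in> words n" for w n using that by (simp_all add: words_def)
  have m: "measure ?\<nu> A = c * measure \<nu> A" for A using c by simp
  have mU: "measure ?\<nu> UNIV = c" unfolding m using emeasure_\<nu>_UNIV by (simp add: measure_def)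
  have mc: "measure ?\<nu> (cyl w) = c * word_ratio w powr \<delta>" if "set w \<subseteq> {1..N}" for w
    unfolding m using emeasure_\<nu>_cyl[OF that] by (simp add: measure_def)
  show ?thesis
  proof (rule weak_limit_partitions[where I = words and S = cyl and J = "{lo..hi}"])
    show "finite_measure ?\<nu>"
      by (rule finite_measureI) (simp add: space_scale_measure emeasure_\<nu>_UNIV)
    show "\<forall>\<^sub>F T in at_right 0. \<forall>w\<in>words n. \<forall>v\<in>words n. w \<noteq> v \<longrightarrow> emeasure (M T) (cyl w \<inter> cyl v) = 0" for n
      using null
    proof eventually_elim
      case (elim T)
      show ?case
      proof (intro ballI impI)
        fix w v assume wv: "w \<in> words n" "v \<in> words n" "w \<noteq> v"
        have "cyl w \<inter> cyl v \<in> sets borel" using cyl_borel W(1)[OF wv(1)] W(1)[OF wv(2)] by blast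
        moreover have "cyl w \<inter> cyl v \<subseteq> F"
          using W[OF wv(1)] W[OF wv(2)] wv(3) by (intro cyl_overlap) simp_all
        ultimately show "emeasure (M T) (cyl w \<inter> cyl v) = 0" using elim by blast
      qed
    qed
    show "emeasure ?\<nu> (cyl w \<inter> cyl v) = 0" if "w \<in> words n" "v \<in> words n" "w \<noteq> v" for w v n
      using emeasure_\<nu>_cyl_overlap[of w v] W[OF that(1)] W[OF that(2)] that(3) by simp
    show "((\<lambda>T. measure (M T) (cyl w)) \<longlongrightarrow> measure ?\<nu> (cyl w)) (at_right 0)" if "w \<in> words n" for w n
      unfolding mc[OF W(1)[OF that]] by (rule cyl[OF W(1)[OF that]])
    show "((\<lambda>T. measure (M T) UNIV) \<longlongrightarrow> measure ?\<nu> UNIV) (at_right 0)" unfolding mU by (rule total)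
    show "(\<Sum>w\<in>words n. measure ?\<nu> (cyl w)) = measure ?\<nu> UNIV" for n
    proof -
      have "(\<Sum>w\<in>words n. measure ?\<nu> (cyl w)) = (\<Sum>w\<in>words n. c * word_ratio w powr \<delta>)"
        by (rule sum.cong[OF refl mc[OF W(1)]])
      also have "\<dots> = c" unfolding sum_distrib_left[symmetric] sum_word_ratio by simp
      finally show ?thesis unfolding mU .
    qed
    show "\<exists>n. \<forall>w\<in>words n. \<forall>x\<in>cyl w. \<forall>y\<in>cyl w. dist x y < e" if "0 < e" for e
      by (rule cyl_small[OF that])
  qed (use M finite_words cyl_borel W cyl_subset in auto)
qed

lemma prim_moment_pos: "0 < prim_moment"
  unfolding prim_moment_def
proof (rule sum_pos)
  fix C assume "C \<in> prim"
  then show "0 < (measure lborel C / 2) powr \<delta> / \<delta>" using gap_length_pos[OF prim_gap[of C]] \<delta>_pos by simp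
qed (use finite_prim prim_nonempty in auto)

lemma limit_const_pos: "0 < limit_const"
  using prim_moment_pos mean_log_pos by simp

lemma weak_limit_avg_curv0: "weak_limit (avg_curv0 F) (scale_measure (ennreal limit_const) \<nu>) (at_right 0)"
proof (rule weak_limit_of_cylinders[OF less_imp_le[OF limit_const_pos]])
  show "\<forall>\<^sub>F T in at_right 0. finite_measure (avg_curv0 F T) \<and> sets (avg_curv0 F T) = sets borel"
    using eventually_unit_interval by eventually_elim (simp add: finite_avg_curv0)
  show "\<forall>\<^sub>F T in at_right 0. \<forall>A. A \<in> sets borel \<longrightarrow> A \<subseteq> F \<longrightarrow> emeasure (avg_curv0 F T) A = 0"
    using eventually_unit_interval
  proof eventually_elim
    case (elim T)
    show ?case
    proof (intro allI impI)
      fix A assume A: "A \<in> sets borel" "A \<subseteq> F"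
      have "(\<integral>\<^sup>+\<epsilon>\<in>{T..1}. ennreal (\<epsilon> powr (scaling_exponent0 F - 1)) * boundary_count A \<epsilon> \<partial>lborel) =
          (\<integral>\<^sup>+\<epsilon>. 0 \<partial>(lborel :: real measure))"
      proof (rule nn_integral_cong)
        fix \<epsilon>
        show "ennreal (\<epsilon> powr (scaling_exponent0 F - 1)) * boundary_count A \<epsilon> * indicator {T..1} \<epsilon> = 0"
          using boundary_count_null[OF _ A(2), of \<epsilon>] elim
          by (cases "T \<le> \<epsilon>") (simp_all del: emeasure_count_space)
      qed
      then show "emeasure (avg_curv0 F T) A = 0" using emeasure_avg_curv0[OF _ A(1), of T] elim by simp
    qed
  qed
qed (rule avg_curv0_total avg_curv0_cyl; assumption)+

lemma weak_limit_avg_curv1: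
  "weak_limit (avg_curv1 F) (scale_measure (ennreal (2 / (1 - \<delta>) * limit_const)) \<nu>) (at_right 0)"
proof (rule weak_limit_of_cylinders)
  show "0 \<le> 2 / (1 - \<delta>) * limit_const"
    using less_imp_le[OF limit_const_pos] \<delta>_less_1 by (intro mult_nonneg_nonneg) auto
  show "\<forall>\<^sub>F T in at_right 0. finite_measure (avg_curv1 F T) \<and> sets (avg_curv1 F T) = sets borel"
    using eventually_unit_interval
  proof eventually_elim
    case (elim T)
    have "emeasure (avg_curv1 F T) UNIV < \<infinity>" using elim by (intro avg_curv1_eq(1)) auto
    then have "finite_measure (avg_curv1 F T)" by (intro finite_measureI) simp
    then show ?case by simp
  qed
  show "\<forall>\<^sub>F T in at_right 0. \<forall>A. A \<in> sets borel \<longrightarrow> A \<subseteq> F \<longrightarrow> emeasure (avg_curv1 F T) A = 0"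
  proof (intro always_eventually allI impI)
    fix T and A :: "real set" assume A: "A \<in> sets borel" "A \<subseteq> F"
    have "emeasure lborel (parallel_set F \<epsilon> \<inter> A) = 0" for \<epsilon>
    proof (rule emeasure_eq_0[OF _ null_F])
      show "F \<in> sets lborel" using F_borel by simp
      show "parallel_set F \<epsilon> \<inter> A \<subseteq> F" using A(2) by (rule le_infI2)
    qed
    then show "emeasure (avg_curv1 F T) A = 0" using emeasure_avg_curv1[OF A(1)] by simp
  qed
  show "((\<lambda>T. measure (avg_curv1 F T) UNIV) \<longlongrightarrow> 2 / (1 - \<delta>) * limit_const) (at_right 0)"
    by (rule avg_curv1_tendsto[OF _ avg_curv0_total]) simp
  show "((\<lambda>T. measure (avg_curv1 F T) (cyl w)) \<longlongrightarrow> 2 / (1 - \<delta>) * limit_const * word_ratio w powr \<delta>) (at_right 0)"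
    if "set w \<subseteq> {1..N}" for w
    unfolding mult.assoc by (rule avg_curv1_tendsto[OF cyl_borel[OF that] avg_curv0_cyl[OF that]])
qed

lemma limit_const_formula:
  "limit_const = 2 powr (- \<delta>) * (\<Sum>L\<in>primary_gaps N \<phi> F. measure lborel L powr \<delta>)
     / (- \<delta> * (\<Sum>i\<in>{1..N}. ln (r i) * r i powr \<delta>))"
  "2 / (1 - \<delta>) * limit_const = 2 powr (1 - \<delta>) * (\<Sum>L\<in>primary_gaps N \<phi> F. measure lborel L powr \<delta>)
     / ((\<delta> - 1) * \<delta> * (\<Sum>i\<in>{1..N}. ln (r i) * r i powr \<delta>))"
proof -
  let ?L = "\<Sum>L\<in>primary_gaps N \<phi> F. measure lborel L powr \<delta>"
  have P: "prim_moment = 2 powr (- \<delta>) * ?L / \<delta>"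
    unfolding prim_moment_def primary_gaps_eq sum_distrib_left sum_divide_distrib
    by (rule sum.cong[OF refl]) (simp add: powr_divide powr_minus divide_simps)
  have S: "mean_log = - (\<Sum>i\<in>{1..N}. ln (r i) * r i powr \<delta>)"
    unfolding mean_log_def sum_negf[symmetric] by (rule sum.cong[OF refl]) simp
  show 1: "limit_const = 2 powr (- \<delta>) * ?L / (- \<delta> * (\<Sum>i\<in>{1..N}. ln (r i) * r i powr \<delta>))"
    unfolding P S by simp
  have "2 powr (1 - \<delta>) = 2 * 2 powr - \<delta>" by (simp add: powr_diff powr_minus divide_simps)
  moreover have "(\<delta> - 1) * \<delta> * S' = (1 - \<delta>) * (- \<delta> * S')" for S' by (simp add: algebra_simps)
  ultimately show "2 / (1 - \<delta>) * limit_const = 2 powr (1 - \<delta>) * ?L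
     / ((\<delta> - 1) * \<delta> * (\<Sum>i\<in>{1..N}. ln (r i) * r i powr \<delta>))"
    unfolding 1 by simp
qed

end

section \<open>The lattice case\<close>

lemma lattice_ifs_log_ratios:
  assumes lat: "lattice_ifs N r" and r: "\<And>i. i \<in> {1..N} \<Longrightarrow> 0 < r i \<and> r i < 1" and N: "1 \<le> N"
  obtains h where "0 < h" "\<And>i. i \<in> {1..N} \<Longrightarrow> \<exists>k::int. ln (r i) = h * of_int k"
proof -
  obtain \<zeta> \<psi> G where eq: "\<forall>\<omega>\<in>infinite_words N. geometric_potential r \<omega> - \<zeta> \<omega> = \<psi> \<omega> - \<psi> (left_shift \<omega>)"
    and G: "discrete_subgroup G" "\<zeta> ` infinite_words N \<subseteq> G"
    using lat unfolding lattice_ifs_def lattice_potential_def by blast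
  \<comment> \<open>Constant words are fixed by the shift, so the coboundary vanishes on them.\<close>
  have inG: "- ln (r i) \<in> G" if i: "i \<in> {1..N}" for i
  proof -
    have w: "(\<lambda>_. i) \<in> infinite_words N" using i by (simp add: infinite_words_def)
    have "geometric_potential r (\<lambda>_. i) - \<zeta> (\<lambda>_. i) = 0"
      using bspec[OF eq w] by (simp add: left_shift_def)
    then have "\<zeta> (\<lambda>_. i) = - ln (r i)" by (simp add: geometric_potential_def)
    moreover have "\<zeta> (\<lambda>_. i) \<in> G" using G(2) w by blast
    ultimately show ?thesis by simp
  qed
  have 1: "1 \<in> {1..N}" using N by simp
  have "0 < - ln (r 1)" using r[OF 1] by simp
  then obtain h where h: "0 < h" "\<And>x. x \<in> G \<Longrightarrow> \<exists>k::int. x = h * of_int k"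
    using discrete_subgroup_cyclic[OF G(1) inG[OF 1]] by blast
  have "\<exists>k::int. ln (r i) = h * of_int k" if i: "i \<in> {1..N}" for i
  proof -
    obtain k :: int where "- ln (r i) = h * of_int k" using h(2)[OF inG[OF i]] by blast
    then have "ln (r i) = h * of_int (- k)" by simp
    then show ?thesis by blast
  qed
  then show thesis using that h(1) by blast
qed

context interval_ifs
begin

lemma word_image_compact: "set w \<subseteq> {1..N} \<Longrightarrow> compact (word_map \<phi> w ` F)"
proof (induction w)
  case Nil
  then show ?case using compact_F by simp
next
  case (Cons i w)
  then have i: "i \<in> {1..N}" and w: "set w \<subseteq> {1..N}" by simp_all
  obtain k s where ks: "\<And>x. x \<in> X \<Longrightarrow> \<phi> i x = k + s * x" using affine[OF i] by blast
  have "word_map \<phi> w ` F \<subseteq> X" using word_map_F[OF w] F_X by blast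
  then have "\<phi> i ` word_map \<phi> w ` F = (\<lambda>x. k + s * x) ` word_map \<phi> w ` F" using ks by (intro image_cong) auto
  also have "compact \<dots>" by (rule compact_continuous_image[OF _ Cons.IH[OF w]]) (intro continuous_intros)
  finally show ?case by (simp add: image_comp)
qed

text \<open>A point of F in the cylinder has a preimage in F by \<open>F_Int_piece\<close> and one
  in the shorter cylinder; injectivity on X identifies them.\<close>

lemma F_Int_cyl: "set w \<subseteq> {1..N} \<Longrightarrow> F \<inter> cyl w \<subseteq> word_map \<phi> w ` F"
proof (induction w)
  case Nil
  then show ?case by simp
next
  case (Cons i w)
  then have i: "i \<in> {1..N}" and w: "set w \<subseteq> {1..N}" by simp_all
  show ?case
  proof
    fix z assume z: "z \<in> F \<inter> cyl (i # w)"
    then obtain y where y: "y \<in> cyl w" "z = \<phi> i y" by (auto simp: cyl_simps)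
    have "z \<in> F \<inter> piece i" using z y cyl_subset[OF w] by blast
    then obtain x where x: "x \<in> F" "z = \<phi> i x" unfolding F_Int_piece[OF i] by blast
    have "x \<in> X" "y \<in> X" using x(1) y(1) F_X cyl_X[OF w] by blast+
    then have "x = y" using inj_onD[OF inj_map[OF i]] x(2) y(2) by metis
    then have "x \<in> word_map \<phi> w ` F" using Cons.IH[OF w] x(1) y(1) by blast
    then show "z \<in> word_map \<phi> (i # w) ` F" using x(2) by auto
  qed
qed

text \<open>Every map changes the logarithm of a gap length by a multiple of h, so modulo h only the
  values of the finitely many primary gaps occur.\<close>

lemma gap_log_length:
  assumes h: "\<And>i. i \<in> {1..N} \<Longrightarrow> \<exists>k::int. ln (r i) = h * of_int k" and C: "C \<in> gaps F"
  shows "\<exists>L\<in>prim. \<exists>k::int. ln (measure lborel C / 2) = ln (measure lborel L / 2) + h * of_int k"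
  using C
proof (induction rule: gap_induct)
  case (prim C)
  then show ?case by (intro bexI[of _ C] exI[of _ 0]) auto
next
  case (image i C)
  obtain L k where L: "L \<in> prim" "ln (measure lborel C / 2) = ln (measure lborel L / 2) + h * of_int (k::int)"
    using image.IH by blast
  obtain m :: int where m: "ln (r i) = h * of_int m" using h[OF image.hyps(1)] by blast
  have "ln (measure lborel (\<phi> i ` C) / 2) = ln (r i * (measure lborel C / 2))"
    using gap_image(2)[OF image.hyps(1,2)] by simp
  also have "\<dots> = ln (r i) + ln (measure lborel C / 2)"
    using ratio(1)[OF image.hyps(1)] gap_length_pos[OF image.hyps(2)] by (intro ln_mult_pos) auto
  also have "\<dots> = ln (measure lborel L / 2) + h * of_int (k + m)"
    unfolding L(2) m by (simp add: distrib_left)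
  finally show ?case using L(1) by blast
qed

text \<open>D collects the residues in [0, h) of the logarithms of the primary half-lengths. The arc
  from the largest residue to the smallest one shifted by h contains no residue, so it is an open
  window missed by all gaps at every scale; the summand h * n moves the logarithms into it. Any two
  residues differ by less than h, so the window is nonempty.\<close>

lemma lattice_window:
  assumes h: "0 < h" "\<And>i. i \<in> {1..N} \<Longrightarrow> \<exists>k::int. ln (r i) = h * of_int k"
  obtains \<alpha> \<beta> where "\<alpha> < \<beta>"
    "\<And>C n. C \<in> gaps F \<Longrightarrow> \<not> (\<alpha> < ln (measure lborel C / 2) + h * real n \<and> ln (measure lborel C / 2) + h * real n < \<beta>)"
proof -
  define frac where "frac = (\<lambda>x. x - h * of_int \<lfloor>x / h\<rfloor>)"
  have frac: "0 \<le> frac x" "frac x < h" for x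
  proof -
    define k where "k = \<lfloor>x / h\<rfloor>"
    have "of_int k \<le> x / h" "x / h < of_int k + 1" by (simp_all add: k_def)
    then have "of_int k * h \<le> x" "x < of_int k * h + h"
      using h(1) by (simp_all add: pos_le_divide_eq pos_divide_less_eq distrib_right)
    then show "0 \<le> frac x" "frac x < h" by (simp_all add: frac_def mult.commute flip: k_def)
  qed
  define D where "D = (\<lambda>L. frac (ln (measure lborel L / 2))) ` prim"
  have D: "finite D" "D \<noteq> {}" using finite_prim prim_nonempty by (auto simp: D_def)
  have bounds: "0 \<le> x" "x < h" if "x \<in> D" for x using that frac by (auto simp: D_def)
  have "Max D < Min D + h"
    using bounds(2)[OF Max_in[OF D]] bounds(1)[OF Min_in[OF D]] by linarith
  moreover have "\<not> (Max D < ln (measure lborel C / 2) + h * real n \<and> ln (measure lborel C / 2) + h * real n < Min D + h)"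
    if C: "C \<in> gaps F" for C n
  proof -
    obtain L k where L: "L \<in> prim" "ln (measure lborel C / 2) = ln (measure lborel L / 2) + h * of_int (k::int)"
      using gap_log_length[OF h(2) C] by blast
    let ?x = "ln (measure lborel L / 2)"
    \<comment> \<open>The total number of periods separating the value from its residue: for m \<le>
      0 the value is at most \<open>Max D\<close>, for m \<ge> 1 at least
      \<open>Min D + h\<close>.\<close>
    define m :: int where "m = \<lfloor>?x / h\<rfloor> + k + int n"
    have eq: "ln (measure lborel C / 2) + h * real n = frac ?x + h * of_int m"
      unfolding L(2) frac_def m_def by (simp add: algebra_simps)
    have fD: "frac ?x \<in> D" using L(1) by (auto simp: D_def)
    have b: "Min D \<le> frac ?x" "frac ?x \<le> Max D" using D fD by auto
    show ?thesis
    proof (cases "m \<le> 0")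
      case True
      then have "h * of_int m \<le> 0" using h(1) by (simp add: mult_nonneg_nonpos)
      then show ?thesis unfolding eq using b by linarith
    next
      case False
      then have "h * 1 \<le> h * of_int m" using h(1) by (intro mult_left_mono) auto
      then show ?thesis unfolding eq using b by linarith
    qed
  qed
  ultimately show thesis by (rule that)
qed

end

text \<open>The set B of the second claim, with a concrete radius \<open>\<epsilon>0\<close> in
  place of "for all sufficiently small \<epsilon>". The words in W may have different
  lengths.\<close>

locale cylinder_union = conformal_ifs +
  fixes B :: "real set" and W :: "nat list set" and \<epsilon>0 :: real
  assumes B_borel: "B \<in> sets borel" and B_nonempty: "F \<inter> B \<noteq> {}"
    and W: "finite W" "W \<subseteq> lists {1..N}" "F \<inter> B = (\<Union>w\<in>W. word_map \<phi> w ` F)"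
    and \<epsilon>0_pos: "0 < \<epsilon>0"
    and parallel_local: "0 < \<epsilon> \<Longrightarrow> \<epsilon> < \<epsilon>0 \<Longrightarrow> parallel_set F \<epsilon> \<inter> B = parallel_set (F \<inter> B) \<epsilon>"
begin

lemma compact_FB: "compact (F \<inter> B)"
  unfolding W(3) using W(1,2) word_image_compact by (intro compact_UN) (auto simp: lists_eq_set)

text \<open>Locality in usable form: a point with only one point p of F within distance \<epsilon>
  belongs to B exactly if p does. Boundary points inside a long gap are of this kind, p being the
  nearer end of the gap.\<close>

lemma in_B_iff:
  assumes \<epsilon>: "0 < \<epsilon>" "\<epsilon> < \<epsilon>0" and p: "p \<in> F" "dist q p \<le> \<epsilon>"
    and unique: "\<And>z. z \<in> F \<Longrightarrow> dist q z \<le> \<epsilon> \<Longrightarrow> z = p"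
  shows "q \<in> B \<longleftrightarrow> p \<in> B"
proof
  assume "p \<in> B"
  then have "infdist q (F \<inter> B) \<le> \<epsilon>" using p by (intro infdist_le2[of p]) auto
  then have "q \<in> parallel_set (F \<inter> B) \<epsilon>" by (simp add: parallel_set_def)
  then show "q \<in> B" using parallel_local[OF \<epsilon>] by blast
next
  assume "q \<in> B"
  moreover have "q \<in> parallel_set F \<epsilon>" using p by (auto simp: parallel_set_def intro: infdist_le2)
  ultimately have "infdist q (F \<inter> B) \<le> \<epsilon>" using parallel_local[OF \<epsilon>] by (auto simp: parallel_set_def)
  moreover obtain z where "z \<in> F \<inter> B" "infdist q (F \<inter> B) = dist q z"
    using infdist_attains_inf[OF compact_imp_closed[OF compact_FB] B_nonempty] by blast
  ultimately show "p \<in> B" using unique[of z] by auto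
qed

text \<open>The moving boundary points are replaced by the fixed gap ends nearest to them. In this
  form the count depends on \<epsilon> only through the set of long gaps and is constant whenever
  that set is.\<close>

definition count_B :: "real \<Rightarrow> real" where
  "count_B \<epsilon> = indicator B lo + indicator B hi +
    (\<Sum>C\<in>long_gaps (2 * \<epsilon>). indicator B (Inf C) + indicator B (Sup C))"

lemma count_B_nonneg: "0 \<le> count_B \<epsilon>"
  unfolding count_B_def by (intro add_nonneg_nonneg sum_nonneg) auto

lemma boundary_count_B:
  assumes \<epsilon>: "0 < \<epsilon>" "\<epsilon> < \<epsilon>0"
  shows "boundary_count B \<epsilon> = ennreal (count_B \<epsilon>)"
proof -
  have "z = lo" if "z \<in> F" "dist (lo - \<epsilon>) z \<le> \<epsilon>" for z
    using subsetD[OF F_subset that(1)] that(2) by (auto simp: dist_real_def abs_le_iff)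
  then have end_lo: "lo - \<epsilon> \<in> B \<longleftrightarrow> lo \<in> B"
    using lo_in \<epsilon> by (intro in_B_iff) (auto simp: dist_real_def)
  have "z = hi" if "z \<in> F" "dist (hi + \<epsilon>) z \<le> \<epsilon>" for z
    using subsetD[OF F_subset that(1)] that(2) by (auto simp: dist_real_def abs_le_iff)
  then have end_hi: "hi + \<epsilon> \<in> B \<longleftrightarrow> hi \<in> B"
    using hi_in \<epsilon> by (intro in_B_iff) (auto simp: dist_real_def)
  have gap: "Inf C + \<epsilon> \<in> B \<longleftrightarrow> Inf C \<in> B" "Sup C - \<epsilon> \<in> B \<longleftrightarrow> Sup C \<in> B" if C: "C \<in> long_gaps (2 * \<epsilon>)" for C
  proof -
    have CF: "C \<in> gaps F" and l: "2 * \<epsilon> < measure lborel C" using C by (simp_all add: long_gaps_def)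
    from CF obtain u v where uv: "C = {u<..<v}" "u < v" "u \<in> F" "v \<in> F" "{u<..<v} \<inter> F = {}"
      "measure lborel C = v - u" "Inf C = u" "Sup C = v" by (rule gapE)
    have out: "z \<le> u \<or> v \<le> z" if "z \<in> F" for z
      using that uv(5) by (meson disjoint_iff greaterThanLessThan_iff not_le)
    have "z = u" if "z \<in> F" "dist (u + \<epsilon>) z \<le> \<epsilon>" for z
      using out[OF that(1)] that(2) l uv(6) by (auto simp: dist_real_def abs_le_iff)
    then have "u + \<epsilon> \<in> B \<longleftrightarrow> u \<in> B"
      using uv(3) \<epsilon> by (intro in_B_iff) (auto simp: dist_real_def)
    then show "Inf C + \<epsilon> \<in> B \<longleftrightarrow> Inf C \<in> B" unfolding uv(7) .
    have "z = v" if "z \<in> F" "dist (v - \<epsilon>) z \<le> \<epsilon>" for z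
      using out[OF that(1)] that(2) l uv(6) by (auto simp: dist_real_def abs_le_iff)
    then have "v - \<epsilon> \<in> B \<longleftrightarrow> v \<in> B"
      using uv(4) \<epsilon> by (intro in_B_iff) (auto simp: dist_real_def)
    then show "Sup C - \<epsilon> \<in> B \<longleftrightarrow> Sup C \<in> B" unfolding uv(8) .
  qed
  have ind: "indicator B x = ennreal (indicator B y)" if "x \<in> B \<longleftrightarrow> y \<in> B" for x y
    using that by (simp add: indicator_def)
  have "(\<Sum>C\<in>long_gaps (2 * \<epsilon>). indicator B (Inf C + \<epsilon>) + indicator B (Sup C - \<epsilon>)) =
      (\<Sum>C\<in>long_gaps (2 * \<epsilon>). ennreal (indicator B (Inf C) + indicator B (Sup C)))"
  proof (rule sum.cong[OF refl])
    fix C assume C: "C \<in> long_gaps (2 * \<epsilon>)"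
    have "indicator B (Inf C + \<epsilon>) + indicator B (Sup C - \<epsilon>) = ennreal (indicator B (Inf C)) + ennreal (indicator B (Sup C))"
      by (intro arg_cong2[where f = "(+)"] ind gap C)
    also have "\<dots> = ennreal (indicator B (Inf C) + indicator B (Sup C))" by (rule ennreal_plus[symmetric]) simp_all
    finally show "indicator B (Inf C + \<epsilon>) + indicator B (Sup C - \<epsilon>) = ennreal (indicator B (Inf C) + indicator B (Sup C))" .
  qed
  also have "\<dots> = ennreal (\<Sum>C\<in>long_gaps (2 * \<epsilon>). indicator B (Inf C) + indicator B (Sup C))"
    by (rule sum_ennreal) simp
  finally show ?thesis
    unfolding boundary_count_formula[OF \<epsilon>(1)] count_B_def ind[OF end_lo] ind[OF end_hi]
    by (simp add: ennreal_plus sum_nonneg)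
qed

text \<open>From above the total count suffices. From below a single cylinder of B does: its
  boundary points have their nearest points of F in the same cylinder, hence in B, and so lie in B
  by locality.\<close>

lemma count_B_bounds:
  obtains c C \<epsilon>1 where "0 < c" "0 < C" "0 < \<epsilon>1" "\<epsilon>1 < \<epsilon>0"
    "\<And>\<epsilon>. 0 < \<epsilon> \<Longrightarrow> \<epsilon> \<le> \<epsilon>1 \<Longrightarrow> c * \<epsilon> powr - \<delta> \<le> count_B \<epsilon>"
    "\<And>\<epsilon>. 0 < \<epsilon> \<Longrightarrow> \<epsilon> \<le> \<epsilon>1 \<Longrightarrow> count_B \<epsilon> \<le> C * \<epsilon> powr - \<delta>"
proof -
  obtain c' C \<epsilon>' where b: "0 < c'" "0 < C" "0 < \<epsilon>'" "\<epsilon>' \<le> 1"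
    "\<And>\<epsilon>. 0 < \<epsilon> \<Longrightarrow> \<epsilon> \<le> \<epsilon>' \<Longrightarrow> ennreal (c' * \<epsilon> powr - \<delta>) \<le> boundary_count UNIV \<epsilon>"
    "\<And>\<epsilon>. 0 < \<epsilon> \<Longrightarrow> \<epsilon> \<le> 1 \<Longrightarrow> boundary_count UNIV \<epsilon> \<le> ennreal (C * \<epsilon> powr - \<delta>)"
    by (rule boundary_count_total_bounds) blast
  obtain c \<epsilon>1 where c: "0 < c" "0 < \<epsilon>1" "\<And>\<epsilon>. 0 < \<epsilon> \<Longrightarrow> \<epsilon> \<le> \<epsilon>1 \<Longrightarrow> c * \<epsilon> powr - \<delta> \<le> gap_count \<epsilon>"
    using gap_count_lower by blast
  obtain w where w: "w \<in> W" using B_nonempty W(3) by blast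
  then have ws: "set w \<subseteq> {1..N}" using W(2) by (auto simp: lists_eq_set)
  let ?\<rho> = "word_ratio w"
  have \<rho>: "0 < ?\<rho>" by (rule word_ratio_pos[OF ws])
  have local: "frontier (parallel_set F \<epsilon>) \<inter> cyl w \<subseteq> frontier (parallel_set F \<epsilon>) \<inter> B" if \<epsilon>: "0 < \<epsilon>" "\<epsilon> < \<epsilon>0" for \<epsilon>
  proof
    fix q assume q: "q \<in> frontier (parallel_set F \<epsilon>) \<inter> cyl w"
    then have d: "infdist q F = \<epsilon>" using frontier_infdist by blast
    obtain z where z: "z \<in> F" "infdist q F = dist q z"
      using infdist_attains_inf[OF closed_F F_nonempty] by blast
    obtain a b where ab: "a \<in> word_map \<phi> w ` F" "b \<in> word_map \<phi> w ` F" "cyl w = {a..b}"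
      using cyl_interval[OF ws] by blast
    have abF: "a \<in> F" "b \<in> F" using ab(1,2) word_map_F[OF ws] by auto
    \<comment> \<open>The ends a and b of the cylinder are themselves points of F, so the nearest
      point z cannot lie beyond them.\<close>
    have "dist q z \<le> dist q a" "dist q z \<le> dist q b" using infdist_le[OF abF(1)] infdist_le[OF abF(2)] z(2) by metis+
    then have "z \<in> cyl w" using q unfolding ab(3) by (auto simp: dist_real_def)
    then have "z \<in> F \<inter> B" using F_Int_cyl[OF ws] z(1) w W(3) by blast
    then have "infdist q (F \<inter> B) \<le> \<epsilon>" using z(2) d by (intro infdist_le2[of z]) auto
    then have "q \<in> parallel_set (F \<inter> B) \<epsilon>" by (simp add: parallel_set_def)
    then show "q \<in> frontier (parallel_set F \<epsilon>) \<inter> B" using parallel_local[OF \<epsilon>] q by blast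
  qed
  \<comment> \<open>Three constraints: the upper bound holds up to 1, locality needs radii strictly
    below \<open>\<epsilon>0\<close>, and the lower bound is applied at the radius \<epsilon>
    divided by the word ratio.\<close>
  define \<epsilon>2 where "\<epsilon>2 = min (min 1 (\<epsilon>0 / 2)) (\<epsilon>1 * ?\<rho>)"
  have \<epsilon>2: "0 < \<epsilon>2" "\<epsilon>2 < \<epsilon>0" "\<epsilon>2 \<le> 1" "\<epsilon>2 \<le> \<epsilon>1 * ?\<rho>"
    using \<epsilon>0_pos c(2) \<rho> by (auto simp: \<epsilon>2_def)
  show thesis
  proof (rule that[of "2 * c * ?\<rho> powr \<delta>" C \<epsilon>2])
    fix \<epsilon> assume \<epsilon>: "0 < \<epsilon>" "\<epsilon> \<le> \<epsilon>2"
    have "c * (\<epsilon> / ?\<rho>) powr - \<delta> \<le> gap_count (\<epsilon> / ?\<rho>)"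
    proof (rule c(3))
      show "0 < \<epsilon> / ?\<rho>" using \<epsilon>(1) \<rho> by simp
      have "\<epsilon> \<le> \<epsilon>1 * ?\<rho>" using \<epsilon>(2) \<epsilon>2(4) by simp
      then show "\<epsilon> / ?\<rho> \<le> \<epsilon>1" using \<rho> by (simp add: pos_divide_le_eq)
    qed
    moreover have "(\<epsilon> / ?\<rho>) powr - \<delta> = ?\<rho> powr \<delta> * \<epsilon> powr - \<delta>"
      using \<epsilon>(1) \<rho> powr_divide[of \<epsilon> ?\<rho> "- \<delta>"] by (simp add: powr_minus_divide)
    then have "2 * c * ?\<rho> powr \<delta> * \<epsilon> powr - \<delta> = 2 * (c * (\<epsilon> / ?\<rho>) powr - \<delta>)"
      by (simp only: mult.assoc)
    ultimately have 1: "2 * c * ?\<rho> powr \<delta> * \<epsilon> powr - \<delta> \<le> 0 + 2 * gap_count (\<epsilon> / ?\<rho>)" by linarith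
    have "boundary_count (cyl w) \<epsilon> \<le> boundary_count B \<epsilon>"
      by (rule emeasure_mono[OF local]) (use \<epsilon> \<epsilon>2 in auto)
    then have "ennreal (0 + 2 * gap_count (\<epsilon> / ?\<rho>)) \<le> ennreal (count_B \<epsilon>)"
      using boundary_count_cyl'[OF ws \<epsilon>(1)] boundary_count_B[of \<epsilon>] \<epsilon> \<epsilon>2 by (simp del: emeasure_count_space)
    then have "0 + 2 * gap_count (\<epsilon> / ?\<rho>) \<le> count_B \<epsilon>"
      by (subst (asm) ennreal_le_iff[OF count_B_nonneg])
    then show "2 * c * ?\<rho> powr \<delta> * \<epsilon> powr - \<delta> \<le> count_B \<epsilon>" using 1 by linarith
  next
    fix \<epsilon> assume \<epsilon>: "0 < \<epsilon>" "\<epsilon> \<le> \<epsilon>2"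
    have "ennreal (count_B \<epsilon>) = boundary_count B \<epsilon>" using boundary_count_B[of \<epsilon>] \<epsilon> \<epsilon>2 by (simp del: emeasure_count_space)
    also have "\<dots> \<le> boundary_count UNIV \<epsilon>" by (rule emeasure_mono) auto
    also have "\<dots> \<le> ennreal (C * \<epsilon> powr - \<delta>)" using \<epsilon> \<epsilon>2 by (intro b(6)) auto
    finally show "count_B \<epsilon> \<le> C * \<epsilon> powr - \<delta>"
      by (subst (asm) ennreal_le_iff) (use b(2) in auto)
  qed (use c(1) \<rho> b(2) \<epsilon>2 in auto)
qed

text \<open>The volume is the integral of the count, hence affine where the count is constant.
  Finiteness is assumed so that \<open>measure\<close> reflects \<open>emeasure\<close>.\<close>

lemma volume_B_increment:
  assumes ab: "0 < a" "a \<le> b" "b < \<epsilon>0" and const: "\<And>s. a \<le> s \<Longrightarrow> s \<le> b \<Longrightarrow> count_B s = k"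
    and fin: "emeasure lborel (parallel_set F b \<inter> B) < \<infinity>"
  shows "measure lborel (parallel_set F b \<inter> B) = measure lborel (parallel_set F a \<inter> B) + k * (b - a)"
proof -
  obtain n where [measurable]: "n \<in> borel_measurable borel" and n: "\<And>\<epsilon>. 0 < \<epsilon> \<Longrightarrow> boundary_count B \<epsilon> = n \<epsilon>"
    "\<And>\<epsilon>. 0 < \<epsilon> \<Longrightarrow> emeasure lborel F = 0 \<Longrightarrow>
       emeasure lborel (parallel_set F \<epsilon> \<inter> B) = (\<integral>\<^sup>+s\<in>{0<..\<epsilon>}. n s \<partial>lborel)"
    using boundary_count_measurable[OF B_borel] by blast
  have k: "0 \<le> k" using const[of a] count_B_nonneg[of a] ab by simp
  have nk: "n s = ennreal k" if "a < s" "s \<le> b" for s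
    using n(1)[of s] boundary_count_B[of s] const[of s] that ab by (simp del: emeasure_count_space)
  have "emeasure lborel (parallel_set F b \<inter> B) = (\<integral>\<^sup>+s. n s * indicator {0<..a} s + ennreal k * indicator {a<..b} s \<partial>lborel)"
    unfolding n(2)[OF less_le_trans[OF ab(1,2)] null_F]
    using ab nk by (intro nn_integral_cong) (auto split: split_indicator)
  also have "\<dots> = (\<integral>\<^sup>+s\<in>{0<..a}. n s \<partial>lborel) + ennreal k * emeasure lborel {a<..b}"
    by (subst nn_integral_add) (simp_all add: nn_integral_cmult_indicator)
  also have "\<dots> = emeasure lborel (parallel_set F a \<inter> B) + ennreal (k * (b - a))"
    unfolding n(2)[OF ab(1) null_F] using ab k by (simp add: ennreal_mult')
  finally have eq: "emeasure lborel (parallel_set F b \<inter> B) = emeasure lborel (parallel_set F a \<inter> B) + ennreal (k * (b - a))" .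
  have "emeasure lborel (parallel_set F a \<inter> B) < \<infinity>" using fin unfolding eq by (auto simp: less_top)
  then show ?thesis
    unfolding measure_def eq using k ab by (simp add: enn2real_plus)
qed

definition scaled_count :: "real \<Rightarrow> real" where
  "scaled_count \<epsilon> = \<epsilon> powr \<delta> * count_B \<epsilon> / 2"

definition scaled_volume :: "real \<Rightarrow> real" where
  "scaled_volume \<epsilon> = \<epsilon> powr (\<delta> - 1) * measure lborel (parallel_set F \<epsilon> \<inter> B)"

text \<open>Translation of the four extended-real limits into upper and lower limits of real
  functions with common positive bounds, the setting of \<open>Liminf_less_Limsup\<close>.\<close>

lemma curv_eq_scaled:
  obtains k K where "0 < k"
    "upper_curv0 F B = Limsup (at_right 0) (\<lambda>\<epsilon>. ennreal (scaled_count \<epsilon>))"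
    "lower_curv0 F B = Liminf (at_right 0) (\<lambda>\<epsilon>. ennreal (scaled_count \<epsilon>))"
    "upper_curv1 F B = Limsup (at_right 0) (\<lambda>\<epsilon>. ennreal (scaled_volume \<epsilon>))"
    "lower_curv1 F B = Liminf (at_right 0) (\<lambda>\<epsilon>. ennreal (scaled_volume \<epsilon>))"
    "\<forall>\<^sub>F \<epsilon> in at_right 0. k \<le> scaled_count \<epsilon>" "\<forall>\<^sub>F \<epsilon> in at_right 0. scaled_count \<epsilon> \<le> K"
    "\<forall>\<^sub>F \<epsilon> in at_right 0. k \<le> scaled_volume \<epsilon>" "\<forall>\<^sub>F \<epsilon> in at_right 0. scaled_volume \<epsilon> \<le> K"
    "\<forall>\<^sub>F \<epsilon> in at_right 0. emeasure lborel (parallel_set F \<epsilon> \<inter> B) < \<infinity>"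
proof -
  obtain c C \<epsilon>1 where b: "0 < c" "0 < C" "0 < \<epsilon>1" "\<epsilon>1 < \<epsilon>0"
    "\<And>\<epsilon>. 0 < \<epsilon> \<Longrightarrow> \<epsilon> \<le> \<epsilon>1 \<Longrightarrow> c * \<epsilon> powr - \<delta> \<le> count_B \<epsilon>"
    "\<And>\<epsilon>. 0 < \<epsilon> \<Longrightarrow> \<epsilon> \<le> \<epsilon>1 \<Longrightarrow> count_B \<epsilon> \<le> C * \<epsilon> powr - \<delta>"
    by (rule count_B_bounds) blast
  have d: "0 < 1 - \<delta>" using \<delta>_less_1 by simp
  have ev: "\<forall>\<^sub>F \<epsilon> in at_right 0. 0 < \<epsilon> \<and> \<epsilon> \<le> \<epsilon>1" by (rule eventually_at_right_le[OF b(3)])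
  have Bc: "boundary_count B s = ennreal (count_B s)" if "0 < s" "s \<le> \<epsilon>1" for s
    using that b(4) by (intro boundary_count_B) auto
  have up: "emeasure lborel (parallel_set F \<epsilon> \<inter> B) \<le> ennreal (C / (1 - \<delta>) * \<epsilon> powr (1 - \<delta>))"
    if \<epsilon>: "0 < \<epsilon>" "\<epsilon> \<le> \<epsilon>1" for \<epsilon>
  proof (rule volume_bounds(1)[OF null_F B_borel \<delta>_less_1 \<epsilon>(1)])
    fix s assume s: "0 < s" "s \<le> \<epsilon>"
    then have s': "0 < s" "s \<le> \<epsilon>1" using \<epsilon> by auto
    show "boundary_count B s \<le> ennreal (C * s powr - \<delta>)" unfolding Bc[OF s'] by (rule ennreal_leI[OF b(6)[OF s']])
  qed (use b(2) in simp)
  have lw: "ennreal (c / (1 - \<delta>) * \<epsilon> powr (1 - \<delta>)) \<le> emeasure lborel (parallel_set F \<epsilon> \<inter> B)"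
    if \<epsilon>: "0 < \<epsilon>" "\<epsilon> \<le> \<epsilon>1" for \<epsilon>
  proof (rule volume_bounds(2)[OF null_F B_borel \<delta>_less_1 \<epsilon>(1)])
    fix s assume s: "0 < s" "s \<le> \<epsilon>"
    then have s': "0 < s" "s \<le> \<epsilon>1" using \<epsilon> by auto
    show "ennreal (c * s powr - \<delta>) \<le> boundary_count B s" unfolding Bc[OF s'] by (rule ennreal_leI[OF b(5)[OF s']])
  qed (use b(1) in simp)
  have fin: "emeasure lborel (parallel_set F \<epsilon> \<inter> B) = ennreal (measure lborel (parallel_set F \<epsilon> \<inter> B))"
    if \<epsilon>: "0 < \<epsilon>" "\<epsilon> \<le> \<epsilon>1" for \<epsilon>
    using le_less_trans[OF up[OF \<epsilon>] ennreal_less_top] by (intro emeasure_eq_ennreal_measure) simp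
  have c0: "ennreal (\<epsilon> powr scaling_exponent0 F) * boundary_count B \<epsilon> / 2 = ennreal (scaled_count \<epsilon>)"
    if \<epsilon>: "0 < \<epsilon>" "\<epsilon> \<le> \<epsilon>1" for \<epsilon>
  proof -
    have "ennreal (scaled_count \<epsilon>) = ennreal (\<epsilon> powr \<delta> * count_B \<epsilon>) / ennreal 2"
      unfolding scaled_count_def using count_B_nonneg[of \<epsilon>] by (intro divide_ennreal[symmetric]) auto
    then show ?thesis unfolding Bc[OF \<epsilon>] scaling_exponent0_F by (simp add: ennreal_mult')
  qed
  have c1: "ennreal (\<epsilon> powr scaling_exponent1 F) * emeasure lborel (parallel_set F \<epsilon> \<inter> B) = ennreal (scaled_volume \<epsilon>)"
    if \<epsilon>: "0 < \<epsilon>" "\<epsilon> \<le> \<epsilon>1" for \<epsilon>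
    unfolding fin[OF \<epsilon>] scaling_exponent1_F scaled_volume_def by (simp add: ennreal_mult')
  have pw: "\<epsilon> powr \<delta> * (x * \<epsilon> powr - \<delta>) = x" "\<epsilon> powr (\<delta> - 1) * (x * \<epsilon> powr (1 - \<delta>)) = x" if "0 < \<epsilon>" for \<epsilon> x
  proof -
    have "\<epsilon> powr \<delta> * \<epsilon> powr - \<delta> = 1" "\<epsilon> powr (\<delta> - 1) * \<epsilon> powr (1 - \<delta>) = 1"
      using that by (simp_all flip: powr_add)
    then show "\<epsilon> powr \<delta> * (x * \<epsilon> powr - \<delta>) = x" "\<epsilon> powr (\<delta> - 1) * (x * \<epsilon> powr (1 - \<delta>)) = x"
      by (simp_all add: mult.left_commute)
  qed
  have l0: "c / 2 \<le> scaled_count \<epsilon>" and u0: "scaled_count \<epsilon> \<le> C / 2" if \<epsilon>: "0 < \<epsilon>" "\<epsilon> \<le> \<epsilon>1" for \<epsilon>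
    using mult_left_mono[OF b(5)[OF \<epsilon>], of "\<epsilon> powr \<delta>"] mult_left_mono[OF b(6)[OF \<epsilon>], of "\<epsilon> powr \<delta>"]
    unfolding pw(1)[OF \<epsilon>(1)] scaled_count_def by simp_all
  have V: "c / (1 - \<delta>) * \<epsilon> powr (1 - \<delta>) \<le> measure lborel (parallel_set F \<epsilon> \<inter> B)"
    "measure lborel (parallel_set F \<epsilon> \<inter> B) \<le> C / (1 - \<delta>) * \<epsilon> powr (1 - \<delta>)" if \<epsilon>: "0 < \<epsilon>" "\<epsilon> \<le> \<epsilon>1" for \<epsilon>
  proof -
    show "c / (1 - \<delta>) * \<epsilon> powr (1 - \<delta>) \<le> measure lborel (parallel_set F \<epsilon> \<inter> B)"
      using lw[OF \<epsilon>] unfolding fin[OF \<epsilon>] by (subst (asm) ennreal_le_iff) simp_all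
    have "0 \<le> C / (1 - \<delta>) * \<epsilon> powr (1 - \<delta>)" using b(2) d by simp
    then show "measure lborel (parallel_set F \<epsilon> \<inter> B) \<le> C / (1 - \<delta>) * \<epsilon> powr (1 - \<delta>)"
      using up[OF \<epsilon>] unfolding fin[OF \<epsilon>] by (subst (asm) ennreal_le_iff)
  qed
  have l1: "c / (1 - \<delta>) \<le> scaled_volume \<epsilon>" and u1: "scaled_volume \<epsilon> \<le> C / (1 - \<delta>)" if \<epsilon>: "0 < \<epsilon>" "\<epsilon> \<le> \<epsilon>1" for \<epsilon>
    using mult_left_mono[OF V(1)[OF \<epsilon>], of "\<epsilon> powr (\<delta> - 1)"] mult_left_mono[OF V(2)[OF \<epsilon>], of "\<epsilon> powr (\<delta> - 1)"]
    unfolding pw(2)[OF \<epsilon>(1)] scaled_volume_def by simp_all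
  show thesis
  proof (rule that[of "min (c / 2) (c / (1 - \<delta>))" "max (C / 2) (C / (1 - \<delta>))"])
    show "0 < min (c / 2) (c / (1 - \<delta>))" using b(1) d by simp
    show "upper_curv0 F B = Limsup (at_right 0) (\<lambda>\<epsilon>. ennreal (scaled_count \<epsilon>))"
      unfolding upper_curv0_def by (rule Limsup_eq) (use ev in eventually_elim, rule c0, auto)
    show "lower_curv0 F B = Liminf (at_right 0) (\<lambda>\<epsilon>. ennreal (scaled_count \<epsilon>))"
      unfolding lower_curv0_def by (rule Liminf_eq) (use ev in eventually_elim, rule c0, auto)
    show "upper_curv1 F B = Limsup (at_right 0) (\<lambda>\<epsilon>. ennreal (scaled_volume \<epsilon>))"
      unfolding upper_curv1_def by (rule Limsup_eq) (use ev in eventually_elim, rule c1, auto)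
    show "lower_curv1 F B = Liminf (at_right 0) (\<lambda>\<epsilon>. ennreal (scaled_volume \<epsilon>))"
      unfolding lower_curv1_def by (rule Liminf_eq) (use ev in eventually_elim, rule c1, auto)
    show "\<forall>\<^sub>F \<epsilon> in at_right 0. min (c / 2) (c / (1 - \<delta>)) \<le> scaled_count \<epsilon>"
      using ev by eventually_elim (meson l0 min.coboundedI1)
    show "\<forall>\<^sub>F \<epsilon> in at_right 0. scaled_count \<epsilon> \<le> max (C / 2) (C / (1 - \<delta>))"
      using ev by eventually_elim (meson u0 max.coboundedI1)
    show "\<forall>\<^sub>F \<epsilon> in at_right 0. min (c / 2) (c / (1 - \<delta>)) \<le> scaled_volume \<epsilon>"
      using ev by eventually_elim (meson l1 min.coboundedI2)
    show "\<forall>\<^sub>F \<epsilon> in at_right 0. scaled_volume \<epsilon> \<le> max (C / 2) (C / (1 - \<delta>))"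
      using ev by eventually_elim (meson u1 max.coboundedI2)
    show "\<forall>\<^sub>F \<epsilon> in at_right 0. emeasure lborel (parallel_set F \<epsilon> \<inter> B) < \<infinity>"
      using ev
    proof eventually_elim
      case (elim \<epsilon>)
      then have "emeasure lborel (parallel_set F \<epsilon> \<inter> B) \<le> ennreal (C / (1 - \<delta>) * \<epsilon> powr (1 - \<delta>))"
        by (intro up) auto
      then show ?case unfolding infinity_ennreal_def by (rule le_less_trans) (rule ennreal_less_top)
    qed
  qed
qed

text \<open>Both cases are argued by contradiction along sequences x * q n with x in the
  exponentiated window: a limit c would be attained for every such x, which prescribes how count and
  volume vary with x.\<close>

lemma curv_strict:
  assumes lat: "lattice_ifs N r"
  shows "(0 < lower_curv0 F B \<and> lower_curv0 F B < upper_curv0 F B \<and> upper_curv0 F B < \<infinity>) \<and>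
    (0 < lower_curv1 F B \<and> lower_curv1 F B < upper_curv1 F B \<and> upper_curv1 F B < \<infinity>)"
proof -
  have "1 \<le> N" using two_maps by simp
  then obtain h where h: "0 < h" "\<And>i. i \<in> {1..N} \<Longrightarrow> \<exists>k::int. ln (r i) = h * of_int k"
    using lattice_ifs_log_ratios[OF lat conjI[OF ratio]] by blast
  obtain \<alpha> \<beta> where w: "\<alpha> < \<beta>"
    "\<And>C n. C \<in> gaps F \<Longrightarrow> \<not> (\<alpha> < ln (measure lborel C / 2) + h * real n \<and> ln (measure lborel C / 2) + h * real n < \<beta>)"
    using lattice_window[OF h] by blast
  \<comment> \<open>Multiplication of \<epsilon> by q n shifts its logarithm by -h n, so the
    products x * q n run through copies of one window at ever smaller scales.\<close>
  define q where "q = (\<lambda>n. exp (- h * real n))"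
  have q: "0 < q n" "ln (q n) = - h * real n" for n by (simp_all add: q_def)
  have "filterlim (\<lambda>n. - h * real n) at_bot sequentially"
    using h(1) by (intro filterlim_tendsto_neg_mult_at_bot[OF tendsto_const] filterlim_real_sequentially) simp
  then have q0: "q \<longlonglongrightarrow> 0" unfolding q_def by (rule filterlim_compose[OF exp_at_bot])
  have seq: "filterlim (\<lambda>n. x * q n) (at_right 0) sequentially" if x: "0 < x" for x
  proof (rule filterlim_at_withinI)
    show "(\<lambda>n. x * q n) \<longlonglongrightarrow> 0" using tendsto_mult[OF tendsto_const q0, of x] by simp
    show "\<forall>\<^sub>F n in sequentially. x * q n \<in> {0<..} - {0}" using x q(1) by simp
  qed
  \<comment> \<open>A gap counted at x * q n but not at y * q n would have the logarithm of its
    half-length, increased by h n, in the window.\<close>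
  have const: "count_B (x * q n) = count_B (y * q n)" if xy: "exp \<alpha> < x" "x \<le> y" "y < exp \<beta>" for x y n
  proof -
    have pos: "0 < x" "0 < y" using xy exp_gt_zero[of \<alpha>] by linarith+
    have "ln (exp \<alpha>) < ln x" "ln y < ln (exp \<beta>)"
      using ln_less_cancel_iff[of "exp \<alpha>" x] ln_less_cancel_iff[of y "exp \<beta>"] xy pos by simp_all
    then have logs: "\<alpha> < ln x" "ln y < \<beta>" by simp_all
    have "long_gaps (2 * (x * q n)) = long_gaps (2 * (y * q n))"
    proof (intro equalityI)
      show "long_gaps (2 * (y * q n)) \<subseteq> long_gaps (2 * (x * q n))"
        using xy(2) q(1)[of n] by (intro long_gaps_antimono) simp
      show "long_gaps (2 * (x * q n)) \<subseteq> long_gaps (2 * (y * q n))"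
      proof
        fix C assume "C \<in> long_gaps (2 * (x * q n))"
        then have C: "C \<in> gaps F" "2 * (x * q n) < measure lborel C" by (simp_all add: long_gaps_def)
        have "2 * (y * q n) < measure lborel C"
        proof (rule ccontr)
          assume n: "\<not> 2 * (y * q n) < measure lborel C"
          have "ln (x * q n) < ln (measure lborel C / 2)"
            using C(2) pos q(1)[of n] gap_length_pos[OF C(1)] by (subst ln_less_cancel_iff) auto
          moreover have "ln (measure lborel C / 2) \<le> ln (y * q n)"
            using n pos q(1)[of n] gap_length_pos[OF C(1)] by (subst ln_le_cancel_iff) auto
          moreover have "ln (x * q n) = ln x - h * real n" "ln (y * q n) = ln y - h * real n"
            using pos q[of n] by (simp_all add: ln_mult_pos)
          ultimately show False using w(2)[OF C(1), of n] logs by linarith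
        qed
        then show "C \<in> long_gaps (2 * (y * q n))" using C(1) by (simp add: long_gaps_def)
      qed
    qed
    then show ?thesis by (simp add: count_B_def)
  qed
  \<comment> \<open>The points x1 and x3 divide the window in thirds on the logarithmic scale and so
    stay strictly inside. But x2 is their arithmetic midpoint, since the volume is affine in
    \<epsilon> and not in its logarithm.\<close>
  define x1 where "x1 = exp ((2 * \<alpha> + \<beta>) / 3)"
  define x3 where "x3 = exp ((\<alpha> + 2 * \<beta>) / 3)"
  define x2 where "x2 = (x1 + x3) / 2"
  have x: "exp \<alpha> < x1" "x1 < x2" "x2 < x3" "x3 < exp \<beta>" "0 < x1"
  proof -
    have "x1 < x3" using w(1) by (simp add: x1_def x3_def)
    then show "x1 < x2" "x2 < x3" by (simp_all add: x2_def)
  qed (use w(1) in \<open>simp_all add: x1_def x3_def\<close>)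
  have xpos: "0 < x2" "0 < x3" using x by linarith+
  obtain k K where curv: "0 < k"
    "upper_curv0 F B = Limsup (at_right 0) (\<lambda>\<epsilon>. ennreal (scaled_count \<epsilon>))"
    "lower_curv0 F B = Liminf (at_right 0) (\<lambda>\<epsilon>. ennreal (scaled_count \<epsilon>))"
    "upper_curv1 F B = Limsup (at_right 0) (\<lambda>\<epsilon>. ennreal (scaled_volume \<epsilon>))"
    "lower_curv1 F B = Liminf (at_right 0) (\<lambda>\<epsilon>. ennreal (scaled_volume \<epsilon>))"
    "\<forall>\<^sub>F \<epsilon> in at_right 0. k \<le> scaled_count \<epsilon>" "\<forall>\<^sub>F \<epsilon> in at_right 0. scaled_count \<epsilon> \<le> K"
    "\<forall>\<^sub>F \<epsilon> in at_right 0. k \<le> scaled_volume \<epsilon>" "\<forall>\<^sub>F \<epsilon> in at_right 0. scaled_volume \<epsilon> \<le> K"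
    "\<forall>\<^sub>F \<epsilon> in at_right 0. emeasure lborel (parallel_set F \<epsilon> \<inter> B) < \<infinity>"
    by (rule curv_eq_scaled)
  have no0: "\<not> (scaled_count \<longlongrightarrow> c) (at_right 0)" if c: "0 < c" for c
  proof
    assume lim: "(scaled_count \<longlongrightarrow> c) (at_right 0)"
    have 1: "(\<lambda>n. scaled_count (x1 * q n)) \<longlonglongrightarrow> c" by (rule filterlim_compose[OF lim seq[OF x(5)]])
    have 2: "(\<lambda>n. scaled_count (x2 * q n)) \<longlonglongrightarrow> c" by (rule filterlim_compose[OF lim seq[OF xpos(1)]])
    have "scaled_count (x2 * q n) = (x2 / x1) powr \<delta> * scaled_count (x1 * q n)" for n
    \<comment> \<open>The counts at x1 * q n and x2 * q n agree, so the scaled values differ by the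
      fixed factor (x2 / x1)^\<delta> > 1; they cannot have the same positive limit.\<close>
    proof -
      have "count_B (x2 * q n) = count_B (x1 * q n)" using x by (intro const[symmetric]) auto
      moreover have "(x2 * q n) powr \<delta> = (x2 / x1) powr \<delta> * (x1 * q n) powr \<delta>"
        using x(5) xpos q(1)[of n] by (subst powr_mult[symmetric]) auto
      ultimately show ?thesis by (simp add: scaled_count_def)
    qed
    then have "(\<lambda>n. scaled_count (x2 * q n)) \<longlonglongrightarrow> (x2 / x1) powr \<delta> * c"
      using tendsto_mult[OF tendsto_const 1] by simp
    then have "(x2 / x1) powr \<delta> * c = c" using 2 by (rule LIMSEQ_unique)
    moreover have "1 < (x2 / x1) powr \<delta>"
      using x \<delta>_pos by (intro gr_one_powr) auto
    ultimately show False using c by simp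
  qed
  have no1: "\<not> (scaled_volume \<longlongrightarrow> c) (at_right 0)" if c: "0 < c" for c
  proof
    assume lim: "(scaled_volume \<longlongrightarrow> c) (at_right 0)"
    \<comment> \<open>Multiplication by y^(1 - \<delta>) removes the dependence on y from the
      normalisation, leaving q n^(\<delta> - 1) times the volume. Volumes at different y thereby
      become comparable.\<close>
    have L: "(\<lambda>n. y powr (1 - \<delta>) * scaled_volume (y * q n)) \<longlonglongrightarrow> y powr (1 - \<delta>) * c" if "0 < y" for y
      by (intro tendsto_mult tendsto_const filterlim_compose[OF lim seq[OF that]])
    have vol: "y powr (1 - \<delta>) * scaled_volume (y * q n) = q n powr (\<delta> - 1) * measure lborel (parallel_set F (y * q n) \<inter> B)"
      if "0 < y" for y n
    proof -
      have "(y * q n) powr (\<delta> - 1) = y powr (\<delta> - 1) * q n powr (\<delta> - 1)" by (rule powr_mult)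
      moreover have "y powr (1 - \<delta>) * y powr (\<delta> - 1) = 1" using that by (simp flip: powr_add)
      ultimately show ?thesis unfolding scaled_volume_def by (simp add: mult.assoc[symmetric])
    qed
    \<comment> \<open>On the interval from x1 * q n to x3 * q n the count is constant, so the volume
      at the midpoint is the mean of those at the ends. In the limit this would give equality in the
      midpoint inequality for the power 1 - \<delta>.\<close>
    have "\<forall>\<^sub>F n in sequentially. x1 powr (1 - \<delta>) * scaled_volume (x1 * q n) + x3 powr (1 - \<delta>) * scaled_volume (x3 * q n) =
        2 * (x2 powr (1 - \<delta>) * scaled_volume (x2 * q n))"
    proof -
      have ev: "\<forall>\<^sub>F \<epsilon> in at_right 0. emeasure lborel (parallel_set F \<epsilon> \<inter> B) < \<infinity> \<and> \<epsilon> < \<epsilon>0"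
        using curv(10) eventually_at_right_le[of "\<epsilon>0 / 2"] \<epsilon>0_pos by (auto elim: eventually_elim2)
      have "\<forall>\<^sub>F n in sequentially. emeasure lborel (parallel_set F (x2 * q n) \<inter> B) < \<infinity> \<and> x2 * q n < \<epsilon>0"
        by (rule eventually_compose_filterlim[OF ev seq[OF xpos(1)]])
      moreover have "\<forall>\<^sub>F n in sequentially. emeasure lborel (parallel_set F (x3 * q n) \<inter> B) < \<infinity> \<and> x3 * q n < \<epsilon>0"
        by (rule eventually_compose_filterlim[OF ev seq[OF xpos(2)]])
      ultimately show ?thesis
      proof eventually_elim
        case (elim n)
        let ?V = "\<lambda>y. measure lborel (parallel_set F (y * q n) \<inter> B)"
        have cB: "count_B s = count_B (x1 * q n)" if s: "x1 * q n \<le> s" "s \<le> x3 * q n" for s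
        proof -
          have "count_B (x1 * q n) = count_B (s / q n * q n)"
          proof (rule const)
            show "x1 \<le> s / q n" using s(1) q(1)[of n] by (simp add: pos_le_divide_eq)
            have "s / q n \<le> x3" using s(2) q(1)[of n] by (simp add: pos_divide_le_eq)
            then show "s / q n < exp \<beta>" using x(4) by simp
          qed (rule x(1))
          then show ?thesis using q(1)[of n] by simp
        qed
        have le: "x1 * q n \<le> x2 * q n" "x2 * q n \<le> x3 * q n" using x q(1)[of n] by simp_all
        have "?V x2 = ?V x1 + count_B (x1 * q n) * (x2 * q n - x1 * q n)"
        proof (rule volume_B_increment[OF _ le(1)])
          fix s assume "x1 * q n \<le> s" "s \<le> x2 * q n"
          then show "count_B s = count_B (x1 * q n)" using le(2) by (intro cB order_trans[OF _ le(2)])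
        qed (use elim(1) mult_pos_pos[OF x(5) q(1)] in blast)+
        moreover have "?V x3 = ?V x2 + count_B (x1 * q n) * (x3 * q n - x2 * q n)"
        proof (rule volume_B_increment[OF _ le(2)])
          fix s assume "x2 * q n \<le> s" "s \<le> x3 * q n"
          then show "count_B s = count_B (x1 * q n)" by (intro cB order_trans[OF le(1)])
        qed (use elim(2) mult_pos_pos[OF xpos(1) q(1)] in blast)+
        moreover have "x3 * q n - x2 * q n = x2 * q n - x1 * q n" by (simp add: x2_def field_simps)
        ultimately have "?V x1 + ?V x3 = 2 * ?V x2" by simp
        then have "q n powr (\<delta> - 1) * ?V x1 + q n powr (\<delta> - 1) * ?V x3 = 2 * (q n powr (\<delta> - 1) * ?V x2)"
          by (metis distrib_left mult.left_commute)
        then show ?case unfolding vol[OF x(5)] vol[OF xpos(1)] vol[OF xpos(2)] .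
      qed
    qed
    moreover have "(\<lambda>n. x1 powr (1 - \<delta>) * scaled_volume (x1 * q n) + x3 powr (1 - \<delta>) * scaled_volume (x3 * q n)) \<longlonglongrightarrow>
        x1 powr (1 - \<delta>) * c + x3 powr (1 - \<delta>) * c"
      by (rule tendsto_add[OF L[OF x(5)] L[OF xpos(2)]])
    ultimately have "(\<lambda>n. 2 * (x2 powr (1 - \<delta>) * scaled_volume (x2 * q n))) \<longlonglongrightarrow>
        x1 powr (1 - \<delta>) * c + x3 powr (1 - \<delta>) * c"
      by (rule Lim_transform_eventually[rotated])
    moreover have "(\<lambda>n. 2 * (x2 powr (1 - \<delta>) * scaled_volume (x2 * q n))) \<longlonglongrightarrow> 2 * (x2 powr (1 - \<delta>) * c)"
      by (rule tendsto_mult[OF tendsto_const L[OF xpos(1)]])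
    ultimately have "x1 powr (1 - \<delta>) * c + x3 powr (1 - \<delta>) * c = 2 * (x2 powr (1 - \<delta>) * c)"
      by (rule LIMSEQ_unique)
    then have "(x1 powr (1 - \<delta>) + x3 powr (1 - \<delta>)) * c = (2 * x2 powr (1 - \<delta>)) * c" by (simp add: distrib_right)
    then have "x1 powr (1 - \<delta>) + x3 powr (1 - \<delta>) = 2 * x2 powr (1 - \<delta>)" using c by simp
    moreover have "x1 powr (1 - \<delta>) + x3 powr (1 - \<delta>) < 2 * x2 powr (1 - \<delta>)"
      unfolding x2_def using x \<delta>_pos \<delta>_less_1 by (intro powr_strictly_midpoint_concave) auto
    ultimately show False by simp
  qed
  show ?thesis
    unfolding curv(2-5)
    using Liminf_less_Limsup[OF curv(1,6,7) no0] Liminf_less_Limsup[OF curv(1,8,9) no1] by blast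
qed

end

theorem theorem2p11:
  fixes X F :: "real set" and N :: nat and \<phi> :: "nat \<Rightarrow> real \<Rightarrow> real" and r :: "nat \<Rightarrow> real"
    and \<delta> :: real and \<nu> :: "real measure"
  assumes "similarity_ifs X N \<phi> r"
    and "self_similar_set X N \<phi> F"
    and "feasible_open_set N \<phi> (interior X)"
    and "emeasure lborel F = 0"
    and "\<delta> = minkowski_dim F"
    and "conformal_measure X N \<phi> r F \<delta> \<nu>"
  shows "weak_limit (avg_curv0 F)
           (scale_measure (ennreal
             (2 powr (- \<delta>) * (\<Sum>L\<in>primary_gaps N \<phi> F. measure lborel L powr \<delta>)
               / (- \<delta> * (\<Sum>i\<in>{1..N}. ln (r i) * r i powr \<delta>)))) \<nu>)
           (at_right 0)
       \<and> weak_limit (avg_curv1 F)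
           (scale_measure (ennreal
             (2 powr (1 - \<delta>) * (\<Sum>L\<in>primary_gaps N \<phi> F. measure lborel L powr \<delta>)
               / ((\<delta> - 1) * \<delta> * (\<Sum>i\<in>{1..N}. ln (r i) * r i powr \<delta>)))) \<nu>)
           (at_right 0)
       \<and> (lattice_ifs N r \<longrightarrow>
           (\<forall>B\<in>sets borel.
              F \<inter> B \<noteq> {} \<and>
              (\<exists>W. finite W \<and> W \<subseteq> lists {1..N} \<and> F \<inter> B = (\<Union>w\<in>W. word_map \<phi> w ` F)) \<and>
              (\<forall>\<^sub>F \<epsilon> in at_right 0. parallel_set F \<epsilon> \<inter> B = parallel_set (F \<inter> B) \<epsilon>)
              \<longrightarrow>
              (0 < lower_curv0 F B \<and> lower_curv0 F B < upper_curv0 F B \<and> upper_curv0 F B < \<infinity>) \<and>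
              (0 < lower_curv1 F B \<and> lower_curv1 F B < upper_curv1 F B \<and> upper_curv1 F B < \<infinity>)))"
proof (intro conjI impI ballI)
  interpret conformal_ifs X F N \<phi> r \<delta> \<nu>
    by unfold_locales (use assms in simp_all)
  show "weak_limit (avg_curv0 F) (scale_measure (ennreal
      (2 powr (- \<delta>) * (\<Sum>L\<in>primary_gaps N \<phi> F. measure lborel L powr \<delta>)
        / (- \<delta> * (\<Sum>i\<in>{1..N}. ln (r i) * r i powr \<delta>)))) \<nu>) (at_right 0)"
    using weak_limit_avg_curv0 unfolding limit_const_formula(1) .
  show "weak_limit (avg_curv1 F) (scale_measure (ennreal
      (2 powr (1 - \<delta>) * (\<Sum>L\<in>primary_gaps N \<phi> F. measure lborel L powr \<delta>)
        / ((\<delta> - 1) * \<delta> * (\<Sum>i\<in>{1..N}. ln (r i) * r i powr \<delta>)))) \<nu>) (at_right 0)"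
    using weak_limit_avg_curv1 unfolding limit_const_formula(2) .
  fix B :: "real set"
  assume lat: "lattice_ifs N r" and B: "B \<in> sets borel"
    and hyp: "F \<inter> B \<noteq> {} \<and>
      (\<exists>W. finite W \<and> W \<subseteq> lists {1..N} \<and> F \<inter> B = (\<Union>w\<in>W. word_map \<phi> w ` F)) \<and>
      (\<forall>\<^sub>F \<epsilon> in at_right 0. parallel_set F \<epsilon> \<inter> B = parallel_set (F \<inter> B) \<epsilon>)"
  obtain W where W: "finite W" "W \<subseteq> lists {1..N}" "F \<inter> B = (\<Union>w\<in>W. word_map \<phi> w ` F)"
    using hyp by blast
  from conjunct2[OF conjunct2[OF hyp]]
  obtain \<epsilon>0 where \<epsilon>0: "0 < \<epsilon>0"
    "\<And>\<epsilon>. 0 < \<epsilon> \<Longrightarrow> \<epsilon> < \<epsilon>0 \<Longrightarrow> parallel_set F \<epsilon> \<inter> B = parallel_set (F \<inter> B) \<epsilon>"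
    unfolding eventually_at_right_field by blast
  interpret cylinder_union X F N \<phi> r \<delta> \<nu> B W \<epsilon>0
    by unfold_locales (rule B conjunct1[OF hyp] W \<epsilon>0; assumption)+
  note strict = curv_strict[OF lat]
  show "0 < lower_curv0 F B" "lower_curv0 F B < upper_curv0 F B" "upper_curv0 F B < \<infinity>"
    "0 < lower_curv1 F B" "lower_curv1 F B < upper_curv1 F B" "upper_curv1 F B < \<infinity>"
    using strict by blast+
qed

end
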